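(* Let $l>0$, $a_1,a_2,b_1,b_2>0$, $c_1,c_2\ge 0$, $p_1\ge 0$, $p_2\le 0$, $q_1\le 0$, $q_2\ge 0$ be constants, and let $K_m=\max\Big\{\frac{1}{\sqrt{a_1}},\frac{1}{\sqrt{a_2}},\frac{l^2}{2\sqrt{a_2}},\frac{l^4}{4\sqrt{a_1}}\Big\}$. Assume that there exist $r_1,\dots,r_{14}>0$ and $\varepsilon_1,\varepsilon_2\in\big(0,\min\{1,\tfrac{1}{K_m}\}\big)$ such that $$\varepsilon_2+\Lambda_1+\frac{4}{l^4}(\Lambda_6-b_1)<0,\qquad \Lambda_2-\varepsilon_2a_1<0,$$ $$\varepsilon_1+\Lambda_3+\frac{2}{l^2}(\Lambda_5-b_2)<0,\qquad \Lambda_4-\varepsilon_1a_2<0,$$ where $$\Lambda_1=\tfrac12\big(c_1r_1+p_1r_2-2q_1+r_7-\varepsilon_2q_1r_5\big)+\tfrac{q_2}{2}\big(r_2+\varepsilon_1r_1\big),$$ $$\Lambda_2=\frac{\varepsilon_2}{2r_{12}}+\frac{\varepsilon_2l^4}{8}\Big(c_1r_3+p_1r_4-\frac{q_1}{r_5}+r_8\Big)+\frac{\varepsilon_2^2l^3r_{13}}{2},$$ $$\Lambda_3=\frac{p_1}{2}\Big(\frac1{r_2}+\frac{\varepsilon_2}{r_4}\Big)+\frac12\Big(c_2r_6-2p_2+\frac{q_2}{r_2}+r_9-\varepsilon_1p_2r_6\Big),$$ $$\Lambda_4=\frac{\varepsilon_1}{2r_{11}}+\frac{c_1l^2}{4}\Big(\frac1{r_1}+\frac{\varepsilon_2}{r_3}\Big)+\frac{l^2}{4}\Big(\frac{c_2}{r_6}+2\varepsilon_1c_2-\frac{\varepsilon_1p_2}{r_6}+\frac{\varepsilon_1q_2}{r_1}+\varepsilon_1r_{10}\Big)+l\,r_{14}\,\varepsilon_1^2,$$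 $$\Lambda_5=\frac{\varepsilon_1}{2}r_{11}+l\,r_{14},\qquad \Lambda_6=\frac{\varepsilon_2}{2}r_{12}+\frac{l^3r_{13}}{2}.$$ Then the beam-string system (S) described in the context is EISS and EiISS with respect to disturbances $d_1,d_2\in C^1(\mathbb{R}_{\ge 0};L^2(0,l))$ and $d_3,d_4\in C^2(\mathbb{R}_{\ge 0})$. More precisely, there exist constants $C>0$ and $\mu_m>0$, independent of $t$, of the initial datum and of the disturbances, such that for all such $d_1,d_2,d_3,d_4$ and every $X_0\in D(\mathcal{A}_{1,d})$ with $\mathcal{B}X_0=(d_3(0),d_4(0))$, the corresponding solution $X=(w,w_t,\phi,\phi_t)$ satisfies, for all $t\ge 0$, $$\|X(\cdot,t)\|_{\mathcal{H}}\le Ce^{-\frac{\mu_m}{4}t}\|X_0\|_{\mathcal{H}}+C\big(\|d_1\|_{L^\infty(0,t;L^2(0,l))}+\|d_2\|_{L^\infty(0,t;L^2(0,l))}\big)+C\big(\|d_3\|_{L^\infty(0,t)}+\|d_4\|_{L^\infty(0,t)}\big)$$ and $$\|X(\cdot,t)\|_{\mathcal{H}}\le Ce^{-\frac{\mu_m}{4}t}\|X_0\|_{\mathcal{H}}+C\Big(\int_0^t\|d_1(\cdot,s)\|_{L^2(0,l)}^2ds\Big)^{1/2}+C\Big(\int_0^t\|d_2(\cdot,s)\|_{L^2(0,l)}^2ds\Big)^{1/2}+C\Big(\int_0^td_3^2(s)ds\Big)^{1/2}+C\Big(\int_0^td_4^2(s)ds\Big)^{1/2}.$$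
   Context: Notation: $\mathbb{R}_{\ge 0}=[0,\infty)$; subscripts $y,t$ denote partial derivatives; $\mathrm{AC}[0,l]$ is the set of absolutely continuous functions on $[0,l]$; $\|f\|_{L^\infty(0,t;L^2(0,l))}=\operatorname{ess\,sup}_{0<s<t}\|f(\cdot,s)\|_{L^2(0,l)}$. System (S): for $(y,t)\in(0,l)\times\mathbb{R}_{\ge 0}$, $$w_{tt}+(a_1w_{yy}+b_1w_{tyy})_{yy}=c_1\phi+p_1\phi_t+q_1w_t+d_1,\qquad \phi_{tt}-(a_2\phi_y+b_2\phi_{ty})_y=c_2\phi+p_2\phi_t+q_2w_t+d_2,$$ with $w(0,t)=w_y(0,t)=\phi(0,t)=0$, $(a_1w_{yy}+b_1w_{tyy})_y(l,t)=d_3(t)$, $(a_2\phi_y+b_2\phi_{ty})(l,t)=d_4(t)$, and initial data $X_0=(w,w_t,\phi,\phi_t)|_{t=0}$. Here $d_1,d_2$ are in-domain disturbances (functions of $(y,t)$) and $d_3,d_4$ boundary disturbances (functions of $t$). State space: $\mathcal{H}=\{(f,g,h,z)\in H^2(0,l)\times L^2(0,l)\times H^1(0,l)\times L^2(0,l): f(0)=f_y(0)=h(0)=0,\ f,f_y,h\in\mathrm{AC}[0,l]\}$ with norm $\|(f,g,h,z)\|_{\mathcal H}^2=\int_0^l(a_1f_{yy}^2+g^2+a_2h_y^2+z^2)\,dy$. $D(\mathcal{A}_{1,d})$ is the set of $(f,g,h,z)\in\mathcal{H}$ such that $g\in H^2(0,l)$, $z\in H^1(0,l)$, $a_1f_{yy}+b_1g_{yy}\in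 H^2(0,l)$, $a_2h_y+b_2z_y\in H^1(0,l)$, $f(0)=f_y(0)=g(0)=g_y(0)=h(0)=z(0)=0$, $(a_1f_{yy}+b_1g_{yy})(l)=0$, and $f,f_y,g,g_y,h,z,\ a_1f_{yy}+b_1g_{yy},\ (a_1f_{yy}+b_1g_{yy})_y,\ a_2h_y+b_2z_y\in\mathrm{AC}[0,l]$. On it, $\mathcal{A}_{1,d}(f,g,h,z)=(g,-(a_1f_{yy}+b_1g_{yy})_{yy},z,(a_2h_y+b_2z_y)_y)$ and $\mathcal{B}(f,g,h,z)=((a_1f_{yy}+b_1g_{yy})_y(l),(a_2h_y+b_2z_y)(l))\in\mathbb{R}^2$. Solution: for $X_0\in D(\mathcal{A}_{1,d})$ with $\mathcal{B}X_0=(d_3(0),d_4(0))$, the solution of (S) is the unique $X=(w,w_t,\phi,\phi_t)\in C^0(\mathbb{R}_{\ge 0};D(\mathcal{A}_{1,d}))\cap C^1(\mathbb{R}_{\ge 0};\mathcal{H})$ (with $D(\mathcal{A}_{1,d})$ carrying the graph norm) satisfying $X(0)=X_0$, the evolution equations of (S), and $\mathcal{B}X(t)=(d_3(t),d_4(t))$ for all $t\ge 0$. $\mathcal{K}$: continuous strictly increasing $\gamma:\mathbb{R}_{\ge 0}\to\mathbb{R}_{\ge 0}$ with $\gamma(0)=0$; $\mathcal{K}_\infty$: those $\gamma\in\mathcal{K}$ with $\gamma(s)\to\infty$ as $s\to\infty$. (S) is EISS (exponentially input-to-state stable) with respect to $d_1,\dots,d_4$ if there exist $\beta'\in\mathcal{K}_\infty$,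 $\lambda>0$, $\gamma_1,\dots,\gamma_4\in\mathcal{K}$ such that solutions satisfy, for all $t\ge0$, $\|X(\cdot,t)\|_{\mathcal H}\le\beta'(\|X_0\|_{\mathcal H})e^{-\lambda t}+\sum_{i=1}^2\gamma_i(\|d_i\|_{L^\infty(0,t;L^2(0,l))})+\sum_{i=3}^4\gamma_i(\|d_i\|_{L^\infty(0,t)})$. (S) is EiISS (exponentially integral input-to-state stable) if there exist $\beta'\in\mathcal{K}_\infty$, $\lambda>0$, $\theta_1,\dots,\theta_4\in\mathcal{K}_\infty$, $\gamma_1,\dots,\gamma_4\in\mathcal{K}$ such that solutions satisfy, for all $t\ge0$, $\|X(\cdot,t)\|_{\mathcal H}\le\beta'(\|X_0\|_{\mathcal H})e^{-\lambda t}+\sum_{i=1}^2\theta_i\big(\int_0^t\gamma_i(\|d_i(\cdot,s)\|_{L^2(0,l)})ds\big)+\sum_{i=3}^4\theta_i\big(\int_0^t\gamma_i(|d_i(s)|)ds\big)$. *)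

theory Defs
  imports "HOL-Probability.Essential_Supremum" "HOL-Library.Function_Algebras"
begin

instantiation "fun" :: (type, real_vector) real_vector
begin

definition scaleR_fun_def: "scaleR r f = (\<lambda>x. r *\<^sub>R f x)"

instance
  by standard (auto simp: scaleR_fun_def fun_eq_iff algebra_simps)

end


section \<open>Function spaces on the interval \<open>(0, l)\<close>\<close>

text \<open>
  Elements of \<open>L\<^sup>2(0,l)\<close>, \<open>H\<^sup>1(0,l)\<close>, \<open>H\<^sup>2(0,l)\<close> are represented by functions on the reals, of which
  only the class modulo equality almost everywhere on \<open>(0,l)\<close> matters: all predicates, norms and
  point evaluations below are invariant under that equivalence. The norms are
  accordingly seminorms on representatives.
\<close>

definition interval_measure :: "real \<Rightarrow> real measure"
  where "interval_measure l = lebesgue_on {0<..<l}"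

definition ae_eq :: "real \<Rightarrow> (real \<Rightarrow> real) \<Rightarrow> (real \<Rightarrow> real) \<Rightarrow> bool"
  where "ae_eq l f g \<longleftrightarrow> (AE y in interval_measure l. f y = g y)"

definition L2 :: "real \<Rightarrow> (real \<Rightarrow> real) set"
  where "L2 l = {f. f \<in> borel_measurable (interval_measure l) \<and>
                    integrable (interval_measure l) (\<lambda>y. (f y)\<^sup>2)}"

definition L2_norm :: "real \<Rightarrow> (real \<Rightarrow> real) \<Rightarrow> real"
  where "L2_norm l f = sqrt (LINT y|interval_measure l. (f y)\<^sup>2)"

definition AC :: "real \<Rightarrow> (real \<Rightarrow> real) \<Rightarrow> bool"
  where "AC l f \<longleftrightarrow>
    (\<forall>\<epsilon>>0. \<exists>\<delta>>0. \<forall>(n::nat) a b.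
       (\<forall>i<n. 0 \<le> a i \<and> a i \<le> b i \<and> b i \<le> l) \<and>
       disjoint_family_on (\<lambda>i. {a i<..<b i}) {..<n} \<and>
       (\<Sum>i<n. b i - a i) < \<delta> \<longrightarrow>
       (\<Sum>i<n. \<bar>f (b i) - f (a i)\<bar>) < \<epsilon>)"

text \<open>
  Membership of an almost-everywhere class in \<open>AC[0,l]\<close> means that it has an absolutely continuous
  representative; this representative is unique on \<open>[0,l]\<close>, and \<open>ev l u x\<close> is its value at
  \<open>x \<in> [0,l]\<close>.
\<close>

definition ACs :: "real \<Rightarrow> (real \<Rightarrow> real) set"
  where "ACs l = {u. \<exists>m. AC l m \<and> ae_eq l u m}"

definition ev :: "real \<Rightarrow> (real \<Rightarrow> real) \<Rightarrow> real \<Rightarrow> real"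
  where "ev l u x = (SOME m. AC l m \<and> ae_eq l u m) x"

definition test_function :: "real \<Rightarrow> (real \<Rightarrow> real) \<Rightarrow> bool"
  where "test_function l \<phi> \<longleftrightarrow>
    (\<forall>n x. (deriv ^^ n) \<phi> field_differentiable at x) \<and>
    (\<exists>K. compact K \<and> K \<subseteq> {0<..<l} \<and> (\<forall>x. x \<notin> K \<longrightarrow> \<phi> x = 0))"

definition locally_integrable :: "real \<Rightarrow> (real \<Rightarrow> real) \<Rightarrow> bool"
  where "locally_integrable l f \<longleftrightarrow>
    (\<forall>a b. 0 < a \<and> b < l \<longrightarrow> integrable (lebesgue_on {a..b}) f)"

definition weak_derivative :: "real \<Rightarrow> (real \<Rightarrow> real) \<Rightarrow> (real \<Rightarrow> real) \<Rightarrow> bool"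
  where "weak_derivative l f g \<longleftrightarrow>
    locally_integrable l f \<and> locally_integrable l g \<and>
    (\<forall>\<phi>. test_function l \<phi> \<longrightarrow>
       (LINT y|interval_measure l. f y * deriv \<phi> y) =
       - (LINT y|interval_measure l. g y * \<phi> y))"

text \<open>The weak derivative is unique up to equality almost everywhere.\<close>

definition wD :: "real \<Rightarrow> (real \<Rightarrow> real) \<Rightarrow> (real \<Rightarrow> real)"
  where "wD l f = (SOME g. weak_derivative l f g)"

definition H1 :: "real \<Rightarrow> (real \<Rightarrow> real) set"
  where "H1 l = {f. f \<in> L2 l \<and> (\<exists>g \<in> L2 l. weak_derivative l f g)}"

definition H2 :: "real \<Rightarrow> (real \<Rightarrow> real) set"
  where "H2 l = {f. f \<in> H1 l \<and> wD l f \<in> H1 l}"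


section \<open>Functions of time\<close>

definition C0_into :: "('v::real_vector \<Rightarrow> real) \<Rightarrow> 'v set \<Rightarrow> (real \<Rightarrow> 'v) \<Rightarrow> bool"
  where "C0_into N V u \<longleftrightarrow>
    (\<forall>t\<ge>0. u t \<in> V) \<and>
    (\<forall>t\<ge>0. ((\<lambda>s. N (u s - u t)) \<longlongrightarrow> 0) (at t within {0..}))"

definition has_time_derivative ::
    "('v::real_vector \<Rightarrow> real) \<Rightarrow> (real \<Rightarrow> 'v) \<Rightarrow> (real \<Rightarrow> 'v) \<Rightarrow> bool"
  where "has_time_derivative N u u' \<longleftrightarrow>
    (\<forall>t\<ge>0. ((\<lambda>s. N ((1 / (s - t)) *\<^sub>R (u s - u t) - u' t)) \<longlongrightarrow> 0) (at t within {0..}))"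

definition C1_into :: "('v::real_vector \<Rightarrow> real) \<Rightarrow> 'v set \<Rightarrow> (real \<Rightarrow> 'v) \<Rightarrow> bool"
  where "C1_into N V u \<longleftrightarrow>
    C0_into N V u \<and> (\<exists>u'. C0_into N V u' \<and> has_time_derivative N u u')"

definition C2_real :: "(real \<Rightarrow> real) \<Rightarrow> bool"
  where "C2_real d \<longleftrightarrow>
    (\<exists>d' d''. (\<forall>t\<ge>0. (d has_real_derivative d' t) (at t within {0..})) \<and>
              (\<forall>t\<ge>0. (d' has_real_derivative d'' t) (at t within {0..})) \<and>
              continuous_on {0..} d'')"

text \<open>
  The \<open>L\<^sup>\<infinity>(0,t)\<close> norm. It is \<open>0\<close> for \<open>t = 0\<close>. An infinite essential supremum would also be sent
  to \<open>0\<close>, but it is only applied to functions that are continuous on \<open>[0,t]\<close>.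
\<close>

definition Linf_norm :: "real \<Rightarrow> (real \<Rightarrow> real) \<Rightarrow> real"
  where "Linf_norm t d = enn2real (esssup (lebesgue_on {0<..<t}) (\<lambda>s. ennreal \<bar>d s\<bar>))"

definition class_K :: "(real \<Rightarrow> real) set"
  where "class_K = {\<gamma>. continuous_on {0..} \<gamma> \<and> strict_mono_on {0..} \<gamma> \<and> \<gamma> 0 = 0}"

definition class_K_inf :: "(real \<Rightarrow> real) set"
  where "class_K_inf = {\<gamma>. \<gamma> \<in> class_K \<and> filterlim \<gamma> at_top at_top}"


section \<open>The beam-string system\<close>

type_synonym state = "(real \<Rightarrow> real) \<times> (real \<Rightarrow> real) \<times> (real \<Rightarrow> real) \<times> (real \<Rightarrow> real)"

locale beam_string =
  fixes l a1 a2 b1 b2 c1 c2 p1 p2 q1 q2 :: real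
begin

definition state_eq :: "state \<Rightarrow> state \<Rightarrow> bool"
  where "state_eq = (\<lambda>(f, g, h, z) (f', g', h', z').
    ae_eq l f f' \<and> ae_eq l g g' \<and> ae_eq l h h' \<and> ae_eq l z z')"

definition state_space :: "state set"
  where "state_space = {(f, g, h, z).
    f \<in> H2 l \<and> g \<in> L2 l \<and> h \<in> H1 l \<and> z \<in> L2 l \<and>
    f \<in> ACs l \<and> wD l f \<in> ACs l \<and> h \<in> ACs l \<and>
    ev l f 0 = 0 \<and> ev l (wD l f) 0 = 0 \<and> ev l h 0 = 0}"

definition state_norm :: "state \<Rightarrow> real"
  where "state_norm = (\<lambda>(f, g, h, z).
    sqrt (LINT y|interval_measure l.
      a1 * (wD l (wD l f) y)\<^sup>2 + (g y)\<^sup>2 + a2 * (wD l h y)\<^sup>2 + (z y)\<^sup>2))"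

definition moment :: "(real \<Rightarrow> real) \<Rightarrow> (real \<Rightarrow> real) \<Rightarrow> real \<Rightarrow> real"
  where "moment f g = (\<lambda>y. a1 * wD l (wD l f) y + b1 * wD l (wD l g) y)"

definition tension :: "(real \<Rightarrow> real) \<Rightarrow> (real \<Rightarrow> real) \<Rightarrow> real \<Rightarrow> real"
  where "tension h z = (\<lambda>y. a2 * wD l h y + b2 * wD l z y)"

definition dom_A :: "state set"
  where "dom_A = {(f, g, h, z).
    (f, g, h, z) \<in> state_space \<and>
    g \<in> H2 l \<and> z \<in> H1 l \<and> moment f g \<in> H2 l \<and> tension h z \<in> H1 l \<and>
    f \<in> ACs l \<and> wD l f \<in> ACs l \<and> g \<in> ACs l \<and> wD l g \<in> ACs l \<and> h \<in> ACs l \<and> z \<in> ACs l \<and>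
    moment f g \<in> ACs l \<and> wD l (moment f g) \<in> ACs l \<and> tension h z \<in> ACs l \<and>
    ev l f 0 = 0 \<and> ev l (wD l f) 0 = 0 \<and> ev l g 0 = 0 \<and> ev l (wD l g) 0 = 0 \<and>
    ev l h 0 = 0 \<and> ev l z 0 = 0 \<and> ev l (moment f g) l = 0}"

definition op_A :: "state \<Rightarrow> state"
  where "op_A = (\<lambda>(f, g, h, z).
    (g, \<lambda>y. - wD l (wD l (moment f g)) y, z, wD l (tension h z)))"

definition op_B :: "state \<Rightarrow> real \<times> real"
  where "op_B = (\<lambda>(f, g, h, z). (ev l (wD l (moment f g)) l, ev l (tension h z) l))"

definition graph_norm :: "state \<Rightarrow> real"
  where "graph_norm x = state_norm x + state_norm (op_A x)"

text \<open>
  In-domain disturbances take time as first and space as second argument, so that \<open>d1 t\<close> is an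
  element of \<open>L\<^sup>2(0,l)\<close>.
\<close>

definition forcing :: "(real \<Rightarrow> real) \<Rightarrow> (real \<Rightarrow> real) \<Rightarrow> state \<Rightarrow> state"
  where "forcing e1 e2 = (\<lambda>(f, g, h, z).
    (\<lambda>y. 0, \<lambda>y. c1 * h y + p1 * z y + q1 * g y + e1 y,
     \<lambda>y. 0, \<lambda>y. c2 * h y + p2 * z y + q2 * g y + e2 y))"

definition disturbances :: "(real \<Rightarrow> real \<Rightarrow> real) \<Rightarrow> (real \<Rightarrow> real \<Rightarrow> real) \<Rightarrow>
    (real \<Rightarrow> real) \<Rightarrow> (real \<Rightarrow> real) \<Rightarrow> bool"
  where "disturbances d1 d2 d3 d4 \<longleftrightarrow>
    C1_into (L2_norm l) (L2 l) d1 \<and> C1_into (L2_norm l) (L2 l) d2 \<and> C2_real d3 \<and> C2_real d4"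

text \<open>
  The equations of the system in first-order form. The first and third components of the
  evolution equation say that the second and fourth components of \<open>X\<close> are the time derivatives
  of the first and third ones.
\<close>

definition solution :: "(real \<Rightarrow> real \<Rightarrow> real) \<Rightarrow> (real \<Rightarrow> real \<Rightarrow> real) \<Rightarrow>
    (real \<Rightarrow> real) \<Rightarrow> (real \<Rightarrow> real) \<Rightarrow> state \<Rightarrow> (real \<Rightarrow> state) \<Rightarrow> bool"
  where "solution d1 d2 d3 d4 X0 X \<longleftrightarrow>
    X0 \<in> dom_A \<and> op_B X0 = (d3 0, d4 0) \<and>
    C0_into graph_norm dom_A X \<and>
    state_eq (X 0) X0 \<and>
    (\<exists>X'. C0_into state_norm state_space X' \<and> has_time_derivative state_norm X X' \<and>
          (\<forall>t\<ge>0. state_eq (X' t) (op_A (X t) + forcing (d1 t) (d2 t) (X t)))) \<and>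
    (\<forall>t\<ge>0. op_B (X t) = (d3 t, d4 t))"

definition EISS :: bool
  where "EISS \<longleftrightarrow>
    (\<exists>\<beta> \<in> class_K_inf. \<exists>\<kappa>>0. \<exists>\<gamma>1 \<in> class_K. \<exists>\<gamma>2 \<in> class_K. \<exists>\<gamma>3 \<in> class_K. \<exists>\<gamma>4 \<in> class_K.
     \<forall>d1 d2 d3 d4 X0 X. disturbances d1 d2 d3 d4 \<longrightarrow> solution d1 d2 d3 d4 X0 X \<longrightarrow>
     (\<forall>t\<ge>0. state_norm (X t) \<le> \<beta> (state_norm X0) * exp (- \<kappa> * t)
        + \<gamma>1 (Linf_norm t (\<lambda>s. L2_norm l (d1 s))) + \<gamma>2 (Linf_norm t (\<lambda>s. L2_norm l (d2 s)))
        + \<gamma>3 (Linf_norm t d3) + \<gamma>4 (Linf_norm t d4)))"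

definition EiISS :: bool
  where "EiISS \<longleftrightarrow>
    (\<exists>\<beta> \<in> class_K_inf. \<exists>\<kappa>>0.
     \<exists>\<theta>1 \<in> class_K_inf. \<exists>\<theta>2 \<in> class_K_inf. \<exists>\<theta>3 \<in> class_K_inf. \<exists>\<theta>4 \<in> class_K_inf.
     \<exists>\<gamma>1 \<in> class_K. \<exists>\<gamma>2 \<in> class_K. \<exists>\<gamma>3 \<in> class_K. \<exists>\<gamma>4 \<in> class_K.
     \<forall>d1 d2 d3 d4 X0 X. disturbances d1 d2 d3 d4 \<longrightarrow> solution d1 d2 d3 d4 X0 X \<longrightarrow>
     (\<forall>t\<ge>0. state_norm (X t) \<le> \<beta> (state_norm X0) * exp (- \<kappa> * t)
        + \<theta>1 (LINT s|lebesgue_on {0..t}. \<gamma>1 (L2_norm l (d1 s)))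
        + \<theta>2 (LINT s|lebesgue_on {0..t}. \<gamma>2 (L2_norm l (d2 s)))
        + \<theta>3 (LINT s|lebesgue_on {0..t}. \<gamma>3 \<bar>d3 s\<bar>)
        + \<theta>4 (LINT s|lebesgue_on {0..t}. \<gamma>4 \<bar>d4 s\<bar>)))"

end

end

(* The energy method: V adds small multiples of <w, w_t> and <phi, phi_t>, and of |w_yy|^2 and
   |phi_y|^2, to half the squared state norm. The last two terms are weighted by the damping
   coefficients, so that the cross terms <w_yy, w_tyy> and <phi_y, phi_ty> cancel in V'. Two
   integrations by parts in space leave the boundary disturbances only at y = l, where they are
   paired with traces that the damping and elastic terms control. Young's and Poincare's
   inequalities then give V' <= -k V + K (|d1|^2 + |d2|^2 + d3^2 + d4^2), and Gronwall's lemma gives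
   both estimates. To compute with weak derivatives, each function is replaced by an iterated
   integral of its highest derivative; this rests on the lemma of du Bois-Reymond. *)

theory Submission
  imports Defs
begin

section \<open>Smooth bump functions\<close>

definition smooth :: "(real \<Rightarrow> real) \<Rightarrow> bool"
  where "smooth f \<longleftrightarrow> (\<forall>n x. (deriv ^^ n) f field_differentiable at x)"

text \<open>A class of functions closed under \<open>deriv\<close> replaces explicit formulas for
  n-th derivatives; each application only has to name a suitable class.\<close>

lemma smooth_coinduct:
  assumes "P f" and step: "\<And>g. P g \<Longrightarrow> (\<forall>x. g field_differentiable at x) \<and> P (deriv g)"
  shows "smooth f"
proof -
  have "P ((deriv ^^ n) f)" for n
    by (induction n) (use assms in auto)
  then show ?thesis
    unfolding smooth_def using step by blast
qed

lemma smooth_differentiable: "smooth f \<Longrightarrow> f field_differentiable at x"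
  unfolding smooth_def by (metis funpow_0)

lemma smooth_deriv: "smooth f \<Longrightarrow> smooth (deriv f)"
  unfolding smooth_def by (metis comp_apply funpow_Suc_right)

lemma smooth_has_deriv: "smooth f \<Longrightarrow> (f has_real_derivative deriv f x) (at x)"
  using smooth_differentiable field_differentiable_derivI by blast

lemma smooth_continuous_on: "smooth f \<Longrightarrow> continuous_on A f"
  by (meson smooth_has_deriv DERIV_isCont continuous_at_imp_continuous_on)

lemma smooth_borel: "smooth f \<Longrightarrow> f \<in> borel_measurable borel"
  by (simp add: smooth_continuous_on borel_measurable_continuous_onI)

lemma smooth_antideriv:
  assumes "\<And>x. (F has_real_derivative f x) (at x)" "smooth f"
  shows "smooth F"
proof -
  have d: "deriv F = f"
    using assms(1) by (auto intro!: ext DERIV_imp_deriv)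
  have "(deriv ^^ n) F field_differentiable at x" for n x
  proof (cases n)
    case 0
    then show ?thesis using assms(1) field_differentiable_def by auto
  next
    case (Suc m)
    then have "(deriv ^^ n) F = (deriv ^^ m) f"
      by (simp add: funpow_swap1 d del: funpow.simps(2)) (simp add: d funpow_swap1)
    then show ?thesis using assms(2) by (simp add: smooth_def)
  qed
  then show ?thesis by (simp add: smooth_def)
qed

lemma smooth_const: "smooth (\<lambda>x. c)"
  by (rule smooth_coinduct[where P = "\<lambda>g. \<exists>c. g = (\<lambda>x. c)"]) auto

text \<open>Closing under products first makes coinduction applicable: the derivative of a product is a
  sum of products.\<close>

inductive smooth_ring :: "(real \<Rightarrow> real) \<Rightarrow> bool" where
  base: "smooth f \<Longrightarrow> smooth_ring f"
| add: "smooth_ring f \<Longrightarrow> smooth_ring g \<Longrightarrow> smooth_ring (\<lambda>x. f x + g x)"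
| mult: "smooth_ring f \<Longrightarrow> smooth_ring g \<Longrightarrow> smooth_ring (\<lambda>x. f x * g x)"

lemma smooth_ring_deriv:
  "smooth_ring f \<Longrightarrow> (\<forall>x. f field_differentiable at x) \<and> smooth_ring (deriv f)"
proof (induction rule: smooth_ring.induct)
  case (base f)
  then show ?case by (simp add: smooth_differentiable smooth_deriv smooth_ring.base)
next
  case (add f g)
  have "deriv (\<lambda>x. f x + g x) = (\<lambda>x. deriv f x + deriv g x)"
    using add by auto
  then show ?case
    using add by (auto intro: field_differentiable_add smooth_ring.add)
next
  case (mult f g)
  have "deriv (\<lambda>x. f x * g x) = (\<lambda>x. f x * deriv g x + deriv f x * g x)"
    using mult by (auto simp: fun_eq_iff)
  then show ?case
    using mult by (auto intro: field_differentiable_mult intro!: smooth_ring.add smooth_ring.mult)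
qed

lemma smooth_ring_smooth: "smooth_ring f \<Longrightarrow> smooth f"
  using smooth_coinduct[of smooth_ring] smooth_ring_deriv by blast

lemma smooth_add: "smooth f \<Longrightarrow> smooth g \<Longrightarrow> smooth (\<lambda>x. f x + g x)"
  and smooth_mult: "smooth f \<Longrightarrow> smooth g \<Longrightarrow> smooth (\<lambda>x. f x * g x)"
  by (auto intro: smooth_ring_smooth smooth_ring.intros)

lemma smooth_affine:
  assumes "smooth f"
  shows "smooth (\<lambda>x. f (m * x + b))"
\<comment> \<open>The factor \<open>k\<close> closes the class under \<open>deriv\<close>: every
  differentiation contributes another power of \<open>m\<close>.\<close>
proof (rule smooth_coinduct[where P = "\<lambda>g. \<exists>k f. smooth f \<and> g = (\<lambda>x. k * f (m * x + b))"])
  show "\<exists>k g. smooth g \<and> (\<lambda>x. f (m * x + b)) = (\<lambda>x. k * g (m * x + b))"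
    using assms by (intro exI[of _ 1] exI[of _ f]) auto
next
  fix g assume "\<exists>k f. smooth f \<and> g = (\<lambda>x. k * f (m * x + b))"
  then obtain k f where f: "smooth f" "g = (\<lambda>x. k * f (m * x + b))" by blast
  have E: "((\<lambda>x. k * f (m * x + b)) has_real_derivative k * (deriv f (m * x + b) * m)) (at x)" for x
    by (intro DERIV_cmult DERIV_chain2[OF smooth_has_deriv[OF f(1)]]) (auto intro!: derivative_eq_intros)
  have D: "(g has_real_derivative (k * m) * deriv f (m * x + b)) (at x)" for x
    unfolding f(2) by (rule DERIV_cong[OF E]) simp
  then have "deriv g = (\<lambda>x. (k * m) * deriv f (m * x + b))"
    by (auto intro!: ext DERIV_imp_deriv)
  then show "(\<forall>x. g field_differentiable at x) \<and>
      (\<exists>k f. smooth f \<and> deriv g = (\<lambda>x. k * f (m * x + b)))"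
    using D f(1) smooth_deriv field_differentiable_def by blast
qed

section \<open>A smooth function flat at the origin, and the bumps made from it\<close>

definition flat :: "real \<Rightarrow> real"
  where "flat x = (if x > 0 then exp (- 1 / x) else 0)"


lemma poly_exp_neg_tendsto: "((\<lambda>y::real. poly p y * exp (- y)) \<longlongrightarrow> 0) at_top"
proof -
  have "((\<lambda>y::real. \<Sum>i\<le>degree p. coeff p i * (y ^ i / exp y)) \<longlongrightarrow> (\<Sum>i\<le>degree p. coeff p i * 0)) at_top"
    by (intro tendsto_intros tendsto_power_div_exp_0)
  moreover have "poly p y * exp (- y) = (\<Sum>i\<le>degree p. coeff p i * (y ^ i / exp y))" for y
    by (simp add: poly_altdef sum_distrib_right exp_minus divide_inverse mult.assoc)
  ultimately show ?thesis by simp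
qed

lemma flat_poly_tendsto: "((\<lambda>x. poly p (1 / x) * exp (- 1 / x)) \<longlongrightarrow> 0) (at_right (0::real))"
proof -
  have "LIM x at_right (0::real). 1 / x :> at_top"
    using filterlim_inverse_at_top_right by (simp add: inverse_eq_divide)
  from filterlim_compose[OF poly_exp_neg_tendsto[of p] this] show ?thesis by simp
qed

text \<open>With y = 1 / x, differentiation in x is - y^2 times differentiation in y, which sends
  p(y) exp(- y) to y^2 (p - p')(y) exp(- y). Polynomials in 1 / x times the exponential thus form a
  class closed under \<open>deriv\<close>; at the origin this holds because the exponential beats
  every polynomial.\<close>

lemma flat_poly_deriv:
  fixes p :: "real poly"
  defines "g \<equiv> \<lambda>p x. if x > 0 then poly p (1 / x) * exp (- 1 / x) else 0"
  shows "(g p has_real_derivative g ([:0, 0, 1:] * (p - pderiv p)) x) (at x)"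
proof (cases x "0::real" rule: linorder_cases)
  case less
  have "((\<lambda>x. 0) has_real_derivative 0) (at x)" by simp
  then have "(g p has_real_derivative 0) (at x)"
    by (rule DERIV_cong_ev[THEN iffD1, rotated -1])
       (use less in \<open>auto simp: g_def intro!: eventually_mono[OF order_tendstoD(2)[OF tendsto_ident_at less]]
          eventually_nhds_in_open[of "{..<0}" x, THEN eventually_mono]\<close>)
  then show ?thesis using less by (simp add: g_def)
next
  case greater
  have "((\<lambda>x. poly p (1 / x) * exp (- 1 / x)) has_real_derivative
      poly p (1 / x) * (exp (- 1 / x) * (1 / x\<^sup>2)) + (poly (pderiv p) (1 / x) * (- 1 / x\<^sup>2)) * exp (- 1 / x)) (at x)"
    using greater
    by (auto intro!: derivative_eq_intros DERIV_chain2[where f = "poly p"] poly_DERIV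
        simp: power2_eq_square field_simps)
  then have "(g p has_real_derivative
      poly p (1 / x) * (exp (- 1 / x) * (1 / x\<^sup>2)) + (poly (pderiv p) (1 / x) * (- 1 / x\<^sup>2)) * exp (- 1 / x)) (at x)"
    by (rule DERIV_cong_ev[THEN iffD1, rotated -1])
       (use greater in \<open>auto simp: g_def intro!: eventually_nhds_in_open[of "{0<..}" x, THEN eventually_mono]\<close>)
  then show ?thesis using greater by (simp add: g_def field_simps power2_eq_square)
next
  case equal
  have "((\<lambda>y. (g p y - g p 0) / (y - 0)) \<longlongrightarrow> 0) (at 0)"
  proof (subst filterlim_at_split, intro conjI)
    show "((\<lambda>y. (g p y - g p 0) / (y - 0)) \<longlongrightarrow> 0) (at_left 0)"
      by (rule tendsto_eventually) (auto simp: g_def eventually_at_left_field intro: exI[of _ "-1"])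
    \<comment> \<open>Dividing by \<open>y\<close> in the difference quotient multiplies the
      polynomial in \<open>1 / y\<close> by its variable, hence the factor
      \<open>[:0, 1:]\<close>.\<close>
    have "((\<lambda>y. poly ([:0, 1:] * p) (1 / y) * exp (- 1 / y)) \<longlongrightarrow> 0) (at_right 0)"
      by (rule flat_poly_tendsto)
    then show "((\<lambda>y. (g p y - g p 0) / (y - 0)) \<longlongrightarrow> 0) (at_right 0)"
      by (rule Lim_transform_eventually)
         (auto simp: g_def eventually_at_right_field intro: exI[of _ "1"])
  qed
  then show ?thesis
    using equal by (simp add: has_field_derivative_iff g_def)
qed

lemma smooth_flat: "smooth flat"
proof (rule smooth_coinduct[where P = "\<lambda>g. \<exists>p. g = (\<lambda>x. if x > 0 then poly p (1 / x) * exp (- 1 / x) else 0)"])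
  show "\<exists>p. flat = (\<lambda>x. if x > 0 then poly p (1 / x) * exp (- 1 / x) else 0)"
    by (intro exI[of _ 1]) (auto simp: flat_def)
next
  fix g :: "real \<Rightarrow> real"
  assume "\<exists>p. g = (\<lambda>x. if x > 0 then poly p (1 / x) * exp (- 1 / x) else 0)"
  then obtain p where g: "g = (\<lambda>x. if x > 0 then poly p (1 / x) * exp (- 1 / x) else 0)" ..
  note D = flat_poly_deriv[of p, folded g]
  have "deriv g = (\<lambda>x. if x > 0 then poly ([:0, 0, 1:] * (p - pderiv p)) (1 / x) * exp (- 1 / x) else 0)"
    by (rule ext, rule DERIV_imp_deriv, rule D)
  then show "(\<forall>x. g field_differentiable at x) \<and>
      (\<exists>p. deriv g = (\<lambda>x. if x > 0 then poly p (1 / x) * exp (- 1 / x) else 0))"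
    using D field_differentiable_def by blast
qed

text \<open>The slope \<open>n + 1\<close> makes \<open>bump a b n\<close> converge to the indicator of \<open>(a, b)\<close>, because
  \<open>exp (- c / (n + 1)) \<rightarrow> 1\<close>.\<close>

definition bump :: "real \<Rightarrow> real \<Rightarrow> nat \<Rightarrow> real \<Rightarrow> real"
  where "bump a b n x = flat (real (Suc n) * (x - a)) * flat (real (Suc n) * (b - x))"

lemma smooth_bump: "smooth (bump a b n)"
proof -
  have "smooth (\<lambda>x. flat (real (Suc n) * x + - (real (Suc n) * a)) * flat (- real (Suc n) * x + real (Suc n) * b))"
    by (intro smooth_mult smooth_affine smooth_flat)
  moreover have "bump a b n = (\<lambda>x. flat (real (Suc n) * x + - (real (Suc n) * a)) * flat (- real (Suc n) * x + real (Suc n) * b))"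
    by (auto simp: bump_def fun_eq_iff algebra_simps)
  ultimately show ?thesis by simp
qed

lemma bump_nonneg: "0 \<le> bump a b n x" and bump_le1: "bump a b n x \<le> 1"
  and bump_outside: "x \<notin> {a<..<b} \<Longrightarrow> bump a b n x = 0"
  and bump_pos: "x \<in> {a<..<b} \<Longrightarrow> bump a b n x > 0"
  by (auto simp: bump_def flat_def zero_less_mult_iff mult_le_one not_less)

lemma bump_tendsto: "(\<lambda>n. bump a b n x) \<longlonglongrightarrow> indicat_real {a<..<b} x"
proof (cases "x \<in> {a<..<b}")
  case True
  have *: "(\<lambda>n. exp (- (1 / y * (1 / real (Suc n))))) \<longlonglongrightarrow> exp (- (1 / y * 0))" for y :: real
    by (intro tendsto_intros LIMSEQ_Suc[OF lim_1_over_n])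
  have "bump a b n x = exp (- (1 / (x - a) * (1 / real (Suc n)))) * exp (- (1 / (b - x) * (1 / real (Suc n))))" for n
    using True by (auto simp: bump_def flat_def zero_less_mult_iff mult.commute)
  then show ?thesis
    using tendsto_mult[OF * *, of "x - a" "b - x"] True by simp
qed (simp add: bump_outside)

lemma test_function_iff:
  "test_function l \<phi> \<longleftrightarrow> smooth \<phi> \<and> (\<exists>K. compact K \<and> K \<subseteq> {0<..<l} \<and> (\<forall>x. x \<notin> K \<longrightarrow> \<phi> x = 0))"
  by (simp add: test_function_def smooth_def)

lemma test_function_bump:
  assumes "0 < a" "b < l"
  shows "test_function l (bump a b n)"
  unfolding test_function_iff
  using assms by (auto intro!: smooth_bump exI[of _ "{a..b}"] bump_outside)

section \<open>Indefinite integrals and weak derivatives\<close>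

lemma space_interval_measure [simp]: "space (interval_measure l) = {0<..<l}"
  by (simp add: interval_measure_def)

lemma finite_interval_measure: "finite_measure (interval_measure l)"
  unfolding interval_measure_def by (rule finite_measure_lebesgue_on) simp

lemma sets_interval_measure_borel: "B \<in> sets borel \<Longrightarrow> {0<..<l} \<inter> B \<in> sets (interval_measure l)"
  unfolding interval_measure_def by (auto simp: sets_restrict_space)

lemma measurable_borel_interval_measure:
  "f \<in> borel_measurable borel \<Longrightarrow> f \<in> borel_measurable (interval_measure l)"
  unfolding interval_measure_def
  by (simp add: measurable_restrict_space1 measurable_completion)

lemma indicator_measurable_interval [measurable]:
  "B \<in> sets borel \<Longrightarrow> indicat_real B \<in> borel_measurable (interval_measure l)"
  by (intro measurable_borel_interval_measure borel_measurable_indicator)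

lemma integrable_interval_indicator:
  assumes "integrable (interval_measure l) f" "B \<in> sets borel"
  shows "integrable (interval_measure l) (\<lambda>y. indicat_real B y * f y)"
proof (rule Bochner_Integration.integrable_bound[OF assms(1)])
  show "(\<lambda>y. indicat_real B y * f y) \<in> borel_measurable (interval_measure l)"
    using assms by (intro borel_measurable_times indicator_measurable_interval) auto
qed (auto simp: indicator_def)

lemma AE_interval_point: "AE y in interval_measure l. y \<noteq> x"
proof -
  have "AE y in lebesgue. y \<noteq> x"
    using AE_completion[OF AE_lborel_singleton[of x]] by (simp add: eq_commute)
  then show ?thesis
    unfolding interval_measure_def by (auto simp: AE_restrict_space_iff elim: eventually_mono)
qed

text \<open>Half-lines are stable under intersection and generate the Borel sets, so Dynkin's
  argument spreads the vanishing to all Borel sets. A Lebesgue set is a Borel set up to a null set,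
  and a density whose integral vanishes on every measurable set is zero.\<close>

lemma integral_halflines_zero_imp_AE_zero:
  assumes f: "integrable (interval_measure l) f"
    and z: "\<And>x. (LINT y|interval_measure l. indicat_real {..x} y * f y) = 0"
  shows "AE y in interval_measure l. f y = 0"
proof (rule sigma_finite_measure.density_zero[OF _ f])
  let ?M = "interval_measure l"
  \<comment> \<open>A half-line ending at \<open>l\<close> covers the whole interval. The case of
    complements below subtracts from this total.\<close>
  have total: "(LINT y|?M. f y) = 0"
  proof -
    have "(LINT y|?M. f y) = (LINT y|?M. indicat_real {..l} y * f y)"
      by (rule Bochner_Integration.integral_cong) auto
    then show ?thesis using z by simp
  qed
  have Bz: "(LINT y|?M. indicat_real B y * f y) = 0" if "B \<in> sets borel" for B
  proof -
    have "B \<in> sigma_sets UNIV (range (\<lambda>a::real. {..a}))"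
      using that borel_eq_atMost by (metis sets_measure_of top_greatest Pow_UNIV)
    then show ?thesis
    proof (induction rule: sigma_sets_induct_disjoint[rotated 2, consumes 1])
      case (4 A)
      have A: "A i \<in> sets borel" for i
        using 4(2) borel_eq_atMost by (metis range_subsetD sets_measure_of top_greatest Pow_UNIV)
      define A' where "A' i = {0<..<l} \<inter> A i" for i
      have "set_lebesgue_integral ?M (\<Union>i. A' i) f = (\<Sum>i. set_lebesgue_integral ?M (A' i) f)"
      proof (rule lebesgue_integral_countable_add)
        show "A' i \<in> sets ?M" for i
          unfolding A'_def using A by (rule sets_interval_measure_borel)
        then show "set_integrable ?M (\<Union>i. A' i) f"
          unfolding set_integrable_def by (intro integrable_mult_indicator f) auto
        show "A' i \<inter> A' j = {}" if "i \<noteq> j" for i j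
          using that 4(1) by (auto simp: A'_def disjoint_family_on_def)
      qed
      moreover have "set_lebesgue_integral ?M (A' i) f = 0" for i
        unfolding set_lebesgue_integral_def 4(3)[of i, symmetric]
        by (rule Bochner_Integration.integral_cong) (auto simp: A'_def indicator_def)
      moreover have "set_lebesgue_integral ?M (\<Union>i. A' i) f = (LINT y|?M. indicat_real (\<Union>i. A i) y * f y)"
        unfolding set_lebesgue_integral_def
        by (rule Bochner_Integration.integral_cong) (auto simp: A'_def indicator_def)
      ultimately show ?case by simp
    next
      case (3 A)
      then have "A \<in> sets borel"
        using borel_eq_atMost by (metis sets_measure_of top_greatest Pow_UNIV)
      then have "(LINT y|?M. f y - indicat_real A y * f y) = 0"
        using 3 total f by (simp add: integrable_interval_indicator)
      moreover have "(LINT y|?M. f y - indicat_real A y * f y) = (LINT y|?M. indicat_real (UNIV - A) y * f y)"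
        by (rule Bochner_Integration.integral_cong) (auto simp: indicator_def)
      ultimately show ?case by simp
    next
      case 2 show ?case by simp
    next
      case (1 A) then show ?case using z by auto
    qed (auto simp: Int_stable_def)
  qed
  show "sigma_finite_measure ?M"
    using finite_interval_measure by (rule finite_measure.axioms(1))
  fix A assume "A \<in> sets ?M"
  then have A: "A \<in> sets lebesgue" "A \<subseteq> {0<..<l}"
    unfolding interval_measure_def by (auto simp: sets_restrict_space_iff)
  then obtain B N where B: "B \<in> sets borel" and N: "negligible N" and BN: "B \<union> N = A"
    using sets_lebesgue_almost_borel by blast
  have "AE x in lebesgue. x \<notin> N"
    using N by (simp add: negligible_iff_null_sets AE_not_in)
  then have "AE x in ?M. x \<notin> N"
    unfolding interval_measure_def by (auto simp: AE_restrict_space_iff elim: eventually_mono)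
  then have "AE x in ?M. indicat_real A x * f x = indicat_real B x * f x"
    by (rule eventually_mono) (use BN in \<open>auto simp: indicator_def\<close>)
  then have "(LINT x|?M. indicat_real A x * f x) = (LINT x|?M. indicat_real B x * f x)"
    by (intro integral_cong_AE borel_measurable_times borel_measurable_indicator \<open>A \<in> sets ?M\<close>
        indicator_measurable_interval B borel_measurable_integrable[OF f])
  then show "set_lebesgue_integral ?M A f = 0"
    using Bz[OF B] by (simp add: set_lebesgue_integral_def)
qed

section \<open>Indefinite integrals\<close>

text \<open>The integral of \<open>f\<close> from 0 to \<open>x\<close>, constant to the left of 0
  and to the right of \<open>l\<close>. It is therefore continuous on the whole line, and both
  traces are plain values of it.\<close>

definition prim :: "real \<Rightarrow> (real \<Rightarrow> real) \<Rightarrow> real \<Rightarrow> real"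
  where "prim l f x = (LINT y|interval_measure l. indicat_real {..x} y * f y)"

lemma prim_0 [simp]: "prim l f 0 = 0"
  unfolding prim_def by (rule integral_eq_zero_AE, rule AE_I2) (auto simp: indicator_def)

lemma prim_l: "prim l f l = (LINT y|interval_measure l. f y)"
  unfolding prim_def by (rule Bochner_Integration.integral_cong) auto

lemma prim_cong_AE:
  assumes "ae_eq l f g" "f \<in> borel_measurable (interval_measure l)" "g \<in> borel_measurable (interval_measure l)"
  shows "prim l f = prim l g"
proof
  fix x
  have "AE y in interval_measure l. indicat_real {..x} y * f y = indicat_real {..x} y * g y"
    using assms(1) unfolding ae_eq_def by (rule eventually_mono) simp
  then show "prim l f x = prim l g x"
    unfolding prim_def
    by (intro integral_cong_AE borel_measurable_times indicator_measurable_interval assms) auto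
qed

text \<open>Dominated convergence: the indicators of the half-lines converge except possibly at the
  point \<open>x\<close> itself, which is null.\<close>

lemma prim_continuous:
  assumes f: "integrable (interval_measure l) f"
  shows "continuous_on A (prim l f)"
proof (rule continuous_at_imp_continuous_on, rule ballI, rule continuous_at_sequentiallyI)
  fix x u assume u: "u \<longlonglongrightarrow> (x::real)"
  show "(\<lambda>n. prim l f (u n)) \<longlonglongrightarrow> prim l f x"
    unfolding prim_def
  proof (rule integral_dominated_convergence[where w = "\<lambda>y. \<bar>f y\<bar>"])
    show "AE y in interval_measure l. (\<lambda>n. indicat_real {..u n} y * f y) \<longlonglongrightarrow> indicat_real {..x} y * f y"
      using AE_interval_point[of x l]
    proof (rule eventually_mono)
      fix y assume "y \<noteq> x"
      have "\<forall>\<^sub>F n in sequentially. indicat_real {..u n} y = indicat_real {..x} y"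
      proof (cases "y < x")
        case True
        from order_tendstoD(1)[OF u this] show ?thesis
          by (rule eventually_mono) (use True in \<open>auto simp: indicator_def\<close>)
      next
        case False
        with \<open>y \<noteq> x\<close> have "x < y" by simp
        from order_tendstoD(2)[OF u this] show ?thesis
          by (rule eventually_mono) (use False \<open>y \<noteq> x\<close> in \<open>auto simp: indicator_def\<close>)
      qed
      then show "(\<lambda>n. indicat_real {..u n} y * f y) \<longlonglongrightarrow> indicat_real {..x} y * f y"
        by (intro tendsto_mult tendsto_const tendsto_eventually)
    qed
    show "AE y in interval_measure l. norm (indicat_real {..u n} y * f y) \<le> \<bar>f y\<bar>" for n
      by (rule AE_I2) (simp add: indicator_def)
  qed (use f in \<open>auto intro!: borel_measurable_times indicator_measurable_interval\<close>)
qed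

lemma prim_add: "integrable (interval_measure l) f \<Longrightarrow> integrable (interval_measure l) g \<Longrightarrow>
    prim l (\<lambda>y. f y + g y) x = prim l f x + prim l g x"
  by (simp add: prim_def distrib_left integrable_interval_indicator)

lemma prim_cmult: "prim l (\<lambda>y. c * f y) x = c * prim l f x"
  by (simp add: prim_def mult.left_commute)

text \<open>Fubini on the triangles \<open>y \<le> x\<close> and \<open>x \<le> y\<close>, which overlap in a null set.\<close>

lemma prim_product:
  assumes f: "integrable (interval_measure l) f" and g: "integrable (interval_measure l) g"
  shows "(LINT x|interval_measure l. f x * prim l g x) + (LINT x|interval_measure l. g x * prim l f x)
     = prim l f l * prim l g l"
proof -
  let ?M = "interval_measure l"
  interpret finite_measure ?M by (rule finite_interval_measure)
  interpret pair_sigma_finite ?M ?M ..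
  have fm [measurable]: "f \<in> borel_measurable ?M" and gm [measurable]: "g \<in> borel_measurable ?M"
    using f g by auto
  have id [measurable]: "(\<lambda>x. x) \<in> borel_measurable ?M"
    by (rule measurable_borel_interval_measure) simp
  have P: "integrable (?M \<Otimes>\<^sub>M ?M) (\<lambda>(x, y). f x * g y)"
  proof (rule Fubini_integrable)
    have "(\<lambda>x. LINT y|?M. norm (f x * g y)) = (\<lambda>x. norm (f x) * (LINT y|?M. norm (g y)))"
      by (simp add: abs_mult)
    then show "integrable ?M (\<lambda>x. LINT y|?M. norm (case (x, y) of (x, y) \<Rightarrow> f x * g y))"
      using f by simp
  qed (use f g in auto)
  have T: "integrable (?M \<Otimes>\<^sub>M ?M) (\<lambda>(x, y). (if y \<le> x then 1 else 0) * (f x * g y))"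
    by (rule Bochner_Integration.integrable_bound[OF P]) auto
  have 1: "(LINT x|?M. f x * prim l g x) = (LINT x|?M. LINT y|?M. (if y \<le> x then 1 else 0) * (f x * g y))"
    by (auto simp: prim_def indicator_def mult.left_commute simp flip: integral_mult_right_zero
        intro!: Bochner_Integration.integral_cong)
  have 2: "(LINT y|?M. g y * prim l f y) = (LINT x|?M. LINT y|?M. (1 - (if y \<le> x then 1 else 0)) * (f x * g y))"
  proof -
    have "(LINT y|?M. g y * prim l f y) = (LINT y|?M. LINT x|?M. (1 - (if y \<le> x then 1 else 0)) * (f x * g y))"
    proof (rule Bochner_Integration.integral_cong[OF refl])
      fix y
      have "AE x in ?M. indicat_real {..y} x * f x = (1 - (if y \<le> x then 1 else 0)) * f x"
        using AE_interval_point[of y l] by (rule eventually_mono) (auto simp: indicator_def)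
      then have "prim l f y = (LINT x|?M. (1 - (if y \<le> x then 1 else 0)) * f x)"
        unfolding prim_def by (intro integral_cong_AE) auto
      then show "g y * prim l f y = (LINT x|?M. (1 - (if y \<le> x then 1 else 0)) * (f x * g y))"
        by (simp add: mult_ac flip: integral_mult_right_zero)
    qed
    also have "\<dots> = (LINT x|?M. LINT y|?M. (1 - (if y \<le> x then 1 else 0)) * (f x * g y))"
    proof (rule Fubini_integral)
      show "integrable (?M \<Otimes>\<^sub>M ?M) (\<lambda>(x, y). (1 - (if y \<le> x then 1 else 0)) * (f x * g y))"
        by (rule Bochner_Integration.integrable_bound[OF P]) auto
    qed
    finally show ?thesis .
  qed
  have "(LINT y|?M. (if y \<le> x then 1 else 0) * (f x * g y)) + (LINT y|?M. (1 - (if y \<le> x then 1 else 0)) * (f x * g y))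
      = f x * (LINT y|?M. g y)" for x
  proof -
    have i: "integrable ?M (\<lambda>y. (if y \<le> x then 1 else 0) * (f x * g y))"
      "integrable ?M (\<lambda>y. (1 - (if y \<le> x then 1 else 0)) * (f x * g y))"
      by (rule Bochner_Integration.integrable_bound[OF integrable_mult_right[OF g, of "f x"]]; auto)+
    show ?thesis
      by (subst Bochner_Integration.integral_add[OF i, symmetric]) (simp add: algebra_simps)
  qed
  moreover have "integrable ?M (\<lambda>x. LINT y|?M. (if y \<le> x then 1 else 0) * (f x * g y))"
    using integrable_fst'[OF T] by simp
  moreover have "integrable ?M (\<lambda>x. LINT y|?M. (1 - (if y \<le> x then 1 else 0)) * (f x * g y))"
  proof -
    have "integrable (?M \<Otimes>\<^sub>M ?M) (\<lambda>(x, y). (1 - (if y \<le> x then 1 else 0)) * (f x * g y))"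
        by (rule Bochner_Integration.integrable_bound[OF P]) auto
    from integrable_fst'[OF this] show ?thesis by simp
  qed
  ultimately show ?thesis
    unfolding 1 2 by (subst Bochner_Integration.integral_add[symmetric]) (auto simp: prim_l)
qed

section \<open>Local integrability and the fundamental lemma of the calculus of variations\<close>

text \<open>Local integrability controls compact subintervals only; a bounded factor supported in
  one of them restores integrability on the whole interval.\<close>

lemma locally_integrable_mult_indicator:
  assumes "locally_integrable l u" "0 < a" "b < l" "k \<in> borel_measurable borel" "\<And>x. \<bar>k x\<bar> \<le> B" "\<And>x. x \<notin> {a..b} \<Longrightarrow> k x = 0"
  shows "integrable (interval_measure l) (\<lambda>y. u y * k y)"
proof -
  have "integrable (lebesgue_on {a..b}) u"
    using assms unfolding locally_integrable_def by blast
  then have "integrable lebesgue (\<lambda>x. indicat_real {a..b} x * u x)"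
    by (simp add: integrable_restrict_space)
  then have *: "integrable lebesgue (\<lambda>x. (indicat_real {a..b} x * u x) * k x)"
  proof -
    assume i: "integrable lebesgue (\<lambda>x. indicat_real {a..b} x * u x)"
    show ?thesis
    proof (rule Bochner_Integration.integrable_bound)
      show "integrable lebesgue (\<lambda>x. B * (indicat_real {a..b} x * u x))"
        using i by simp
      show "(\<lambda>x. indicat_real {a..b} x * u x * k x) \<in> borel_measurable lebesgue"
        using i assms(4) by (intro borel_measurable_times[OF borel_measurable_integrable]) (auto intro: measurable_completion)
      show "AE x in lebesgue. norm (indicat_real {a..b} x * u x * k x) \<le> norm (B * (indicat_real {a..b} x * u x))"
        using assms(5) order_trans[OF abs_ge_zero assms(5)]
        by (intro AE_I2) (auto simp: abs_mult indicator_def mult.commute intro: mult_right_mono)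
    qed
  qed
  have "(\<lambda>x. (indicat_real {a..b} x * u x) * k x) = (\<lambda>x. indicat_real {0<..<l} x *\<^sub>R (u x * k x))"
    using assms(2,3,6) by (auto simp: indicator_def fun_eq_iff)
  with * show ?thesis
    unfolding interval_measure_def by (simp add: integrable_restrict_space)
qed

lemma integrable_imp_locally_integrable:
  assumes "integrable (interval_measure l) f"
  shows "locally_integrable l f"
  unfolding locally_integrable_def
proof (intro allI impI)
  fix a b :: real assume ab: "0 < a \<and> b < l"
  have "integrable lebesgue (\<lambda>x. indicat_real {0<..<l} x *\<^sub>R f x)"
    using assms by (simp add: interval_measure_def integrable_restrict_space)
  then have "integrable lebesgue (\<lambda>x. indicat_real {a..b} x *\<^sub>R (indicat_real {0<..<l} x *\<^sub>R f x))"
    by (rule integrable_mult_indicator[rotated]) auto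
  moreover have "(\<lambda>x. indicat_real {a..b} x *\<^sub>R (indicat_real {0<..<l} x *\<^sub>R f x)) = (\<lambda>x. indicat_real {a..b} x *\<^sub>R f x)"
    using ab by (auto simp: indicator_def)
  ultimately show "integrable (lebesgue_on {a..b}) f"
    by (simp add: integrable_restrict_space)
qed

lemma test_function_bound:
  assumes "test_function l \<phi>"
  obtains a b B where "0 < a" "b < l" "\<And>x. \<bar>\<phi> x\<bar> \<le> B" "\<And>x. x \<notin> {a..b} \<Longrightarrow> \<phi> x = 0"
proof -
  obtain K where K: "compact K" "K \<subseteq> {0<..<l}" "\<And>x. x \<notin> K \<Longrightarrow> \<phi> x = 0" and s: "smooth \<phi>"
    using assms unfolding test_function_iff by blast
  have "compact (\<phi> ` K)"
    by (intro compact_continuous_image smooth_continuous_on s K)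
  then obtain B where "\<And>x. x \<in> K \<Longrightarrow> \<bar>\<phi> x\<bar> \<le> B"
    using compact_imp_bounded bounded_iff by (metis imageI real_norm_def)
  then have B: "\<bar>\<phi> x\<bar> \<le> max 0 B" for x
    using K(3)[of x] by (cases "x \<in> K") (auto simp: le_max_iff_disj)
  show ?thesis
  proof (cases "K = {}")
    case True
    \<comment> \<open>An empty support has no endpoints. The values 1 and \<open>l - 1\<close> are
      chosen just to satisfy the two strict inequalities, and the function vanishes
      everywhere.\<close>
    show ?thesis by (rule that[of 1 "l - 1", OF _ _ B]) (use True K in auto)
  next
    case False
    obtain a where a: "a \<in> K" "\<forall>x\<in>K. a \<le> x" using compact_attains_inf[OF K(1) False] by blast
    obtain b where b: "b \<in> K" "\<forall>x\<in>K. x \<le> b" using compact_attains_sup[OF K(1) False] by blast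
    show ?thesis
    proof (rule that[of a b, OF _ _ B])
      show "0 < a" "b < l" using a(1) b(1) K(2) by auto
      show "\<phi> x = 0" if "x \<notin> {a..b}" for x using that a(2) b(2) K(3) by force
    qed
  qed
qed

lemma locally_integrable_test:
  assumes "locally_integrable l u" "test_function l \<phi>"
  shows "integrable (interval_measure l) (\<lambda>y. u y * \<phi> y)"
proof -
  obtain a b B where "0 < a" "b < l" "\<And>x. \<bar>\<phi> x\<bar> \<le> B" "\<And>x. x \<notin> {a..b} \<Longrightarrow> \<phi> x = 0"
    using test_function_bound[OF assms(2)] by blast
  moreover have "\<phi> \<in> borel_measurable borel"
    using assms(2) smooth_borel by (simp add: test_function_iff)
  ultimately show ?thesis using locally_integrable_mult_indicator[OF assms(1)] by blast
qed

lemma test_function_deriv: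
  assumes "test_function l \<phi>"
  shows "test_function l (deriv \<phi>)"
proof -
  obtain K where K: "compact K" "K \<subseteq> {0<..<l}" "\<And>x. x \<notin> K \<Longrightarrow> \<phi> x = 0" and s: "smooth \<phi>"
    using assms unfolding test_function_iff by blast
  have "deriv \<phi> x = 0" if "x \<notin> K" for x
  proof (rule DERIV_imp_deriv)
    have "open (- K)" using K(1) compact_imp_closed open_Compl by blast
    moreover have "((\<lambda>x. 0) has_real_derivative 0) (at x)" by simp
    ultimately show "(\<phi> has_real_derivative 0) (at x)"
      using that K(3) by (metis ComplD ComplI has_field_derivative_transform_within_open)
  qed
  then show ?thesis
    unfolding test_function_iff using K s smooth_deriv by blast
qed

text \<open>Bumps converge boundedly to indicators of open intervals, so \<open>u\<close> has
  integral zero over every open interval strictly inside. This makes its half-line integrals vanish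
  there, and countably many such intervals exhaust the whole.\<close>

lemma fundamental_lemma:
  assumes u: "locally_integrable l u"
    and z: "\<And>\<phi>. test_function l \<phi> \<Longrightarrow> (LINT y|interval_measure l. u y * \<phi> y) = 0"
  shows "AE y in interval_measure l. u y = 0"
proof -
  let ?M = "interval_measure l"
  have open_zero: "(LINT y|?M. u y * indicat_real {a<..<b} y) = 0" if "0 < a" "b < l" for a b
  proof -
    have "(\<lambda>n. LINT y|?M. u y * bump a b n y) \<longlonglongrightarrow> (LINT y|?M. u y * indicat_real {a<..<b} y)"
    proof (rule integral_dominated_convergence[where w = "\<lambda>y. \<bar>u y * indicat_real {a<..<b} y\<bar>"])
      have *: "integrable ?M (\<lambda>y. u y * indicat_real {a<..<b} y)"
        by (rule locally_integrable_mult_indicator[OF u that, where B = 1]) (auto simp: indicator_def)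
      show "integrable ?M (\<lambda>y. \<bar>u y * indicat_real {a<..<b} y\<bar>)"
        using * by (rule integrable_abs)
      show "(\<lambda>y. u y * indicat_real {a<..<b} y) \<in> borel_measurable ?M"
        using * by (rule borel_measurable_integrable)
      show "(\<lambda>y. u y * bump a b n y) \<in> borel_measurable ?M" for n
        by (intro borel_measurable_integrable locally_integrable_test u test_function_bump that)
      show "AE y in ?M. (\<lambda>n. u y * bump a b n y) \<longlonglongrightarrow> u y * indicat_real {a<..<b} y"
        by (intro AE_I2 tendsto_intros bump_tendsto)
      show "AE y in ?M. norm (u y * bump a b n y) \<le> \<bar>u y * indicat_real {a<..<b} y\<bar>" for n
      proof (rule AE_I2)
        show "norm (u y * bump a b n y) \<le> \<bar>u y * indicat_real {a<..<b} y\<bar>" for y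
          using bump_nonneg[of a b n y] bump_le1[of a b n y] bump_outside[of y a b n]
          by (cases "y \<in> {a<..<b}") (auto simp: abs_mult intro: mult_left_le)
      qed
    qed
    moreover have "(LINT y|?M. u y * bump a b n y) = 0" for n
      by (intro z test_function_bump that)
    ultimately show ?thesis by (simp add: LIMSEQ_const_iff)
  qed
  have piece: "AE y in ?M. u y * indicat_real {a<..<b} y = 0" if "0 < a" "b < l" for a b
  proof (rule integral_halflines_zero_imp_AE_zero)
    show "integrable ?M (\<lambda>y. u y * indicat_real {a<..<b} y)"
      by (rule locally_integrable_mult_indicator[OF u that, where B = 1]) (auto simp: indicator_def)
    fix x
    \<comment> \<open>Cutting (a, b) at \<open>x\<close> leaves the interval from a to
      \<open>min x b\<close>, up to the point \<open>x\<close>, and the open case applies to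
      it.\<close>
    have "(LINT y|?M. indicat_real {..x} y * (u y * indicat_real {a<..<b} y))
        = (LINT y|?M. u y * indicat_real {a<..<min x b} y)"
    proof (rule integral_cong_AE)
      show "(\<lambda>y. u y * indicat_real {a<..<min x b} y) \<in> borel_measurable ?M"
        by (rule borel_measurable_integrable, rule locally_integrable_mult_indicator[OF u, where a = a and b = b and B = 1])
          (use that in \<open>auto simp: indicator_def\<close>)
      show "(\<lambda>y. indicat_real {..x} y * (u y * indicat_real {a<..<b} y)) \<in> borel_measurable ?M"
        by (rule borel_measurable_integrable, rule integrable_interval_indicator,
            rule locally_integrable_mult_indicator[OF u, where a = a and b = b and B = 1])
          (use that in \<open>auto simp: indicator_def\<close>)
      show "AE y in ?M. indicat_real {..x} y * (u y * indicat_real {a<..<b} y) = u y * indicat_real {a<..<min x b} y"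
        using AE_interval_point[of x l] by (rule eventually_mono) (auto simp: indicator_def)
    qed
    then show "(LINT y|?M. indicat_real {..x} y * (u y * indicat_real {a<..<b} y)) = 0"
      using open_zero[of a "min x b"] that by simp
  qed
  have "AE y in ?M. \<forall>n. u y * indicat_real {inverse (real (Suc n)) <..< l - inverse (real (Suc n))} y = 0"
    unfolding AE_all_countable by (intro allI piece) auto
  then show ?thesis
  proof (rule AE_mp[OF _ AE_I2], intro impI)
    fix y assume y: "y \<in> space ?M" and u0: "\<forall>n. u y * indicat_real {inverse (real (Suc n)) <..< l - inverse (real (Suc n))} y = 0"
    then obtain n where "inverse (real (Suc n)) < min y (l - y)"
      using reals_Archimedean[of "min y (l - y)"] by auto
    then have "y \<in> {inverse (real (Suc n)) <..< l - inverse (real (Suc n))}" by auto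
    then show "u y = 0" using u0 by (metis indicator_simps(1) mult.right_neutral)
  qed
qed

section \<open>Weak derivatives and the lemma of du Bois-Reymond\<close>

lemma weak_derivative_unique:
  assumes "weak_derivative l f g" "weak_derivative l f' g'" "ae_eq l f f'"
  shows "ae_eq l g g'"
proof -
  let ?M = "interval_measure l"
  have li: "locally_integrable l g" "locally_integrable l g'" "locally_integrable l f" "locally_integrable l f'"
    using assms unfolding weak_derivative_def by auto
  have "AE y in ?M. g y - g' y = 0"
  proof (rule fundamental_lemma)
    show "locally_integrable l (\<lambda>y. g y - g' y)"
      using li unfolding locally_integrable_def by auto
    fix \<phi> assume \<phi>: "test_function l \<phi>"
    have "(LINT y|?M. f y * deriv \<phi> y) = (LINT y|?M. f' y * deriv \<phi> y)"
    proof (rule integral_cong_AE)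
      show "AE y in ?M. f y * deriv \<phi> y = f' y * deriv \<phi> y"
        using assms(3) unfolding ae_eq_def by (rule eventually_mono) simp
    qed (intro borel_measurable_integrable locally_integrable_test li test_function_deriv \<phi>)+
    then have "(LINT y|?M. g y * \<phi> y) = (LINT y|?M. g' y * \<phi> y)"
      using assms(1,2) \<phi> unfolding weak_derivative_def by simp
    then show "(LINT y|?M. (g y - g' y) * \<phi> y) = 0"
      using li \<phi> by (simp add: left_diff_distrib locally_integrable_test)
  qed
  then show ?thesis unfolding ae_eq_def by simp
qed

lemma prim_deriv:
  assumes s: "smooth \<phi>" and x: "x \<in> {0<..l}"
  shows "prim l (deriv \<phi>) x = \<phi> x - \<phi> 0"
proof -
  have "(deriv \<phi> has_integral (\<phi> x - \<phi> 0)) {0..x}"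
    using x by (intro fundamental_theorem_of_calculus)
      (auto intro: smooth_has_deriv[OF s] has_field_derivative_at_within simp flip: has_real_derivative_iff_has_vector_derivative)
  moreover have "integrable (lebesgue_on {0..x}) (deriv \<phi>)"
    by (intro continuous_imp_integrable_real smooth_continuous_on smooth_deriv s)
  ultimately have "(LINT y|lebesgue_on {0..x}. deriv \<phi> y) = \<phi> x - \<phi> 0"
    by (simp add: lebesgue_integral_eq_integral integral_unique)
  moreover have "(LINT y|lebesgue_on {0..x}. deriv \<phi> y) = prim l (deriv \<phi>) x"
  proof -
    have m: "deriv \<phi> \<in> borel_measurable lebesgue"
      by (intro measurable_completion) (simp add: smooth_borel smooth_deriv s)
    have "(LINT y|lebesgue. indicat_real {0..x} y * deriv \<phi> y)
        = (LINT y|lebesgue. indicat_real {0<..<l} y * (indicat_real {..x} y * deriv \<phi> y))"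
    proof (rule integral_cong_AE)
      have "AE y in lebesgue. y \<noteq> 0" "AE y in lebesgue. y \<noteq> l"
        using AE_completion[OF AE_lborel_singleton[of 0]] AE_completion[OF AE_lborel_singleton[of l]]
        by (simp_all add: eq_commute)
      then show "AE y in lebesgue. indicat_real {0..x} y * deriv \<phi> y
          = indicat_real {0<..<l} y * (indicat_real {..x} y * deriv \<phi> y)"
        by eventually_elim (use x in \<open>auto simp: indicator_def\<close>)
    qed (intro borel_measurable_times m borel_measurable_indicator; simp)+
    then show ?thesis
      by (simp add: prim_def interval_measure_def integral_restrict_space)
  qed
  ultimately show ?thesis by simp
qed

text \<open>The defining identity is the Fubini formula \<open>prim_product\<close> for
  \<open>deriv \<phi>\<close> and \<open>g\<close>; its boundary product vanishes because \<phi> is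
  zero at both ends. No pointwise derivative of \<open>prim l g\<close> is involved.\<close>

lemma weak_derivative_prim:
  assumes l: "l > 0" and g: "integrable (interval_measure l) g"
  shows "weak_derivative l (\<lambda>y. c + prim l g y) g"
  unfolding weak_derivative_def
proof (intro conjI allI impI)
  let ?M = "interval_measure l"
  interpret finite_measure ?M by (rule finite_interval_measure)
  have cont: "continuous_on UNIV (\<lambda>y. c + prim l g y)"
    by (intro continuous_intros prim_continuous g)
  show li: "locally_integrable l (\<lambda>y. c + prim l g y)"
    unfolding locally_integrable_def
    by (intro allI impI continuous_imp_integrable_real continuous_on_subset[OF cont]) auto
  show "locally_integrable l g" by (rule integrable_imp_locally_integrable[OF g])
  fix \<phi> assume \<phi>: "test_function l \<phi>"
  then have s: "smooth \<phi>" by (simp add: test_function_iff)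
  have int1: "integrable ?M (\<lambda>y. 1 * deriv \<phi> y)"
    by (intro locally_integrable_test test_function_deriv \<phi>) (auto intro: integrable_imp_locally_integrable)
  have "\<phi> 0 = 0" using \<phi> by (force simp: test_function_iff)
  then have P: "prim l (deriv \<phi>) x = \<phi> x" if "x \<in> {0<..l}" for x
    using prim_deriv[OF s that] by simp
  have "\<phi> l = 0" using \<phi> by (force simp: test_function_iff)
  show "(LINT y|?M. (c + prim l g y) * deriv \<phi> y) = - (LINT y|?M. g y * \<phi> y)"
  proof -
    have "(LINT y|?M. deriv \<phi> y * prim l g y) + (LINT y|?M. g y * prim l (deriv \<phi>) y) = 0"
      using prim_product[OF _ g, of "deriv \<phi>"] int1 P[of l] l \<open>\<phi> l = 0\<close> by simp
    moreover have "(LINT y|?M. g y * prim l (deriv \<phi>) y) = (LINT y|?M. g y * \<phi> y)"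
      by (rule Bochner_Integration.integral_cong) (auto simp: P)
    moreover have "(LINT y|?M. (c + prim l g y) * deriv \<phi> y)
        = c * (LINT y|?M. deriv \<phi> y) + (LINT y|?M. deriv \<phi> y * prim l g y)"
    proof -
      have "integrable ?M (\<lambda>y. (c + prim l g y) * deriv \<phi> y)"
        by (intro locally_integrable_test li test_function_deriv \<phi>)
      moreover have "integrable ?M (\<lambda>y. c * deriv \<phi> y)" using int1 by simp
      ultimately have "integrable ?M (\<lambda>y. prim l g y * deriv \<phi> y)"
        using Bochner_Integration.integrable_diff[of ?M "\<lambda>y. (c + prim l g y) * deriv \<phi> y" "\<lambda>y. c * deriv \<phi> y"]
        by (simp add: algebra_simps)
      then show ?thesis using int1 by (simp add: distrib_right mult.commute[of "prim l g _"])
    qed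
    moreover have "(LINT y|?M. deriv \<phi> y) = 0"
      using P[of l] l \<open>\<phi> l = 0\<close> by (simp add: prim_l)
    ultimately show ?thesis by simp
  qed
qed

text \<open>The hypothesis only tests \<open>u\<close> against derivatives of test functions. These
  include every test function of mean zero, and an arbitrary one differs from such a function by a
  multiple of a fixed bump, which accounts for the constant.\<close>

lemma du_bois_reymond:
  assumes l: "l > 0" and w: "weak_derivative l u (\<lambda>_. 0)"
  obtains c where "ae_eq l u (\<lambda>_. c)"
proof -
  let ?M = "interval_measure l"
  have u: "locally_integrable l u" using w by (simp add: weak_derivative_def)
  have wz: "(LINT y|?M. u y * deriv \<phi> y) = 0" if "test_function l \<phi>" for \<phi>
    using w that by (simp add: weak_derivative_def)
  have one: "locally_integrable l (\<lambda>_. 1)"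
    unfolding locally_integrable_def by (auto intro!: continuous_imp_integrable_real)
  \<comment> \<open>Any test function with nonzero integral would do; the middle third of the
    interval keeps the support away from the ends.\<close>
  define \<eta> where "\<eta> = bump (l / 3) (2 * l / 3) 0"
  have \<eta>: "test_function l \<eta>"
    unfolding \<eta>_def using l by (intro test_function_bump) auto
  have int1: "integrable ?M \<psi>" if "test_function l \<psi>" for \<psi>
    using locally_integrable_test[OF one that] by simp
  define m where "m = (LINT y|?M. \<eta> y)"
  have "m \<noteq> 0"
  proof
    assume "m = 0"
    then have ae: "AE y in ?M. \<eta> y = 0"
      using integral_nonneg_eq_0_iff_AE[OF int1[OF \<eta>]] bump_nonneg unfolding m_def \<eta>_def by simp
    then have "AE y in lebesgue. y \<in> {0<..<l} \<longrightarrow> \<eta> y = 0"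
      unfolding interval_measure_def by (simp add: AE_restrict_space_iff)
    then obtain N where N: "{y. \<not> (y \<in> {0<..<l} \<longrightarrow> \<eta> y = 0)} \<subseteq> N" "N \<in> null_sets lebesgue"
      by (auto simp: eventually_ae_filter)
    have "{l/3<..<2*l/3} \<subseteq> N"
      using N(1) bump_pos[of _ "l/3" "2*l/3" 0] l unfolding \<eta>_def by force
    then have "negligible {l/3<..<2*l/3}"
      using N(2) negligible_iff_null_sets negligible_subset by blast
    then show False using open_not_negligible[of "{l/3<..<2*l/3}"] l by auto
  qed
  \<comment> \<open>If \<open>u\<close> is a constant, testing it against \<eta> shows that it must
    be this one.\<close>
  define c where "c = (LINT y|?M. u y * \<eta> y) / m"
  have "AE y in ?M. u y - c = 0"
  proof (rule fundamental_lemma)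
    show "locally_integrable l (\<lambda>y. u y - c)"
      using u unfolding locally_integrable_def
      by (auto intro!: Bochner_Integration.integrable_diff continuous_imp_integrable_real)
    fix \<psi> assume \<psi>: "test_function l \<psi>"
    \<comment> \<open>This multiple of \<eta> makes the mean of \<open>\<omega>\<close>
      zero.\<close>
    define k where "k = (LINT y|?M. \<psi> y) / m"
    define \<omega> where "\<omega> y = \<psi> y + (- k) * \<eta> y" for y
    have s: "smooth \<omega>"
      unfolding \<omega>_def using \<psi> \<eta> by (intro smooth_add smooth_mult smooth_const) (simp_all add: test_function_iff)
    have "\<exists>K. compact K \<and> K \<subseteq> {0<..<l} \<and> (\<forall>x. x \<notin> K \<longrightarrow> \<omega> x = 0)"
    proof -
      obtain K K' where "compact K" "K \<subseteq> {0<..<l}" "\<forall>x. x \<notin> K \<longrightarrow> \<psi> x = 0"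
          "compact K'" "K' \<subseteq> {0<..<l}" "\<forall>x. x \<notin> K' \<longrightarrow> \<eta> x = 0"
        using \<psi> \<eta> unfolding test_function_iff by blast
      then show ?thesis by (intro exI[of _ "K \<union> K'"]) (auto simp: \<omega>_def)
    qed
    with s have \<omega>: "test_function l \<omega>" by (simp add: test_function_iff)
    have "\<exists>F. \<forall>x::real. -\<infinity> < ereal x \<longrightarrow> ereal x < \<infinity> \<longrightarrow> (F has_vector_derivative \<omega> x) (at x)"
      by (rule einterval_antiderivative) (use smooth_continuous_on[OF s, of UNIV] in \<open>auto simp: continuous_on_eq_continuous_at\<close>)
    then obtain F where F: "(F has_real_derivative \<omega> x) (at x)" for x
      by (auto simp: has_real_derivative_iff_has_vector_derivative)
    have dF: "deriv F = \<omega>" by (rule ext) (rule DERIV_imp_deriv[OF F])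
    have sF: "smooth F" by (rule smooth_antideriv[OF F s])
    have "prim l \<omega> l = 0"
      using \<open>m \<noteq> 0\<close> int1[OF \<psi>] int1[OF \<eta>] by (simp add: prim_l \<omega>_def k_def flip: m_def)
    then have Fl: "F l = F 0" using prim_deriv[OF sF, of l l] l by (simp add: dF)
    obtain a b B where ab: "0 < a" "b < l" "\<And>x. \<bar>\<omega> x\<bar> \<le> B" "\<And>x. x \<notin> {a..b} \<Longrightarrow> \<omega> x = 0"
      by (rule test_function_bound[OF \<omega>]) blast
    \<comment> \<open>The antiderivative is constant on each side of the support of
      \<open>\<omega>\<close>. Mean zero makes the two constants equal, so subtracting
      \<open>F 0\<close> gives compact support.\<close>
    have F0: "F x = F 0" if "x \<notin> {a..b}" for x
    proof -
      have 1: "F x = F y" if "convex S" "x \<in> S" "y \<in> S" "S \<inter> {a..b} = {}" for S x y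
      proof -
        have "\<exists>c. \<forall>x\<in>S. F x = c"
        proof (rule has_field_derivative_zero_constant[OF that(1)])
          fix z assume "z \<in> S"
          then have "\<omega> z = 0" using that(4) ab(4) by blast
          then show "(F has_field_derivative 0) (at z within S)"
            using F[of z] by (simp add: has_field_derivative_at_within)
        qed
        then show ?thesis using that(2,3) by metis
      qed
      show ?thesis
      proof (cases "x < a")
        case True then show ?thesis by (intro 1[of "{..<a}"]) (use ab in auto)
      next
        case False
        then have "F x = F l" by (intro 1[of "{b<..}"]) (use ab that in auto)
        then show ?thesis using Fl by simp
      qed
    qed
    have "test_function l (\<lambda>x. F x + (- F 0))"
      unfolding test_function_iff
    proof
      show "smooth (\<lambda>x. F x + (- F 0))" by (intro smooth_add smooth_const sF)
      have "\<forall>x. x \<notin> {a..b} \<longrightarrow> F x + (- F 0) = 0"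
      proof (intro allI impI)
        fix x assume "x \<notin> {a..b}"
        from F0[OF this] show "F x + (- F 0) = 0" by linarith
      qed
      moreover have "{a..b} \<subseteq> {0<..<l}" using ab by auto
      ultimately show "\<exists>K. compact K \<and> K \<subseteq> {0<..<l} \<and> (\<forall>x. x \<notin> K \<longrightarrow> F x + (- F 0) = 0)"
        using compact_Icc by blast
    qed
    moreover have "deriv (\<lambda>x. F x + (- F 0)) = \<omega>"
      by (rule ext, rule DERIV_imp_deriv) (auto intro!: derivative_eq_intros F)
    ultimately have "(LINT y|?M. u y * \<omega> y) = 0"
      using wz by metis
    moreover have "(LINT y|?M. u y * \<omega> y) = (LINT y|?M. u y * \<psi> y) - k * (LINT y|?M. u y * \<eta> y)"
    proof -
      have "(\<lambda>y. u y * \<omega> y) = (\<lambda>y. u y * \<psi> y - k * (u y * \<eta> y))"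
        by (auto simp: \<omega>_def algebra_simps)
      then show ?thesis using locally_integrable_test[OF u \<psi>] locally_integrable_test[OF u \<eta>] by simp
    qed
    moreover have "(LINT y|?M. (u y - c) * \<psi> y) = (LINT y|?M. u y * \<psi> y) - c * (LINT y|?M. \<psi> y)"
      using locally_integrable_test[OF u \<psi>] int1[OF \<psi>] by (simp add: left_diff_distrib)
    ultimately show "(LINT y|?M. (u y - c) * \<psi> y) = 0"
      by (simp add: c_def k_def)
  qed
  then show ?thesis using that[of c] by (simp add: ae_eq_def)
qed

text \<open>\<open>f\<close> and \<open>prim l g\<close> have the same weak derivative, so their
  difference has weak derivative zero and is a constant.\<close>

lemma weak_derivative_imp_prim:
  assumes l: "l > 0" and w: "weak_derivative l f g" and g: "integrable (interval_measure l) g"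
  obtains c where "ae_eq l f (\<lambda>y. c + prim l g y)"
proof -
  let ?M = "interval_measure l"
  note P = weak_derivative_prim[OF l g, of 0, simplified]
  have li: "locally_integrable l f" "locally_integrable l (prim l g)"
    using w P by (auto simp: weak_derivative_def)
  have "weak_derivative l (\<lambda>y. f y - prim l g y) (\<lambda>_. 0)"
    unfolding weak_derivative_def
  proof (intro conjI allI impI)
    show "locally_integrable l (\<lambda>y. f y - prim l g y)" "locally_integrable l (\<lambda>_. 0)"
      using li unfolding locally_integrable_def by auto
    fix \<phi> assume \<phi>: "test_function l \<phi>"
    have "(LINT y|?M. (f y - prim l g y) * deriv \<phi> y)
        = (LINT y|?M. f y * deriv \<phi> y) - (LINT y|?M. prim l g y * deriv \<phi> y)"
      using li test_function_deriv[OF \<phi>] by (simp add: left_diff_distrib locally_integrable_test)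
    then show "(LINT y|?M. (f y - prim l g y) * deriv \<phi> y) = - (LINT y|?M. 0 * \<phi> y)"
      using w P \<phi> by (simp add: weak_derivative_def)
  qed
  then obtain c where "ae_eq l (\<lambda>y. f y - prim l g y) (\<lambda>_. c)"
    using du_bois_reymond[OF l] by blast
  then have "ae_eq l f (\<lambda>y. c + prim l g y)"
    unfolding ae_eq_def by (rule eventually_mono) auto
  then show ?thesis by (rule that)
qed

section \<open>Point values of almost-everywhere classes\<close>

lemma AC_continuous_on:
  assumes "AC l m"
  shows "continuous_on {0..l} m"
  unfolding continuous_on_iff
proof (intro ballI allI impI)
  fix x e :: real assume x: "x \<in> {0..l}" and e: "e > 0"
  from assms[unfolded AC_def, rule_format, OF e] obtain d where "d > 0" and
    d: "\<forall>(n::nat) a b. (\<forall>i<n. 0 \<le> a i \<and> a i \<le> b i \<and> b i \<le> l) \<and>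
       disjoint_family_on (\<lambda>i. {a i<..<b i}) {..<n} \<and> (\<Sum>i<n. b i - a i) < d \<longrightarrow>
       (\<Sum>i<n. \<bar>m (b i) - m (a i)\<bar>) < e"
    by (rule exE) (erule conjE)
  have "dist (m y) (m x) < e" if "y \<in> {0..l}" "dist y x < d" for y
  proof -
    have "max x y - min x y < d" "min x y \<le> max x y"
      using that(2) unfolding dist_real_def by linarith+
    then have "\<bar>m (max x y) - m (min x y)\<bar> < e"
      using d[rule_format, of 1 "\<lambda>_. min x y" "\<lambda>_. max x y"] that(1) x
      by (simp add: disjoint_family_on_def)
    then show ?thesis
      by (cases "x \<le> y") (simp_all add: dist_real_def abs_minus_commute[of "m x"])
  qed
  with \<open>d > 0\<close> show "\<exists>d>0. \<forall>y\<in>{0..l}. dist y x < d \<longrightarrow> dist (m y) (m x) < e" by blast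
qed

text \<open>No nonempty open interval is null, so the set of agreement is dense in the closed
  interval. Continuity then gives equality at the endpoints too, where the traces are taken.\<close>

lemma ae_eq_continuous_eq:
  assumes l: "l > 0" and "continuous_on {0..l} F" "continuous_on {0..l} G" "ae_eq l F G" "x \<in> {0..l}"
  shows "F x = G x"
proof -
  define A where "A = {y \<in> {0<..<l}. F y - G y = 0}"
  have "AE y in lebesgue. y \<in> {0<..<l} \<longrightarrow> F y = G y"
    using assms(4) unfolding ae_eq_def interval_measure_def by (simp add: AE_restrict_space_iff)
  then obtain N where N: "{y. \<not> (y \<in> {0<..<l} \<longrightarrow> F y = G y)} \<subseteq> N" "N \<in> null_sets lebesgue"
    by (auto simp: eventually_ae_filter)
  have cl: "{0..l} \<subseteq> closure A"
  proof
    fix z assume z: "z \<in> {0..l}"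
    show "z \<in> closure A"
      unfolding closure_approachable
    proof (intro allI impI)
      fix e :: real assume "e > 0"
      let ?U = "{max 0 (z - e)<..<min l (z + e)}"
      have "\<not> negligible ?U"
        using z l \<open>e > 0\<close> by (intro open_not_negligible) auto
      then have "\<not> ?U \<subseteq> N"
        using N(2) negligible_iff_null_sets negligible_subset by blast
      then obtain y where "y \<in> ?U" "y \<notin> N" by blast
      then have "y \<in> A" "dist y z < e" using N(1) by (auto simp: A_def dist_real_def)
      then show "\<exists>y\<in>A. dist y z < e" by blast
    qed
  qed
  have A: "closure A = {0..l}"
  proof
    show "closure A \<subseteq> {0..l}" by (rule closure_minimal) (auto simp: A_def)
  qed (rule cl)
  have "F x - G x = 0"
    by (rule continuous_constant_on_closure[of A]) (use assms A in \<open>auto simp: A_def intro!: continuous_intros\<close>)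
  then show ?thesis by simp
qed

lemma ae_eq_sym: "ae_eq l f g \<Longrightarrow> ae_eq l g f"
  unfolding ae_eq_def by (simp add: eq_commute)

lemma ae_eq_trans: "ae_eq l f g \<Longrightarrow> ae_eq l g h \<Longrightarrow> ae_eq l f h"
  unfolding ae_eq_def by (erule (1) eventually_elim2) simp

lemma ae_eq_refl [simp]: "ae_eq l f f"
  by (simp add: ae_eq_def)

text \<open>Whatever representative the choice in \<open>ev\<close> picks, it is continuous and
  almost everywhere equal to \<open>F\<close>, hence equal to \<open>F\<close> on the closed
  interval. Every trace is computed through this.\<close>

lemma ev_eq:
  assumes l: "l > 0" and "f \<in> ACs l" "ae_eq l f F" "continuous_on {0..l} F" "x \<in> {0..l}"
  shows "ev l f x = F x"
proof -
  define m where "m = (SOME m. AC l m \<and> ae_eq l f m)"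
  have m: "AC l m \<and> ae_eq l f m"
    unfolding m_def by (rule someI_ex[where P = "\<lambda>m. AC l m \<and> ae_eq l f m"])
      (use assms(2) in \<open>auto simp: ACs_def\<close>)
  have "m x = F x"
    using m assms by (intro ae_eq_continuous_eq[OF l AC_continuous_on]) (auto intro: ae_eq_trans ae_eq_sym)
  then show ?thesis by (simp add: ev_def m_def)
qed

lemma integrable_mult_continuous:
  fixes f p :: "real \<Rightarrow> real"
  assumes "integrable (interval_measure l) f" "continuous_on UNIV p"
  shows "integrable (interval_measure l) (\<lambda>y. p y * f y)"
proof -
  have "compact (p ` {0..l})"
    by (intro compact_continuous_image continuous_on_subset[OF assms(2)]) auto
  then obtain B where B: "\<And>x. x \<in> {0..l} \<Longrightarrow> \<bar>p x\<bar> \<le> B"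
    using compact_imp_bounded bounded_iff by (metis imageI real_norm_def)
  show ?thesis
  proof (rule Bochner_Integration.integrable_bound)
    show "integrable (interval_measure l) (\<lambda>y. B * f y)" using assms(1) by simp
    show "(\<lambda>y. p y * f y) \<in> borel_measurable (interval_measure l)"
      by (intro borel_measurable_times measurable_borel_interval_measure borel_measurable_continuous_onI
          assms(2) borel_measurable_integrable assms(1))
    show "AE y in interval_measure l. norm (p y * f y) \<le> norm (B * f y)"
    proof (rule AE_I2)
      fix y assume "y \<in> space (interval_measure l)"
      then have "\<bar>p y\<bar> \<le> \<bar>B\<bar>" using B[of y] by auto
      then show "norm (p y * f y) \<le> norm (B * f y)"
        by (simp add: abs_mult mult_right_mono)
    qed
  qed
qed

lemma integration_by_parts_prim:
  assumes l: "l > 0" and f: "integrable (interval_measure l) f" and g: "integrable (interval_measure l) g"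
    and F: "\<And>x. F x = a + prim l f x" and G: "\<And>x. G x = b + prim l g x"
  shows "(LINT y|interval_measure l. F y * g y) = F l * G l - F 0 * G 0 - (LINT y|interval_measure l. f y * G y)"
proof -
  let ?M = "interval_measure l"
  have "(LINT y|?M. F y * g y) = (LINT y|?M. a * g y + prim l f y * g y)"
    by (simp add: F distrib_right)
  also have "\<dots> = a * prim l g l + (LINT y|?M. g y * prim l f y)"
    using g integrable_mult_continuous[OF g prim_continuous[OF f]]
    by (simp add: prim_l mult.commute[of "prim l f _"])
  finally have 1: "(LINT y|?M. F y * g y) = a * prim l g l + (LINT y|?M. g y * prim l f y)" .
  have "(LINT y|?M. f y * G y) = (LINT y|?M. b * f y + prim l g y * f y)"
    by (simp add: G distrib_left mult.commute[of "f _"])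
  also have "\<dots> = b * prim l f l + (LINT y|?M. f y * prim l g y)"
    using f integrable_mult_continuous[OF f prim_continuous[OF g]]
    by (simp add: prim_l mult.commute[of "prim l g _"])
  finally show ?thesis
    using 1 prim_product[OF f g] by (simp add: F G algebra_simps)
qed

section \<open>Sobolev functions as iterated integrals\<close>

definition ip :: "real \<Rightarrow> (real \<Rightarrow> real) \<Rightarrow> (real \<Rightarrow> real) \<Rightarrow> real"
  where "ip l f g = (LINT y|interval_measure l. f y * g y)"

lemma L2D:
  assumes "f \<in> L2 l"
  shows "f \<in> borel_measurable (interval_measure l)" "integrable (interval_measure l) (\<lambda>y. (f y)\<^sup>2)"
  using assms by (auto simp: L2_def)

lemma L2_mult_integrable:
  assumes f: "f \<in> L2 l" and g: "g \<in> L2 l"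
  shows "integrable (interval_measure l) (\<lambda>y. f y * g y)"
proof (rule Bochner_Integration.integrable_bound)
  show "integrable (interval_measure l) (\<lambda>y. (f y)\<^sup>2 + (g y)\<^sup>2)"
    using L2D[OF f] L2D[OF g] by simp
  show "(\<lambda>y. f y * g y) \<in> borel_measurable (interval_measure l)"
    using L2D[OF f] L2D[OF g] by simp
  show "AE y in interval_measure l. norm (f y * g y) \<le> norm ((f y)\<^sup>2 + (g y)\<^sup>2)"
  proof (rule AE_I2)
    fix y
    have "2 * (\<bar>f y\<bar> * \<bar>g y\<bar>) \<le> (f y)\<^sup>2 + (g y)\<^sup>2"
      using sum_squares_bound[of "\<bar>f y\<bar>" "\<bar>g y\<bar>"] by simp
    moreover have "0 \<le> \<bar>f y\<bar> * \<bar>g y\<bar>" by simp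
    ultimately show "norm (f y * g y) \<le> norm ((f y)\<^sup>2 + (g y)\<^sup>2)"
      unfolding real_norm_def abs_mult by linarith
  qed
qed

lemma L2_linear:
  assumes f: "f \<in> L2 l" and g: "g \<in> L2 l"
  shows "(\<lambda>y. a * f y + b * g y) \<in> L2 l"
proof -
  have "(\<lambda>y. (a * f y + b * g y)\<^sup>2) = (\<lambda>y. a\<^sup>2 * (f y)\<^sup>2 + (2 * a * b) * (f y * g y) + b\<^sup>2 * (g y)\<^sup>2)"
    by (auto simp: power2_eq_square algebra_simps)
  then show ?thesis
    using L2D[OF f] L2D[OF g] L2_mult_integrable[OF f g] by (simp add: L2_def)
qed

lemma L2_cmult: "f \<in> L2 l \<Longrightarrow> (\<lambda>y. a * f y) \<in> L2 l"
  and L2_add: "f \<in> L2 l \<Longrightarrow> g \<in> L2 l \<Longrightarrow> (\<lambda>y. f y + g y) \<in> L2 l"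
  and L2_diff: "f \<in> L2 l \<Longrightarrow> g \<in> L2 l \<Longrightarrow> (\<lambda>y. f y - g y) \<in> L2 l"
  using L2_linear[of f l f a 0] L2_linear[of f l g 1 1] L2_linear[of f l g 1 "-1"] by simp_all

lemma L2_cong_AE:
  assumes f: "f \<in> L2 l" and e: "ae_eq l f g" and g: "g \<in> borel_measurable (interval_measure l)"
  shows "g \<in> L2 l"
proof -
  have "AE y in interval_measure l. (f y)\<^sup>2 = (g y)\<^sup>2"
    using e unfolding ae_eq_def by (rule eventually_mono) simp
  then have "integrable (interval_measure l) (\<lambda>y. (g y)\<^sup>2)"
    using L2D[OF f] g by (subst integrable_cong_AE[symmetric]) auto
  then show ?thesis using g by (simp add: L2_def)
qed

lemma L2_continuous:
  assumes "continuous_on UNIV f"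
  shows "f \<in> L2 l"
proof -
  interpret finite_measure "interval_measure l" by (rule finite_interval_measure)
  have "integrable (interval_measure l) (\<lambda>y. f y * (f y * 1))"
    by (rule integrable_mult_continuous[OF integrable_mult_continuous[OF _ assms] assms]) simp
  then show ?thesis
    using assms by (simp add: L2_def power2_eq_square measurable_borel_interval_measure borel_measurable_continuous_onI)
qed

lemma L2_integrable: "f \<in> L2 l \<Longrightarrow> integrable (interval_measure l) f"
  using L2_mult_integrable[of f l "\<lambda>_. 1"] L2_continuous[of "\<lambda>_. 1" l] by simp

lemma ip_commute: "ip l f g = ip l g f"
  by (simp add: ip_def mult.commute)

lemma ip_linear_left:
  assumes "f \<in> L2 l" "g \<in> L2 l" "h \<in> L2 l"
  shows "ip l (\<lambda>y. a * f y + b * g y) h = a * ip l f h + b * ip l g h"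
proof -
  have "(\<lambda>y. (a * f y + b * g y) * h y) = (\<lambda>y. a * (f y * h y) + b * (g y * h y))"
    by (auto simp: algebra_simps)
  then show ?thesis
    using assms by (simp add: ip_def L2_mult_integrable)
qed

lemma ip_linear_right:
  assumes "f \<in> L2 l" "g \<in> L2 l" "h \<in> L2 l"
  shows "ip l h (\<lambda>y. a * f y + b * g y) = a * ip l h f + b * ip l h g"
  using ip_linear_left[OF assms] by (simp add: ip_commute)

lemma ip_add_right: "f \<in> L2 l \<Longrightarrow> g \<in> L2 l \<Longrightarrow> h \<in> L2 l \<Longrightarrow> ip l h (\<lambda>y. f y + g y) = ip l h f + ip l h g"
  using ip_linear_right[of f l g h 1 1] by simp

lemma ip_cmult_right: "ip l h (\<lambda>y. a * f y) = a * ip l h f"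
  by (simp add: ip_def mult.left_commute)

lemma ip_cong_AE:
  assumes "ae_eq l f f'" "ae_eq l g g'" "f \<in> L2 l" "g \<in> L2 l" "f' \<in> L2 l" "g' \<in> L2 l"
  shows "ip l f g = ip l f' g'"
  unfolding ip_def
proof (rule integral_cong_AE)
  show "AE y in interval_measure l. f y * g y = f' y * g' y"
    using assms(1,2) unfolding ae_eq_def by eventually_elim simp
qed (use assms L2D in \<open>auto intro!: borel_measurable_times\<close>)

lemma ip_self: "ip l f f = (L2_norm l f)\<^sup>2"
  by (simp add: ip_def L2_norm_def power2_eq_square)

lemma ip_self_nonneg: "0 \<le> ip l f f"
  by (simp add: ip_self)

lemma L2_norm_nonneg: "0 \<le> L2_norm l f"
  by (simp add: L2_norm_def)

lemma ip_young:
  assumes f: "f \<in> L2 l" and g: "g \<in> L2 l" and r: "r > 0"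
  shows "\<bar>ip l f g\<bar> \<le> r / 2 * ip l f f + ip l g g / (2 * r)"
proof -
  \<comment> \<open>This is the square of the norm of \<open>sqrt r f + (s / sqrt r) g\<close>; the
    signs s = 1 and s = -1 give the two halves of the absolute value.\<close>
  have "0 \<le> r * ip l f f + 2 * s * ip l f g + ip l g g / r" if "s\<^sup>2 = 1" for s
  proof -
    define q where "q = sqrt r"
    have q: "q > 0" "r = q * q" using r by (auto simp: q_def)
    have h: "(\<lambda>y. q * f y + (s / q) * g y) \<in> L2 l" by (rule L2_linear[OF f g])
    have "0 \<le> ip l (\<lambda>y. q * f y + (s / q) * g y) (\<lambda>y. q * f y + (s / q) * g y)"
      by (rule ip_self_nonneg)
    also have "\<dots> = q * (q * ip l f f + (s / q) * ip l f g) + (s / q) * (q * ip l f g + (s / q) * ip l g g)"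
      by (simp only: ip_linear_left[OF f g h] ip_linear_right[OF f g f] ip_linear_right[OF f g g] ip_commute[of l g f])
    also have "\<dots> = r * ip l f f + 2 * s * ip l f g + ip l g g / r"
      using q that by (simp add: field_simps power2_eq_square)
    finally show ?thesis .
  qed
  from this[of 1] this[of "-1"] r show ?thesis by (simp add: field_simps abs_le_iff)
qed

text \<open>Young's inequality with the optimal weight, the quotient of the two norms. A shift by
  \<open>d\<close> keeps that quotient defined when a norm is zero.\<close>

lemma ip_cauchy:
  assumes f: "f \<in> L2 l" and g: "g \<in> L2 l"
  shows "\<bar>ip l f g\<bar> \<le> L2_norm l f * L2_norm l g"
proof (rule field_le_epsilon)
  fix e :: real assume "e > 0"
  \<comment> \<open>Small enough that the error \<open>d * (d + L2_norm l f + L2_norm l g)\<close>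
    caused by the shift is at most \<open>e\<close>; the bound 1 absorbs the term quadratic in
    \<open>d\<close>.\<close>
  define d where "d = min 1 (e / (1 + L2_norm l f + L2_norm l g))"
  define a where "a = L2_norm l f + d"
  define b where "b = L2_norm l g + d"
  have pos: "1 + L2_norm l f + L2_norm l g > 0" using L2_norm_nonneg[of l f] L2_norm_nonneg[of l g] by simp
  then have d: "d > 0" "d \<le> 1"
    using \<open>e > 0\<close> by (auto simp: d_def)
  have "d \<le> e / (1 + L2_norm l f + L2_norm l g)" by (simp add: d_def)
  then have d': "d * (1 + L2_norm l f + L2_norm l g) \<le> e"
    using pos by (simp only: pos_le_divide_eq)
  have ab: "a > 0" "b > 0" "L2_norm l f \<le> a" "L2_norm l g \<le> b"
    using d L2_norm_nonneg[of l f] L2_norm_nonneg[of l g] by (auto simp: a_def b_def)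
  have "\<bar>ip l f g\<bar> \<le> (b / a) / 2 * (L2_norm l f)\<^sup>2 + (L2_norm l g)\<^sup>2 / (2 * (b / a))"
    using ip_young[OF f g, of "b / a"] ab by (simp add: ip_self)
  also have "\<dots> \<le> (b / a) / 2 * a\<^sup>2 + b\<^sup>2 / (2 * (b / a))"
    using ab L2_norm_nonneg by (intro add_mono mult_left_mono divide_right_mono power_mono) auto
  also have "\<dots> = a * b" using ab by (simp add: field_simps power2_eq_square)
  also have "\<dots> = L2_norm l f * L2_norm l g + d * (d + L2_norm l f + L2_norm l g)"
    by (simp add: a_def b_def algebra_simps)
  also have "\<dots> \<le> L2_norm l f * L2_norm l g + d * (1 + L2_norm l f + L2_norm l g)"
    using d by (intro add_left_mono mult_left_mono) auto
  finally show "\<bar>ip l f g\<bar> \<le> L2_norm l f * L2_norm l g + e" using d' by linarith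
qed

lemma L2_norm_triangle:
  assumes f: "f \<in> L2 l" and g: "g \<in> L2 l"
  shows "L2_norm l (\<lambda>y. f y + g y) \<le> L2_norm l f + L2_norm l g"
proof (rule power2_le_imp_le)
  have "(L2_norm l (\<lambda>y. f y + g y))\<^sup>2 = ip l f f + 2 * ip l f g + ip l g g"
    using ip_linear_left[OF f g L2_add[OF f g], of 1 1] f g
    by (simp add: ip_self[symmetric] ip_add_right ip_commute[of l g f])
  also have "\<dots> \<le> (L2_norm l f + L2_norm l g)\<^sup>2"
    using ip_cauchy[OF f g] by (simp add: ip_self power2_sum)
  finally show "(L2_norm l (\<lambda>y. f y + g y))\<^sup>2 \<le> (L2_norm l f + L2_norm l g)\<^sup>2" .
qed (simp add: L2_norm_nonneg)

lemma L2_norm_minus: "L2_norm l (\<lambda>y. - f y) = L2_norm l f"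
  by (simp add: L2_norm_def)

lemma L2_norm_diff_bound:
  assumes f: "f \<in> L2 l" and g: "g \<in> L2 l"
  shows "\<bar>L2_norm l f - L2_norm l g\<bar> \<le> L2_norm l (\<lambda>y. f y - g y)"
proof -
  have "L2_norm l f \<le> L2_norm l (\<lambda>y. f y - g y) + L2_norm l g"
    using L2_norm_triangle[OF L2_diff[OF f g] g] by simp
  moreover have "L2_norm l g \<le> L2_norm l (\<lambda>y. g y - f y) + L2_norm l f"
    using L2_norm_triangle[OF L2_diff[OF g f] f] by simp
  moreover have "L2_norm l (\<lambda>y. g y - f y) = L2_norm l (\<lambda>y. f y - g y)"
    using L2_norm_minus[of l "\<lambda>y. f y - g y"] by simp
  ultimately show ?thesis by linarith
qed

section \<open>Poincare and trace inequalities for iterated integrals\<close>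

lemma smooth_id: "smooth (\<lambda>x. x)"
  by (rule smooth_antideriv[OF _ smooth_const[of 1]]) auto

lemma prim_L2: "f \<in> L2 l \<Longrightarrow> prim l f \<in> L2 l"
  by (rule L2_continuous, rule prim_continuous, rule L2_integrable)

text \<open>Cauchy-Schwarz against the indicator of (0, x), whose squared norm is
  \<open>x\<close>.\<close>

lemma prim_square_le:
  assumes f: "f \<in> L2 l" and x: "x \<in> {0..l}"
  shows "(prim l f x)\<^sup>2 \<le> x * ip l f f"
proof (cases "x = 0")
  case False
  have i: "indicat_real {..x} \<in> L2 l"
  proof -
    interpret finite_measure "interval_measure l" by (rule finite_interval_measure)
    have "integrable (interval_measure l) (\<lambda>y. indicat_real {..x} y * 1)"
      by (rule integrable_interval_indicator) auto
    moreover have "(\<lambda>y. (indicat_real {..x} y)\<^sup>2) = indicat_real {..x}"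
      by (auto simp: indicator_def)
    ultimately show ?thesis by (simp add: L2_def indicator_measurable_interval)
  qed
  have "ip l (indicat_real {..x}) (indicat_real {..x}) = prim l (deriv (\<lambda>x. x)) x"
    unfolding ip_def prim_def by (rule Bochner_Integration.integral_cong) (auto simp: indicator_def)
  also have "\<dots> = x" using prim_deriv[OF smooth_id, of x l] False x by simp
  finally have ii: "ip l (indicat_real {..x}) (indicat_real {..x}) = x" .
  have "\<bar>prim l f x\<bar> \<le> L2_norm l (indicat_real {..x}) * L2_norm l f"
    using ip_cauchy[OF i f] by (simp add: ip_def prim_def)
  then have "\<bar>prim l f x\<bar>\<^sup>2 \<le> (L2_norm l (indicat_real {..x}) * L2_norm l f)\<^sup>2"
    by (rule power_mono) simp
  then show ?thesis by (simp add: power_mult_distrib ii flip: ip_self)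
qed simp

text \<open>Integrating the pointwise bound \<open>y * ip l f f\<close> over the interval produces
  the constant, since the integral of y from 0 to l is l^2 / 2.\<close>

lemma prim_poincare:
  assumes l: "l > 0" and f: "f \<in> L2 l"
  shows "ip l (prim l f) (prim l f) \<le> l\<^sup>2 / 2 * ip l f f"
proof -
  have "smooth (\<lambda>x. (1/2) * (x * x))"
    by (intro smooth_mult smooth_id smooth_const)
  moreover have "deriv (\<lambda>x. (1/2) * (x * x)) = (\<lambda>x::real. x)"
    by (rule ext, rule DERIV_imp_deriv) (auto intro!: derivative_eq_intros)
  ultimately have x: "(LINT y|interval_measure l. y) = l\<^sup>2 / 2"
    using prim_deriv[of "\<lambda>x. (1/2) * (x * x)" l l] l by (simp add: prim_l power2_eq_square)
  have "ip l (prim l f) (prim l f) \<le> (LINT y|interval_measure l. y * ip l f f)"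
    unfolding ip_def[of l "prim l f"]
  proof (rule integral_mono)
    show "integrable (interval_measure l) (\<lambda>y. prim l f y * prim l f y)"
      by (intro L2_mult_integrable prim_L2 f)
    show "integrable (interval_measure l) (\<lambda>y. y * ip l f f)"
      by (intro integrable_mult_left L2_integrable L2_continuous continuous_on_id)
    show "prim l f y * prim l f y \<le> y * ip l f f" if "y \<in> space (interval_measure l)" for y
      using prim_square_le[OF f, of y] that by (simp add: power2_eq_square)
  qed
  then show ?thesis by (simp add: x)
qed

lemma prim_prim_poincare:
  assumes l: "l > 0" and f: "f \<in> L2 l"
  shows "ip l (prim l (prim l f)) (prim l (prim l f)) \<le> l^4 / 4 * ip l f f"
proof -
  have "ip l (prim l (prim l f)) (prim l (prim l f)) \<le> l\<^sup>2 / 2 * ip l (prim l f) (prim l f)"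
    by (rule prim_poincare[OF l prim_L2[OF f]])
  also have "\<dots> \<le> l\<^sup>2 / 2 * (l\<^sup>2 / 2 * ip l f f)"
    by (intro mult_left_mono prim_poincare l f) simp
  finally show ?thesis by (simp add: power4_eq_xxxx power2_eq_square)
qed

lemma prim_prim_square_le:
  assumes l: "l > 0" and f: "f \<in> L2 l"
  shows "(prim l (prim l f) l)\<^sup>2 \<le> l^3 / 2 * ip l f f"
proof -
  have "(prim l (prim l f) l)\<^sup>2 \<le> l * ip l (prim l f) (prim l f)"
    by (rule prim_square_le[OF prim_L2[OF f]]) (use l in auto)
  also have "\<dots> \<le> l * (l\<^sup>2 / 2 * ip l f f)"
    by (intro mult_left_mono prim_poincare l f) (use l in simp)
  finally show ?thesis by (simp add: power3_eq_cube power2_eq_square)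
qed

section \<open>From chosen weak derivatives to representations\<close>

text \<open>A weak derivative picked by choice is known only to be locally integrable, while
  membership in \<open>L2\<close> asks for measurability on the whole interval. Truncations to an
  exhausting sequence converge to \<open>u\<close> pointwise.\<close>

lemma locally_integrable_measurable:
  assumes u: "locally_integrable l u"
  shows "u \<in> borel_measurable (interval_measure l)"
proof (rule borel_measurable_LIMSEQ_real)
  define D where "D n = {inverse (real (Suc n))..l - inverse (real (Suc n))}" for n
  show "(\<lambda>y. u y * indicat_real (D n) y) \<in> borel_measurable (interval_measure l)" for n
    by (rule borel_measurable_integrable, rule locally_integrable_mult_indicator[OF u,
        of "inverse (real (Suc n))" "l - inverse (real (Suc n))" _ 1])
      (auto simp: D_def indicator_def)
  fix y assume y: "y \<in> space (interval_measure l)"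
  have "\<forall>\<^sub>F n in sequentially. inverse (real (Suc n)) < min y (l - y)"
    using order_tendstoD(2)[OF LIMSEQ_inverse_real_of_nat, of "min y (l - y)"] y by simp
  then have "\<forall>\<^sub>F n in sequentially. u y * indicat_real (D n) y = u y"
    by (rule eventually_mono) (auto simp: D_def indicator_def)
  then show "(\<lambda>n. u y * indicat_real (D n) y) \<longlonglongrightarrow> u y"
    by (rule tendsto_eventually)
qed

lemma weak_derivative_cong:
  assumes w: "weak_derivative l F g" and e: "ae_eq l f F" and li: "locally_integrable l f"
  shows "weak_derivative l f g"
  unfolding weak_derivative_def
proof (intro conjI allI impI li)
  show "locally_integrable l g" using w by (simp add: weak_derivative_def)
  fix \<phi> assume \<phi>: "test_function l \<phi>"
  have "(LINT y|interval_measure l. f y * deriv \<phi> y) = (LINT y|interval_measure l. F y * deriv \<phi> y)"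
  proof (rule integral_cong_AE)
    show "AE y in interval_measure l. f y * deriv \<phi> y = F y * deriv \<phi> y"
      using e unfolding ae_eq_def by (rule eventually_mono) simp
    show "(\<lambda>y. f y * deriv \<phi> y) \<in> borel_measurable (interval_measure l)"
      by (intro borel_measurable_integrable locally_integrable_test li test_function_deriv \<phi>)
    show "(\<lambda>y. F y * deriv \<phi> y) \<in> borel_measurable (interval_measure l)"
      using w by (intro borel_measurable_integrable locally_integrable_test test_function_deriv \<phi>)
        (simp add: weak_derivative_def)
  qed
  then show "(LINT y|interval_measure l. f y * deriv \<phi> y) = - (LINT y|interval_measure l. g y * \<phi> y)"
    using w \<phi> by (simp add: weak_derivative_def)
qed

text \<open>Uniqueness of weak derivatives ties the arbitrary choice in \<open>wD\<close> to any
  derivative \<open>g\<close> that is already known.\<close>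

lemma weak_derivative_wD:
  assumes "weak_derivative l f g"
  shows "weak_derivative l f (wD l f)" "ae_eq l (wD l f) g" "g \<in> L2 l \<Longrightarrow> wD l f \<in> L2 l"
proof -
  show w: "weak_derivative l f (wD l f)"
    unfolding wD_def by (rule someI[where P = "weak_derivative l f", OF assms])
  show e: "ae_eq l (wD l f) g"
    by (rule weak_derivative_unique[OF w assms ae_eq_refl])
  show "wD l f \<in> L2 l" if "g \<in> L2 l"
    using L2_cong_AE[OF that ae_eq_sym[OF e]] w
    by (simp add: weak_derivative_def locally_integrable_measurable)
qed

lemma L2_locally_integrable: "f \<in> L2 l \<Longrightarrow> locally_integrable l f"
  by (intro integrable_imp_locally_integrable L2_integrable)

lemma H1_wD:
  assumes "f \<in> H1 l"
  shows "f \<in> L2 l" "weak_derivative l f (wD l f)" "wD l f \<in> L2 l"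
  using assms weak_derivative_wD unfolding H1_def by blast+

text \<open>The constant of integration is identified by evaluating at 0, where \<open>prim\<close>
  vanishes.\<close>

lemma H1_representation:
  assumes l: "l > 0" and f: "f \<in> H1 l" "f \<in> ACs l"
  shows "ae_eq l f (\<lambda>y. ev l f 0 + prim l (wD l f) y)"
    and "x \<in> {0..l} \<Longrightarrow> ev l f x = ev l f 0 + prim l (wD l f) x"
proof -
  have i: "integrable (interval_measure l) (wD l f)" by (rule L2_integrable[OF H1_wD(3)[OF f(1)]])
  obtain c where c: "ae_eq l f (\<lambda>y. c + prim l (wD l f) y)"
    using weak_derivative_imp_prim[OF l H1_wD(2)[OF f(1)] i] by blast
  have e: "ev l f x = c + prim l (wD l f) x" if "x \<in> {0..l}" for x
    by (rule ev_eq[OF l f(2) c _ that]) (intro continuous_intros prim_continuous i)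
  then have "ev l f 0 = c" using l by simp
  then show "ae_eq l f (\<lambda>y. ev l f 0 + prim l (wD l f) y)"
    and "x \<in> {0..l} \<Longrightarrow> ev l f x = ev l f 0 + prim l (wD l f) x"
    using c e by auto
qed

text \<open>Functions with vanishing traces at \<open>0\<close> are carried together with their highest derivative \<open>W\<close>;
  their traces at \<open>l\<close> are then values of \<open>prim\<close>.\<close>

definition prim_rep :: "real \<Rightarrow> (real \<Rightarrow> real) \<Rightarrow> (real \<Rightarrow> real) \<Rightarrow> bool"
  where "prim_rep l f W \<longleftrightarrow> f \<in> L2 l \<and> W \<in> L2 l \<and> ae_eq l f (prim l W)"

definition prim2_rep :: "real \<Rightarrow> (real \<Rightarrow> real) \<Rightarrow> (real \<Rightarrow> real) \<Rightarrow> bool"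
  where "prim2_rep l f W \<longleftrightarrow> f \<in> L2 l \<and> W \<in> L2 l \<and> ae_eq l f (prim l (prim l W))"

lemma H1_prim_rep:
  assumes "l > 0" "f \<in> H1 l" "f \<in> ACs l" "ev l f 0 = 0"
  shows "prim_rep l f (wD l f)"
  using H1_representation(1)[OF assms(1-3)] H1_wD[OF assms(2)] assms(4) by (simp add: prim_rep_def)

lemma H2_prim2_rep:
  assumes "l > 0" "f \<in> H2 l" "f \<in> ACs l" "wD l f \<in> ACs l" "ev l f 0 = 0" "ev l (wD l f) 0 = 0"
  shows "prim2_rep l f (wD l (wD l f))"
proof -
  have "prim_rep l f (wD l f)" "prim_rep l (wD l f) (wD l (wD l f))"
    using assms by (auto intro: H1_prim_rep simp: H2_def)
  then show ?thesis
    unfolding prim_rep_def prim2_rep_def using prim_cong_AE L2D(1) prim_L2 by metis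
qed

text \<open>The converse passage to \<open>H1_prim_rep\<close>: a representation built by linear
  algebra determines the chosen derivative up to a null set.\<close>

lemma prim_rep_wD:
  assumes l: "l > 0" and r: "prim_rep l f W"
  shows "ae_eq l (wD l f) W" "wD l f \<in> L2 l"
proof -
  have W: "W \<in> L2 l" and f: "f \<in> L2 l" "ae_eq l f (prim l W)" using r by (auto simp: prim_rep_def)
  have "weak_derivative l f W"
    using weak_derivative_cong[OF weak_derivative_prim[OF l L2_integrable[OF W], of 0]] f
    by (simp add: L2_locally_integrable)
  then show "ae_eq l (wD l f) W" "wD l f \<in> L2 l"
    using weak_derivative_wD W by blast+
qed

lemma prim2_rep_wD:
  assumes l: "l > 0" and r: "prim2_rep l f W"
  shows "ae_eq l (wD l (wD l f)) W" "wD l (wD l f) \<in> L2 l"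
proof -
  have W: "W \<in> L2 l" and f: "f \<in> L2 l" "ae_eq l f (prim l (prim l W))" using r by (auto simp: prim2_rep_def)
  have "prim_rep l f (prim l W)" using f prim_L2[OF W] by (simp add: prim_rep_def)
  then have "prim_rep l (wD l f) W" using prim_rep_wD[OF l] W by (simp add: prim_rep_def)
  then show "ae_eq l (wD l (wD l f)) W" "wD l (wD l f) \<in> L2 l"
    using prim_rep_wD[OF l] by blast+
qed

lemma prim_linear:
  "f \<in> L2 l \<Longrightarrow> g \<in> L2 l \<Longrightarrow> prim l (\<lambda>y. a * f y + b * g y) = (\<lambda>x. a * prim l f x + b * prim l g x)"
  by (rule ext) (simp add: prim_add prim_cmult L2_integrable)

text \<open>\<open>wD\<close> respects linear combinations only up to null sets, whereas here the
  derivative of the combination is the literal combination of the derivatives.\<close>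

lemma prim_rep_linear:
  assumes "prim_rep l f F" "prim_rep l g G"
  shows "prim_rep l (\<lambda>y. a * f y + b * g y) (\<lambda>y. a * F y + b * G y)"
proof -
  have "ae_eq l (\<lambda>y. a * f y + b * g y) (\<lambda>y. a * prim l F y + b * prim l G y)"
    using assms unfolding prim_rep_def ae_eq_def by (auto elim: eventually_elim2)
  then show ?thesis using assms by (simp add: prim_rep_def L2_linear prim_linear)
qed

lemma prim2_rep_linear:
  assumes "prim2_rep l f F" "prim2_rep l g G"
  shows "prim2_rep l (\<lambda>y. a * f y + b * g y) (\<lambda>y. a * F y + b * G y)"
proof -
  have "ae_eq l (\<lambda>y. a * f y + b * g y) (\<lambda>y. a * prim l (prim l F) y + b * prim l (prim l G) y)"
    using assms unfolding prim2_rep_def ae_eq_def by (auto elim: eventually_elim2)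
  then show ?thesis using assms by (simp add: prim2_rep_def L2_linear prim_linear prim_L2)
qed

lemma prim_rep_cong: "prim_rep l f F \<Longrightarrow> ae_eq l f g \<Longrightarrow> g \<in> L2 l \<Longrightarrow> prim_rep l g F"
  and prim2_rep_cong: "prim2_rep l f F \<Longrightarrow> ae_eq l f g \<Longrightarrow> g \<in> L2 l \<Longrightarrow> prim2_rep l g F"
  unfolding prim_rep_def prim2_rep_def by (blast intro: ae_eq_trans ae_eq_sym)+

section \<open>Energy identity\<close>

text \<open>\<open>u'\<close> is the derivative at the single time \<open>t\<close>, not a function
  of time. Membership in \<open>L2\<close> is bundled in because the triangle and Cauchy-Schwarz
  inequalities ask for it; at t = 0 the derivative is one-sided.\<close>

definition tderiv :: "real \<Rightarrow> (real \<Rightarrow> real \<Rightarrow> real) \<Rightarrow> (real \<Rightarrow> real) \<Rightarrow> real \<Rightarrow> bool"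
  where "tderiv l u u' t \<longleftrightarrow> (\<forall>s\<ge>0. u s \<in> L2 l) \<and> u' \<in> L2 l \<and>
    ((\<lambda>s. L2_norm l (\<lambda>y. (1 / (s - t)) * (u s y - u t y) - u' y)) \<longlongrightarrow> 0) (at t within {0..})"

lemma eventually_at_nonneg:
  "(\<And>s. s \<ge> 0 \<Longrightarrow> s \<noteq> t \<Longrightarrow> P s) \<Longrightarrow> \<forall>\<^sub>F s in at t within {0..}. P (s::real)"
  unfolding eventually_at_filter by (rule always_eventually) auto

lemma L2_norm_cmult: "L2_norm l (\<lambda>y. c * f y) = \<bar>c\<bar> * L2_norm l f"
  by (simp add: L2_norm_def power_mult_distrib real_sqrt_mult)

text \<open>The increment is \<open>s - t\<close> times the sum of \<open>u'\<close> and a remainder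
  that tends to zero.\<close>

lemma tderiv_continuous:
  assumes u: "tderiv l u u' t" and t: "t \<ge> 0"
  shows "((\<lambda>s. L2_norm l (\<lambda>y. u s y - u t y)) \<longlongrightarrow> 0) (at t within {0..})"
proof (rule Lim_null_comparison)
  let ?r = "\<lambda>s y. (1 / (s - t)) * (u s y - u t y) - u' y"
  have L: "u s \<in> L2 l" if "s \<ge> 0" for s using u that by (simp add: tderiv_def)
  have u': "u' \<in> L2 l" using u by (simp add: tderiv_def)
  have "norm (L2_norm l (\<lambda>y. u s y - u t y)) \<le> \<bar>s - t\<bar> * (L2_norm l (?r s) + L2_norm l u')"
    if "s \<ge> 0" "s \<noteq> t" for s
  proof -
    have r: "?r s \<in> L2 l" by (intro L2_diff L2_cmult L u' that t)
    have "(\<lambda>y. u s y - u t y) = (\<lambda>y. (s - t) * (?r s y + u' y))"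
      using that by (auto simp: field_simps)
    then have "L2_norm l (\<lambda>y. u s y - u t y) = \<bar>s - t\<bar> * L2_norm l (\<lambda>y. ?r s y + u' y)"
      by (simp only: L2_norm_cmult)
    also have "\<dots> \<le> \<bar>s - t\<bar> * (L2_norm l (?r s) + L2_norm l u')"
      by (intro mult_left_mono L2_norm_triangle r u') simp
    finally show ?thesis using L2_norm_nonneg by simp
  qed
  then show "\<forall>\<^sub>F s in at t within {0..}. norm (L2_norm l (\<lambda>y. u s y - u t y)) \<le> \<bar>s - t\<bar> * (L2_norm l (?r s) + L2_norm l u')"
    by (intro eventually_at_nonneg)
  have "((\<lambda>s. \<bar>s - t\<bar> * (L2_norm l (?r s) + L2_norm l u')) \<longlongrightarrow> \<bar>t - t\<bar> * (0 + L2_norm l u')) (at t within {0..})"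
    using u by (intro tendsto_intros) (auto simp: tderiv_def)
  then show "((\<lambda>s. \<bar>s - t\<bar> * (L2_norm l (?r s) + L2_norm l u')) \<longlongrightarrow> 0) (at t within {0..})"
    by simp
qed

lemma L2_norm_tendsto:
  fixes u :: "real \<Rightarrow> real \<Rightarrow> real"
  assumes "\<And>s. s \<ge> 0 \<Longrightarrow> u s \<in> L2 l" "t \<ge> 0"
    and "((\<lambda>s. L2_norm l (\<lambda>y. u s y - u t y)) \<longlongrightarrow> 0) (at t within {0..})"
  shows "((\<lambda>s. L2_norm l (u s)) \<longlongrightarrow> L2_norm l (u t)) (at t within {0..})"
proof -
  have "((\<lambda>s. L2_norm l (u s) - L2_norm l (u t)) \<longlongrightarrow> 0) (at t within {0..})"
  proof (rule Lim_null_comparison[OF eventually_at_nonneg assms(3)])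
    show "norm (L2_norm l (u s) - L2_norm l (u t)) \<le> L2_norm l (\<lambda>y. u s y - u t y)" if "s \<ge> 0" for s
      using L2_norm_diff_bound[OF assms(1)[OF that] assms(1)[OF assms(2)]] by simp
  qed
  then show ?thesis by (simp add: LIM_zero_iff)
qed

lemma ip_has_derivative:
  assumes u: "tderiv l u u' t" and v: "tderiv l v v' t" and t: "t \<ge> 0"
  shows "((\<lambda>s. ip l (u s) (v s)) has_real_derivative ip l u' (v t) + ip l (u t) v') (at t within {0..})"
proof -
  let ?ru = "\<lambda>s y. (1 / (s - t)) * (u s y - u t y) - u' y"
  let ?rv = "\<lambda>s y. (1 / (s - t)) * (v s y - v t y) - v' y"
  let ?D = "ip l u' (v t) + ip l (u t) v'"
  have L: "u s \<in> L2 l" "v s \<in> L2 l" if "s \<ge> 0" for s using u v that by (auto simp: tderiv_def)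
  have L': "u' \<in> L2 l" "v' \<in> L2 l" using u v by (auto simp: tderiv_def)
  \<comment> \<open>The error of the quotient splits into three inner products: the remainder of
    \<open>u\<close> with \<open>v s\<close>, \<open>u'\<close> with the increment of
    \<open>v\<close>, and \<open>u t\<close> with the remainder of \<open>v\<close>. Cauchy-Schwarz
    bounds each by a null function of \<open>s\<close>.\<close>
  have bound: "norm ((ip l (u s) (v s) - ip l (u t) (v t)) / (s - t) - ?D)
      \<le> L2_norm l (?ru s) * L2_norm l (v s) + L2_norm l u' * L2_norm l (\<lambda>y. v s y - v t y)
        + L2_norm l (u t) * L2_norm l (?rv s)" if s: "s \<ge> 0" "s \<noteq> t" for s
  proof -
    have ru: "?ru s \<in> L2 l" and rv: "?rv s \<in> L2 l" and dv: "(\<lambda>y. v s y - v t y) \<in> L2 l"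
      by (intro L2_diff L2_cmult L L' s t)+
    have du: "(\<lambda>y. u s y - u t y) \<in> L2 l" by (intro L2_diff L s t)
    have 1: "ip l (?ru s) (v s) = (1 / (s - t)) * (ip l (u s) (v s) - ip l (u t) (v s)) - ip l u' (v s)"
      using ip_linear_left[OF du L'(1) L(2)[OF s(1)], of "1 / (s - t)" "-1"]
        ip_linear_left[OF L(1)[OF s(1)] L(1)[OF t] L(2)[OF s(1)], of 1 "-1"] by simp
    have 2: "ip l u' (\<lambda>y. v s y - v t y) = ip l u' (v s) - ip l u' (v t)"
      using ip_linear_right[OF L(2)[OF s(1)] L(2)[OF t] L'(1), of 1 "-1"] by simp
    have 3: "ip l (u t) (?rv s) = (1 / (s - t)) * (ip l (u t) (v s) - ip l (u t) (v t)) - ip l (u t) v'"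
      using ip_linear_right[OF dv L'(2) L(1)[OF t], of "1 / (s - t)" "-1"]
        ip_linear_right[OF L(2)[OF s(1)] L(2)[OF t] L(1)[OF t], of 1 "-1"] by simp
    have "(ip l (u s) (v s) - ip l (u t) (v t)) / (s - t) - ?D
        = ip l (?ru s) (v s) + ip l u' (\<lambda>y. v s y - v t y) + ip l (u t) (?rv s)"
      unfolding 1 2 3 using s by (simp add: diff_divide_distrib)
    then show ?thesis
      using ip_cauchy[OF ru L(2)[OF s(1)]] ip_cauchy[OF L'(1) dv] ip_cauchy[OF L(1)[OF t] rv]
      unfolding real_norm_def by linarith
  qed
  have "((\<lambda>s. L2_norm l (?ru s) * L2_norm l (v s) + L2_norm l u' * L2_norm l (\<lambda>y. v s y - v t y)
        + L2_norm l (u t) * L2_norm l (?rv s)) \<longlongrightarrow>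
        0 * L2_norm l (v t) + L2_norm l u' * 0 + L2_norm l (u t) * 0) (at t within {0..})"
    using u v by (intro tendsto_intros tderiv_continuous[OF v t] L2_norm_tendsto[OF _ t tderiv_continuous[OF v t]])
      (auto simp: tderiv_def)
  then have "((\<lambda>s. (ip l (u s) (v s) - ip l (u t) (v t)) / (s - t) - ?D) \<longlongrightarrow> 0) (at t within {0..})"
    using Lim_null_comparison[OF eventually_at_nonneg[OF bound]] by simp
  then show ?thesis
    by (simp add: has_field_derivative_iff LIM_zero_iff)
qed

section \<open>The state norm through representations\<close>

context beam_string
begin

text \<open>Replaces the derivatives chosen by \<open>wD\<close> with those of any representation.
  This is how the norm of a difference quotient of states becomes computable.\<close>

lemma state_norm_rep:
  assumes l: "l > 0" and "prim2_rep l f W" "g \<in> L2 l" "prim_rep l h P" "z \<in> L2 l"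
  shows "(LINT y|interval_measure l.
      a1 * (wD l (wD l f) y)\<^sup>2 + (g y)\<^sup>2 + a2 * (wD l h y)\<^sup>2 + (z y)\<^sup>2)
    = a1 * ip l W W + ip l g g + a2 * ip l P P + ip l z z"
proof -
  note W = prim2_rep_wD[OF l assms(2)] and P = prim_rep_wD[OF l assms(4)]
  have L: "W \<in> L2 l" "P \<in> L2 l" using assms by (auto simp: prim_rep_def prim2_rep_def)
  have "(LINT y|interval_measure l.
      a1 * (wD l (wD l f) y)\<^sup>2 + (g y)\<^sup>2 + a2 * (wD l h y)\<^sup>2 + (z y)\<^sup>2)
    = a1 * ip l (wD l (wD l f)) (wD l (wD l f)) + ip l g g + a2 * ip l (wD l h) (wD l h) + ip l z z"
    using L2D(2)[OF W(2)] L2D(2)[OF P(2)] L2D(2)[OF assms(3)] L2D(2)[OF assms(5)]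
    by (simp add: ip_def power2_eq_square)
  then show ?thesis
    using ip_cong_AE[OF W(1) W(1) W(2) W(2) L(1) L(1)] ip_cong_AE[OF P(1) P(1) P(2) P(2) L(2) L(2)] by simp
qed

lemma state_norm_rep_sq:
  assumes "l > 0" "a1 \<ge> 0" "a2 \<ge> 0" "prim2_rep l f W" "g \<in> L2 l" "prim_rep l h P" "z \<in> L2 l"
  shows "(state_norm (f, g, h, z))\<^sup>2 = a1 * ip l W W + ip l g g + a2 * ip l P P + ip l z z"
  using state_norm_rep[OF assms(1,4-7)] assms(2,3)
  by (simp add: state_norm_def ip_self_nonneg)

lemma state_spaceD:
  assumes "l > 0" "(f, g, h, z) \<in> state_space"
  shows "prim2_rep l f (wD l (wD l f))" "g \<in> L2 l" "prim_rep l h (wD l h)" "z \<in> L2 l"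
  using assms by (auto simp: state_space_def intro: H1_prim_rep H2_prim2_rep)

lemma dom_AD:
  assumes "l > 0" "(f, g, h, z) \<in> dom_A"
  shows "(f, g, h, z) \<in> state_space" "prim2_rep l g (wD l (wD l g))" "prim_rep l z (wD l z)"
    "moment f g \<in> H2 l" "moment f g \<in> ACs l" "wD l (moment f g) \<in> ACs l" "ev l (moment f g) l = 0"
    "tension h z \<in> H1 l" "tension h z \<in> ACs l"
  using assms unfolding dom_A_def by (simp_all add: H1_prim_rep H2_prim2_rep)

end

section \<open>Integration by parts in space\<close>

text \<open>\<open>u\<close> and its first derivative vanish at 0, so boundary terms arise at
  \<open>l\<close> only. The first integration leaves the trace of \<open>u\<close> times the shear
  force, which is the prescribed datum; the second leaves a multiple of the moment at
  \<open>l\<close>, which is zero.\<close>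

lemma beam_integration_by_parts:
  assumes l: "l > 0" and u: "prim2_rep l u U" and M: "M \<in> H2 l" "M \<in> ACs l" "wD l M \<in> ACs l" "ev l M l = 0"
  shows "ip l u (wD l (wD l M)) = prim l (prim l U) l * ev l (wD l M) l + ip l U M"
proof -
  have H: "M \<in> H1 l" "wD l M \<in> H1 l" using M(1) by (auto simp: H2_def)
  note HM = H1_wD[OF H(1)] and HM' = H1_wD[OF H(2)]
  have U: "U \<in> L2 l" and u: "u \<in> L2 l" "ae_eq l u (prim l (prim l U))" using u by (auto simp: prim2_rep_def)
  define G where "G y = ev l (wD l M) 0 + prim l (wD l (wD l M)) y" for y
  define K where "K y = ev l M 0 + prim l (wD l M) y" for y
  have GL: "G \<in> L2 l" "K \<in> L2 l"
    unfolding G_def K_def by (intro L2_continuous continuous_intros prim_continuous L2_integrable HM HM')+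
  have ae: "ae_eq l (wD l M) G" "ae_eq l M K"
    unfolding G_def K_def using H1_representation(1)[OF l] H M by auto
  have end_G: "G l = ev l (wD l M) l" "K l = 0"
    unfolding G_def K_def using H1_representation(2)[OF l H(2) M(3), of l] H1_representation(2)[OF l H(1) M(2), of l] M(4) l
    by auto
  have "ip l u (wD l (wD l M)) = ip l (prim l (prim l U)) (wD l (wD l M))"
    by (intro ip_cong_AE u ae_eq_refl HM' prim_L2 U)
  also have "\<dots> = prim l (prim l U) l * G l - prim l (prim l U) 0 * G 0 - ip l (prim l U) G"
    unfolding ip_def
    by (rule integration_by_parts_prim[OF l L2_integrable[OF prim_L2[OF U]] L2_integrable[OF HM'(3)], where a = 0])
      (simp_all add: G_def)
  also have "ip l (prim l U) G = ip l (prim l U) (wD l M)"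
    by (intro ip_cong_AE ae_eq_refl ae_eq_sym[OF ae(1)] prim_L2 U GL HM)
  also have "ip l (prim l U) (wD l M) = prim l U l * K l - prim l U 0 * K 0 - ip l U K"
    unfolding ip_def
    by (rule integration_by_parts_prim[OF l L2_integrable[OF U] L2_integrable[OF HM(3)], where a = 0])
      (simp_all add: K_def)
  also have "ip l U K = ip l U M"
    by (intro ip_cong_AE ae_eq_refl ae_eq_sym[OF ae(2)] U GL HM)
  finally show ?thesis by (simp add: end_G)
qed

text \<open>The tension at \<open>l\<close> is the prescribed datum of the string, so its boundary
  term is kept.\<close>

lemma string_integration_by_parts:
  assumes l: "l > 0" and u: "prim_rep l u U" and T: "T \<in> H1 l" "T \<in> ACs l"
  shows "ip l u (wD l T) = prim l U l * ev l T l - ip l U T"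
proof -
  note HT = H1_wD[OF T(1)]
  have U: "U \<in> L2 l" and u: "u \<in> L2 l" "ae_eq l u (prim l U)" using u by (auto simp: prim_rep_def)
  define K where "K y = ev l T 0 + prim l (wD l T) y" for y
  have K: "K \<in> L2 l"
    unfolding K_def by (intro L2_continuous continuous_intros prim_continuous L2_integrable HT)
  have ae: "ae_eq l T K" "K l = ev l T l"
    unfolding K_def using H1_representation(1)[OF l T] H1_representation(2)[OF l T, of l] l by simp_all
  have "ip l u (wD l T) = ip l (prim l U) (wD l T)"
    by (intro ip_cong_AE u ae_eq_refl HT prim_L2 U)
  also have "\<dots> = prim l U l * K l - prim l U 0 * K 0 - ip l U K"
    unfolding ip_def
    by (rule integration_by_parts_prim[OF l L2_integrable[OF U] L2_integrable[OF HT(3)], where a = 0])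
      (simp_all add: K_def)
  also have "ip l U K = ip l U T"
    by (intro ip_cong_AE ae_eq_refl ae_eq_sym[OF ae(1)] U K HT)
  finally show ?thesis by (simp add: ae)
qed

text \<open>With \<open>q = 1 / (s - t)\<close> this is the remainder in \<open>tderiv\<close>:
  remainders of \<open>f\<close> are integrals of remainders of its derivative.\<close>

lemma prim_rep_quotient:
  assumes "prim_rep l f F" "prim_rep l g G" "prim_rep l h H"
  shows "prim_rep l (\<lambda>y. q * (f y - g y) - h y) (\<lambda>y. q * (F y - G y) - H y)"
  using prim_rep_linear[OF prim_rep_linear[OF assms(1,2), of q "- q"] assms(3), of 1 "-1"]
  by (simp add: right_diff_distrib)

lemma prim2_rep_quotient:
  assumes "prim2_rep l f F" "prim2_rep l g G" "prim2_rep l h H"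
  shows "prim2_rep l (\<lambda>y. q * (f y - g y) - h y) (\<lambda>y. q * (F y - G y) - H y)"
  using prim2_rep_linear[OF prim2_rep_linear[OF assms(1,2), of q "- q"] assms(3), of 1 "-1"]
  by (simp add: right_diff_distrib)

lemma prim_rep_ip_le:
  assumes l: "l > 0" and r: "prim_rep l f F"
  shows "ip l f f \<le> l\<^sup>2 / 2 * ip l F F"
proof -
  have "ip l f f = ip l (prim l F) (prim l F)"
    using r by (intro ip_cong_AE) (auto simp: prim_rep_def intro: prim_L2)
  then show ?thesis using prim_poincare[OF l, of F] r by (simp add: prim_rep_def)
qed

lemma prim2_rep_ip_le:
  assumes l: "l > 0" and r: "prim2_rep l f F"
  shows "ip l f f \<le> l^4 / 4 * ip l F F"
proof -
  have "ip l f f = ip l (prim l (prim l F)) (prim l (prim l F))"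
    using r by (intro ip_cong_AE) (auto simp: prim2_rep_def intro: prim_L2)
  then show ?thesis using prim_prim_poincare[OF l, of F] r by (simp add: prim2_rep_def)
qed

lemma tendsto_zero_of_square_le:
  fixes n N :: "real \<Rightarrow> real"
  assumes "\<And>s. s \<ge> 0 \<Longrightarrow> s \<noteq> t \<Longrightarrow> (n s)\<^sup>2 \<le> K * (N s)\<^sup>2"
    and "(N \<longlongrightarrow> 0) (at t within {0..})"
  shows "(n \<longlongrightarrow> 0) (at t within {0..})"
proof (rule Lim_null_comparison[OF eventually_at_nonneg])
  show "norm (n s) \<le> sqrt \<bar>K\<bar> * \<bar>N s\<bar>" if "s \<ge> 0" "s \<noteq> t" for s
  proof -
    have "(n s)\<^sup>2 \<le> \<bar>K\<bar> * (N s)\<^sup>2"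
      using assms(1)[OF that] by (meson abs_ge_self mult_right_mono order_trans zero_le_power2)
    then have "sqrt ((n s)\<^sup>2) \<le> sqrt (\<bar>K\<bar> * (N s)\<^sup>2)" by (rule real_sqrt_le_mono)
    then show ?thesis by (simp add: real_sqrt_mult)
  qed
  have "((\<lambda>s. sqrt \<bar>K\<bar> * \<bar>N s\<bar>) \<longlongrightarrow> sqrt \<bar>K\<bar> * \<bar>0\<bar>) (at t within {0..})"
    by (intro tendsto_intros assms)
  then show "((\<lambda>s. sqrt \<bar>K\<bar> * \<bar>N s\<bar>) \<longlongrightarrow> 0) (at t within {0..})" by simp
qed

section \<open>The derivative of the Lyapunov functional along solutions\<close>

context beam_string
begin

text \<open>The squared state norm of the remainder is a weighted sum of squared L2 norms, so it
  dominates the remainders of w_yy, w_t, phi_y and phi_t at once, and those of w and phi through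
  Poincare. Almost-everywhere equal functions are allowed as derivatives because the evolution
  equation holds only in the sense of \<open>state_eq\<close>.\<close>

lemma tderiv_components:
  assumes pos: "l > 0" "a1 > 0" "a2 > 0" and t: "t \<ge> 0"
    and X: "\<And>s. s \<ge> 0 \<Longrightarrow> (w s, v s, \<phi> s, \<psi> s) \<in> state_space"
    and X': "(w', v', \<phi>', \<psi>') \<in> state_space"
    and lim: "((\<lambda>s. state_norm ((1 / (s - t)) *\<^sub>R ((w s, v s, \<phi> s, \<psi> s) - (w t, v t, \<phi> t, \<psi> t))
        - (w', v', \<phi>', \<psi>'))) \<longlongrightarrow> 0) (at t within {0..})"
    and w0: "ae_eq l w' w0" "prim2_rep l w0 W0" and v0: "ae_eq l v' v0" "v0 \<in> L2 l"
    and \<phi>0: "ae_eq l \<phi>' \<phi>0" "prim_rep l \<phi>0 P0" and \<psi>0: "ae_eq l \<psi>' \<psi>0" "\<psi>0 \<in> L2 l"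
  shows "tderiv l (\<lambda>s. wD l (wD l (w s))) W0 t" "tderiv l w w0 t" "tderiv l v v0 t"
    "tderiv l (\<lambda>s. wD l (\<phi> s)) P0 t" "tderiv l \<phi> \<phi>0 t" "tderiv l \<psi> \<psi>0 t"
proof -
  define W where "W s = wD l (wD l (w s))" for s
  define P where "P s = wD l (\<phi> s)" for s
  define N where "N s = state_norm ((1 / (s - t)) *\<^sub>R ((w s, v s, \<phi> s, \<psi> s) - (w t, v t, \<phi> t, \<psi> t))
        - (w', v', \<phi>', \<psi>'))" for s
  define Q where "Q u u0 s y = (1 / (s - t)) * (u s y - u t y) - u0 y" for u :: "real \<Rightarrow> real \<Rightarrow> real" and u0 s y
  note D = state_spaceD[OF pos(1) X] and D' = state_spaceD[OF pos(1) X']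
  have L': "w' \<in> L2 l" "\<phi>' \<in> L2 l" using D' by (auto simp: prim_rep_def prim2_rep_def)
  have L: "w s \<in> L2 l" "W s \<in> L2 l" "\<phi> s \<in> L2 l" "P s \<in> L2 l" if "s \<ge> 0" for s
    using D[OF that] by (auto simp: prim_rep_def prim2_rep_def W_def P_def)
  have L0: "w0 \<in> L2 l" "W0 \<in> L2 l" "\<phi>0 \<in> L2 l" "P0 \<in> L2 l" using w0 \<phi>0 by (auto simp: prim_rep_def prim2_rep_def)
  have w'r: "prim2_rep l w' W0" by (rule prim2_rep_cong[OF w0(2) ae_eq_sym[OF w0(1)] L'(1)])
  have \<phi>'r: "prim_rep l \<phi>' P0" by (rule prim_rep_cong[OF \<phi>0(2) ae_eq_sym[OF \<phi>0(1)] L'(2)])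
  \<comment> \<open>The velocities are replaced by almost-everywhere equal ones. For the
    displacements the replacement acts on representations, so that \<open>W0\<close> and
    \<open>P0\<close> stand for the derivatives of \<open>w'\<close> and
    \<open>\<phi>'\<close>.\<close>
  have N2: "(N s)\<^sup>2 = a1 * ip l (Q W W0 s) (Q W W0 s) + ip l (Q v v0 s) (Q v v0 s)
      + a2 * ip l (Q P P0 s) (Q P P0 s) + ip l (Q \<psi> \<psi>0 s) (Q \<psi> \<psi>0 s)" if s: "s \<ge> 0" for s
  proof -
    have Ns: "N s = state_norm (Q w w' s, Q v v' s, Q \<phi> \<phi>' s, Q \<psi> \<psi>' s)"
      unfolding N_def by (rule arg_cong[where f = state_norm]) (auto simp: Q_def scaleR_fun_def fun_eq_iff)
    have LQ: "Q v v' s \<in> L2 l" "Q v v0 s \<in> L2 l" "Q \<psi> \<psi>' s \<in> L2 l" "Q \<psi> \<psi>0 s \<in> L2 l"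
      unfolding Q_def by (intro L2_diff L2_cmult D s t D' v0 \<psi>0)+
    have ae: "ae_eq l (Q v v' s) (Q v v0 s)" "ae_eq l (Q \<psi> \<psi>' s) (Q \<psi> \<psi>0 s)"
      using v0(1) \<psi>0(1) unfolding ae_eq_def Q_def by (auto elim: eventually_mono)
    have "prim2_rep l (Q w w' s) (Q W W0 s)" "prim_rep l (Q \<phi> \<phi>' s) (Q P P0 s)"
      unfolding Q_def W_def P_def by (intro prim2_rep_quotient prim_rep_quotient D s t w'r \<phi>'r)+
    from state_norm_rep_sq[OF pos(1) _ _ this(1) LQ(1) this(2) LQ(3)] pos
    show ?thesis
      unfolding Ns using ip_cong_AE[OF ae(1,1) LQ(1,1,2,2)] ip_cong_AE[OF ae(2,2) LQ(3,3,4,4)] by simp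
  qed
  have lim: "(N \<longlongrightarrow> 0) (at t within {0..})" using lim by (simp add: N_def[abs_def])
  have nn: "0 \<le> a1 * ip l f f" "0 \<le> a2 * ip l f f" "0 \<le> ip l f f" for f
    using pos ip_self_nonneg by auto
  have bW: "ip l (Q W W0 s) (Q W W0 s) \<le> 1 / a1 * (N s)\<^sup>2" if "s \<ge> 0" for s
  proof -
    have "a1 * ip l (Q W W0 s) (Q W W0 s) \<le> (N s)\<^sup>2"
      unfolding N2[OF that] using nn(3)[of "Q v v0 s"] nn(2)[of "Q P P0 s"] nn(3)[of "Q \<psi> \<psi>0 s"] by linarith
    then show ?thesis using pos by (simp add: field_simps)
  qed
  have bP: "ip l (Q P P0 s) (Q P P0 s) \<le> 1 / a2 * (N s)\<^sup>2" if "s \<ge> 0" for s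
  proof -
    have "a2 * ip l (Q P P0 s) (Q P P0 s) \<le> (N s)\<^sup>2"
      unfolding N2[OF that] using nn(3)[of "Q v v0 s"] nn(1)[of "Q W W0 s"] nn(3)[of "Q \<psi> \<psi>0 s"] by linarith
    then show ?thesis using pos by (simp add: field_simps)
  qed
  have bv: "ip l (Q v v0 s) (Q v v0 s) \<le> 1 * (N s)\<^sup>2" if "s \<ge> 0" for s
    unfolding N2[OF that] mult_1 using nn(1)[of "Q W W0 s"] nn(2)[of "Q P P0 s"] nn(3)[of "Q \<psi> \<psi>0 s"] by linarith
  have b\<psi>: "ip l (Q \<psi> \<psi>0 s) (Q \<psi> \<psi>0 s) \<le> 1 * (N s)\<^sup>2" if "s \<ge> 0" for s
    unfolding N2[OF that] mult_1 using nn(1)[of "Q W W0 s"] nn(2)[of "Q P P0 s"] nn(3)[of "Q v v0 s"] by linarith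
  have bw: "ip l (Q w w0 s) (Q w w0 s) \<le> (l^4 / 4 * (1 / a1)) * (N s)\<^sup>2" if s: "s \<ge> 0" for s
  proof -
    have "prim2_rep l (Q w w0 s) (Q W W0 s)"
      unfolding Q_def W_def by (intro prim2_rep_quotient D s t w0)
    from prim2_rep_ip_le[OF pos(1) this] mult_left_mono[OF bW[OF s], of "l^4 / 4"]
    show ?thesis unfolding mult.assoc by (rule order_trans) simp
  qed
  have b\<phi>: "ip l (Q \<phi> \<phi>0 s) (Q \<phi> \<phi>0 s) \<le> (l\<^sup>2 / 2 * (1 / a2)) * (N s)\<^sup>2" if s: "s \<ge> 0" for s
  proof -
    have "prim_rep l (Q \<phi> \<phi>0 s) (Q P P0 s)"
      unfolding Q_def P_def by (intro prim_rep_quotient D s t \<phi>0)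
    from prim_rep_ip_le[OF pos(1) this] mult_left_mono[OF bP[OF s], of "l\<^sup>2 / 2"]
    show ?thesis unfolding mult.assoc by (rule order_trans) simp
  qed
  have td: "tderiv l u u0 t"
    if "\<And>s. s \<ge> 0 \<Longrightarrow> u s \<in> L2 l" "u0 \<in> L2 l" "\<And>s. s \<ge> 0 \<Longrightarrow> ip l (Q u u0 s) (Q u u0 s) \<le> K * (N s)\<^sup>2" for u u0 K
    unfolding tderiv_def
  proof (intro conjI allI impI that(1,2))
    have "((\<lambda>s. L2_norm l (Q u u0 s)) \<longlongrightarrow> 0) (at t within {0..})"
      using that(3) by (intro tendsto_zero_of_square_le[OF _ lim]) (simp add: ip_self)
    then show "((\<lambda>s. L2_norm l (\<lambda>y. (1 / (s - t)) * (u s y - u t y) - u0 y)) \<longlongrightarrow> 0) (at t within {0..})"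
      by (simp add: Q_def[abs_def])
  qed
  show "tderiv l (\<lambda>s. wD l (wD l (w s))) W0 t"
    unfolding W_def[symmetric] by (rule td[OF L(2) L0(2) bW])
  show "tderiv l w w0 t" by (rule td[OF L(1) L0(1) bw])
  show "tderiv l v v0 t" by (rule td[OF D(2) v0(2) bv])
  show "tderiv l (\<lambda>s. wD l (\<phi> s)) P0 t"
    unfolding P_def[symmetric] by (rule td[OF L(4) L0(4) bP])
  show "tderiv l \<phi> \<phi>0 t" by (rule td[OF L(3) L0(3) b\<phi>])
  show "tderiv l \<psi> \<psi>0 t" by (rule td[OF D(4) \<psi>0(2) b\<psi>])
qed

text \<open>The terms weighted by \<open>b1\<close> and \<open>b2\<close> absorb the cross terms \<open>w\<^sub>y\<^sub>y w\<^sub>t\<^sub>y\<^sub>y\<close> and \<open>\<phi>\<^sub>y \<phi>\<^sub>t\<^sub>y\<close>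
  that the damping produces in the derivative of the coupling terms \<open>w w\<^sub>t\<close> and \<open>\<phi> \<phi>\<^sub>t\<close>.\<close>

definition lyapunov :: "real \<Rightarrow> real \<Rightarrow> state \<Rightarrow> real"
  where "lyapunov \<epsilon>1 \<epsilon>2 = (\<lambda>(f, g, h, z).
    (a1 * ip l (wD l (wD l f)) (wD l (wD l f)) + ip l g g + a2 * ip l (wD l h) (wD l h) + ip l z z) / 2
    + \<epsilon>2 * (ip l f g + b1 / 2 * ip l (wD l (wD l f)) (wD l (wD l f)))
    + \<epsilon>1 * (ip l h z + b2 / 2 * ip l (wD l h) (wD l h)))"

definition beam_force :: "(real \<Rightarrow> real) \<Rightarrow> state \<Rightarrow> real \<Rightarrow> real"
  where "beam_force e = (\<lambda>(f, g, h, z) y. c1 * h y + p1 * z y + q1 * g y + e y)"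

definition string_force :: "(real \<Rightarrow> real) \<Rightarrow> state \<Rightarrow> real \<Rightarrow> real"
  where "string_force e = (\<lambda>(f, g, h, z) y. c2 * h y + p2 * z y + q2 * g y + e y)"

text \<open>The derivative of \<open>lyapunov\<close> along solutions, with the traces at \<open>l\<close> written as iterated
  integrals.\<close>

definition dissipation :: "real \<Rightarrow> real \<Rightarrow> (real \<Rightarrow> real) \<Rightarrow> (real \<Rightarrow> real) \<Rightarrow> real \<Rightarrow> real \<Rightarrow> state \<Rightarrow> real"
  where "dissipation \<epsilon>1 \<epsilon>2 e1 e2 e3 e4 = (\<lambda>(f, g, h, z).
    - b1 * ip l (wD l (wD l g)) (wD l (wD l g)) - prim l (prim l (wD l (wD l g))) l * e3
      + ip l g (beam_force e1 (f, g, h, z))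
    - b2 * ip l (wD l z) (wD l z) + prim l (wD l z) l * e4 + ip l z (string_force e2 (f, g, h, z))
    + \<epsilon>2 * (ip l g g - a1 * ip l (wD l (wD l f)) (wD l (wD l f)) - prim l (prim l (wD l (wD l f))) l * e3
      + ip l f (beam_force e1 (f, g, h, z)))
    + \<epsilon>1 * (ip l z z - a2 * ip l (wD l h) (wD l h) + prim l (wD l h) l * e4
      + ip l h (string_force e2 (f, g, h, z))))"

lemma lyapunov_derivative:
  assumes pos: "l > 0" "a1 > 0" "a2 > 0" and t: "t \<ge> 0"
    and sol: "solution d1 d2 d3 d4 X0 X" and d: "d1 t \<in> L2 l" "d2 t \<in> L2 l"
  shows "((\<lambda>s. lyapunov \<epsilon>1 \<epsilon>2 (X s)) has_real_derivative
    dissipation \<epsilon>1 \<epsilon>2 (d1 t) (d2 t) (d3 t) (d4 t) (X t)) (at t within {0..})"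
proof -
  obtain X' where dom: "\<And>s. s \<ge> 0 \<Longrightarrow> X s \<in> dom_A"
    and X'sp: "\<And>s. s \<ge> 0 \<Longrightarrow> X' s \<in> state_space" and X'd: "has_time_derivative state_norm X X'"
    and eqs: "\<And>t. t \<ge> 0 \<Longrightarrow> state_eq (X' t) (op_A (X t) + forcing (d1 t) (d2 t) (X t))"
    and bc: "\<And>t. t \<ge> 0 \<Longrightarrow> op_B (X t) = (d3 t, d4 t)"
    using sol unfolding solution_def C0_into_def by blast
  define w where "w s = fst (X s)" for s
  define v where "v s = fst (snd (X s))" for s
  define \<phi> where "\<phi> s = fst (snd (snd (X s)))" for s
  define \<psi> where "\<psi> s = snd (snd (snd (X s)))" for s
  have X: "X s = (w s, v s, \<phi> s, \<psi> s)" for s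
    by (simp add: w_def v_def \<phi>_def \<psi>_def)
  obtain w' v' \<phi>' \<psi>' where X't: "X' t = (w', v', \<phi>', \<psi>')" by (metis prod_cases4)
  define M where "M = moment (w t) (v t)"
  define T where "T = tension (\<phi> t) (\<psi> t)"
  define W where "W s = wD l (wD l (w s))" for s
  define V where "V s = wD l (wD l (v s))" for s
  define P where "P s = wD l (\<phi> s)" for s
  define Z where "Z s = wD l (\<psi> s)" for s
  define F1 where "F1 = beam_force (d1 t) (X t)"
  define F2 where "F2 = string_force (d2 t) (X t)"
  note dm = dom_AD[OF pos(1) dom[unfolded X]]
  note ss = state_spaceD[OF pos(1) dm(1)]
  have M: "M \<in> H2 l" "M \<in> ACs l" "wD l M \<in> ACs l" "ev l M l = 0" and T: "T \<in> H1 l" "T \<in> ACs l"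
    using dm[OF t] by (auto simp: M_def T_def)
  have bcs: "ev l (wD l M) l = d3 t" "ev l T l = d4 t"
    using bc[OF t] by (auto simp: op_B_def X M_def T_def)
  have rw: "prim2_rep l (w s) (W s)" and rv: "prim2_rep l (v s) (V s)" and r\<phi>: "prim_rep l (\<phi> s) (P s)" and r\<psi>: "prim_rep l (\<psi> s) (Z s)"
    if "s \<ge> 0" for s
    using ss[OF that] dm[OF that] by (simp_all add: W_def V_def P_def Z_def)
  have L: "w t \<in> L2 l" "W t \<in> L2 l" "v t \<in> L2 l" "V t \<in> L2 l" "\<phi> t \<in> L2 l" "P t \<in> L2 l" "\<psi> t \<in> L2 l" "Z t \<in> L2 l"
    using rw[OF t] rv[OF t] r\<phi>[OF t] r\<psi>[OF t] by (auto simp: prim_rep_def prim2_rep_def)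
  have F: "F1 \<in> L2 l" "F2 \<in> L2 l"
    unfolding F1_def F2_def beam_force_def string_force_def X prod.case
    by (intro L2_add L2_cmult L d)+
  have M2: "wD l (wD l M) \<in> L2 l" using M(1) H1_wD by (auto simp: H2_def)
  have T1: "wD l T \<in> L2 l" using T(1) H1_wD by auto
  \<comment> \<open>\<open>G\<close> and \<open>H\<close> are the right-hand sides for w_tt and
    phi_tt. The factor \<open>(-1)\<close> puts \<open>G\<close> into the form of the linearity
    lemmas.\<close>
  define G where "G y = (-1) * wD l (wD l M) y + F1 y" for y
  define H where "H y = wD l T y + F2 y" for y
  have GH: "G \<in> L2 l" "H \<in> L2 l"
    unfolding G_def H_def by (intro L2_add L2_cmult M2 T1 F)+
  have "state_eq (w', v', \<phi>', \<psi>') (v t, G, \<psi> t, H)"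
    using eqs[OF t] unfolding X't X
    by (simp add: op_A_def forcing_def plus_fun_def G_def[abs_def] H_def[abs_def] F1_def F2_def
        beam_force_def string_force_def X M_def T_def)
  then have ae: "ae_eq l w' (v t)" "ae_eq l v' G" "ae_eq l \<phi>' (\<psi> t)" "ae_eq l \<psi>' H"
    by (auto simp: state_eq_def)
  note td = tderiv_components[OF pos t dm(1) X'sp[OF t, unfolded X't] _ ae(1) rv[OF t] ae(2) GH(1) ae(3) r\<psi>[OF t] ae(4) GH(2)]
  have lim: "((\<lambda>s. state_norm ((1 / (s - t)) *\<^sub>R ((w s, v s, \<phi> s, \<psi> s) - (w t, v t, \<phi> t, \<psi> t))
        - (w', v', \<phi>', \<psi>'))) \<longlongrightarrow> 0) (at t within {0..})"
    using X'd t unfolding has_time_derivative_def X X't[symmetric] by blast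
  note td = td[OF _ lim, folded W_def P_def]
  have lyap: "lyapunov \<epsilon>1 \<epsilon>2 (X s) = (a1 * ip l (W s) (W s) + ip l (v s) (v s) + a2 * ip l (P s) (P s) + ip l (\<psi> s) (\<psi> s)) / 2
    + \<epsilon>2 * (ip l (w s) (v s) + b1 / 2 * ip l (W s) (W s)) + \<epsilon>1 * (ip l (\<phi> s) (\<psi> s) + b2 / 2 * ip l (P s) (P s))" for s
    by (simp add: lyapunov_def X W_def P_def)
  have D: "((\<lambda>s. lyapunov \<epsilon>1 \<epsilon>2 (X s)) has_real_derivative
      (a1 * (ip l (V t) (W t) + ip l (W t) (V t)) + (ip l G (v t) + ip l (v t) G)
        + a2 * (ip l (Z t) (P t) + ip l (P t) (Z t)) + (ip l H (\<psi> t) + ip l (\<psi> t) H)) / 2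
      + \<epsilon>2 * ((ip l (v t) (v t) + ip l (w t) G) + b1 / 2 * (ip l (V t) (W t) + ip l (W t) (V t)))
      + \<epsilon>1 * ((ip l (\<psi> t) (\<psi> t) + ip l (\<phi> t) H) + b2 / 2 * (ip l (Z t) (P t) + ip l (P t) (Z t)))) (at t within {0..})"
    unfolding lyap
    by (intro DERIV_add DERIV_cdivide DERIV_cmult ip_has_derivative td t)
  \<comment> \<open>After integration by parts the moment carries no derivative any more, so it can
    be split into its elastic and damping parts within L2.\<close>
  have ipM: "ip l U M = a1 * ip l U (W t) + b1 * ip l U (V t)" if "U \<in> L2 l" for U
    unfolding M_def moment_def W_def[symmetric] V_def[symmetric] by (rule ip_linear_right[OF L(2,4) that])
  have ipT: "ip l U T = a2 * ip l U (P t) + b2 * ip l U (Z t)" if "U \<in> L2 l" for U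
    unfolding T_def tension_def P_def[symmetric] Z_def[symmetric] by (rule ip_linear_right[OF L(6,8) that])
  have ipG: "ip l u G = - (prim l (prim l U) l * d3 t + (a1 * ip l U (W t) + b1 * ip l U (V t))) + ip l u F1"
    if "prim2_rep l u U" for u U
  proof -
    have u: "u \<in> L2 l" "U \<in> L2 l" using that by (auto simp: prim2_rep_def)
    have "ip l u G = - ip l u (wD l (wD l M)) + ip l u F1"
      unfolding G_def using ip_linear_right[OF M2 F(1) u(1), of "-1" 1] by simp
    then show ?thesis
      using beam_integration_by_parts[OF pos(1) that M] by (simp add: bcs ipM u)
  qed
  have ipH: "ip l u H = prim l U l * d4 t - (a2 * ip l U (P t) + b2 * ip l U (Z t)) + ip l u F2"
    if "prim_rep l u U" for u U
  proof -
    have u: "u \<in> L2 l" "U \<in> L2 l" using that by (auto simp: prim_rep_def)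
    have "ip l u H = ip l u (wD l T) + ip l u F2"
      unfolding H_def by (rule ip_add_right[OF T1 F(2) u(1)])
    then show ?thesis
      using string_integration_by_parts[OF pos(1) that T] by (simp add: bcs ipT u)
  qed
  have diss: "dissipation \<epsilon>1 \<epsilon>2 (d1 t) (d2 t) (d3 t) (d4 t) (X t) =
    - b1 * ip l (V t) (V t) - prim l (prim l (V t)) l * d3 t + ip l (v t) F1
    - b2 * ip l (Z t) (Z t) + prim l (Z t) l * d4 t + ip l (\<psi> t) F2
    + \<epsilon>2 * (ip l (v t) (v t) - a1 * ip l (W t) (W t) - prim l (prim l (W t)) l * d3 t + ip l (w t) F1)
    + \<epsilon>1 * (ip l (\<psi> t) (\<psi> t) - a2 * ip l (P t) (P t) + prim l (P t) l * d4 t + ip l (\<phi> t) F2)"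
    by (simp add: dissipation_def X F1_def F2_def W_def V_def P_def Z_def)
  \<comment> \<open>The elastic parts of <w_t, w_tt> and <phi_t, phi_tt> cancel the derivative of
    the elastic energy; the damping parts of <w, w_tt> and <phi, phi_tt> cancel the terms weighted
    by \<open>b1\<close> and \<open>b2\<close>.\<close>
  show ?thesis
  proof (rule DERIV_cong[OF D])
    show "(a1 * (ip l (V t) (W t) + ip l (W t) (V t)) + (ip l G (v t) + ip l (v t) G)
        + a2 * (ip l (Z t) (P t) + ip l (P t) (Z t)) + (ip l H (\<psi> t) + ip l (\<psi> t) H)) / 2
      + \<epsilon>2 * ((ip l (v t) (v t) + ip l (w t) G) + b1 / 2 * (ip l (V t) (W t) + ip l (W t) (V t)))
      + \<epsilon>1 * ((ip l (\<psi> t) (\<psi> t) + ip l (\<phi> t) H) + b2 / 2 * (ip l (Z t) (P t) + ip l (P t) (Z t)))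
      = dissipation \<epsilon>1 \<epsilon>2 (d1 t) (d2 t) (d3 t) (d4 t) (X t)"
      unfolding diss ip_commute[of l G] ip_commute[of l H] ipG[OF rv[OF t]] ipG[OF rw[OF t]] ipH[OF r\<psi>[OF t]]
        ipH[OF r\<phi>[OF t]] ip_commute[of l "V t" "W t"] ip_commute[of l "Z t" "P t"]
      by (simp add: field_simps)
  qed
qed

end

section \<open>Exponential decay\<close>

lemma ip_young_upper:
  assumes "f \<in> L2 l" "g \<in> L2 l" "r > 0"
  shows "ip l f g \<le> r / 2 * ip l f f + 1 / r / 2 * ip l g g" "- ip l f g \<le> r / 2 * ip l f f + 1 / r / 2 * ip l g g"
  using ip_young[OF assms] by (auto simp: abs_le_iff mult.commute)

lemma product_young:
  fixes x y r :: real
  assumes "r > 0"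
  shows "x * y \<le> r / 2 * x\<^sup>2 + 1 / r / 2 * y\<^sup>2" "- x * y \<le> r / 2 * x\<^sup>2 + 1 / r / 2 * y\<^sup>2"
proof -
  have "0 \<le> (r * x - y)\<^sup>2 / (2 * r)" "0 \<le> (r * x + y)\<^sup>2 / (2 * r)" using assms by auto
  then show "x * y \<le> r / 2 * x\<^sup>2 + 1 / r / 2 * y\<^sup>2" "- x * y \<le> r / 2 * x\<^sup>2 + 1 / r / 2 * y\<^sup>2"
    using assms by (simp_all add: field_simps power2_eq_square)
qed

lemma prim_rep_end_le:
  assumes "l > 0" "prim_rep l f F"
  shows "(prim l F l)\<^sup>2 \<le> l * ip l F F"
  using prim_square_le[of F l l] assms by (simp add: prim_rep_def)

lemma prim2_rep_end_le:
  assumes "l > 0" "prim2_rep l f F"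
  shows "(prim l (prim l F) l)\<^sup>2 \<le> l^3 / 2 * ip l F F"
  using prim_prim_square_le[of l F] assms by (simp add: prim2_rep_def)

context beam_string
begin

text \<open>Each product is split by Young with its own weight: \<open>r 1\<close> for g h,
  \<open>r 2\<close> for g z, \<open>r 3\<close> for f h, \<open>r 4\<close> for f z,
  \<open>r 5\<close> for f g, \<open>r 6\<close> for z h, \<open>r 7\<close> and \<open>r 8\<close>
  for \<open>e1\<close> against g and f, \<open>r 9\<close> and \<open>r 10\<close> for
  \<open>e2\<close> against z and h, \<open>r 13\<close> and \<open>r 14\<close> for the traces
  against \<open>e3\<close> and \<open>e4\<close>. The undifferentiated squares of f and h are then
  moved to \<open>W\<close> and \<open>P\<close> by Poincare.\<close>

lemma dissipation_le:
  fixes r :: "nat \<Rightarrow> real"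
  assumes l: "l > 0"
    and sg: "c1 \<ge> 0" "c2 \<ge> 0" "p1 \<ge> 0" "p2 \<le> 0" "q1 \<le> 0" "q2 \<ge> 0" "\<epsilon>1 > 0" "\<epsilon>2 > 0"
    and r: "\<And>i. i \<in> {1..14} \<Longrightarrow> r i > 0"
    and \<Lambda>1: "\<Lambda>1 = 1/2 * (c1 * r 1 + p1 * r 2 - 2 * q1 + r 7 - \<epsilon>2 * q1 * r 5)
                   + q2 / 2 * (r 2 + \<epsilon>1 * r 1)"
    and \<Lambda>2: "\<Lambda>2 = \<epsilon>2 / (2 * r 12) + \<epsilon>2 * l^4 / 8 * (c1 * r 3 + p1 * r 4 - q1 / r 5 + r 8)
                   + \<epsilon>2^2 * l^3 * r 13 / 2"
    and \<Lambda>3: "\<Lambda>3 = p1 / 2 * (1 / r 2 + \<epsilon>2 / r 4)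
                   + 1/2 * (c2 * r 6 - 2 * p2 + q2 / r 2 + r 9 - \<epsilon>1 * p2 * r 6)"
    and \<Lambda>4: "\<Lambda>4 = \<epsilon>1 / (2 * r 11) + c1 * l^2 / 4 * (1 / r 1 + \<epsilon>2 / r 3)
                   + l^2 / 4 * (c2 / r 6 + 2 * \<epsilon>1 * c2 - \<epsilon>1 * p2 / r 6 + \<epsilon>1 * q2 / r 1 + \<epsilon>1 * r 10)
                   + l * r 14 * \<epsilon>1^2"
    and \<Lambda>5: "\<Lambda>5 = \<epsilon>1 / 2 * r 11 + l * r 14"
    and \<Lambda>6: "\<Lambda>6 = \<epsilon>2 / 2 * r 12 + l^3 * r 13 / 2"
    and dom: "(f, g, h, z) \<in> dom_A" and e: "e1 \<in> L2 l" "e2 \<in> L2 l"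
  defines "W \<equiv> wD l (wD l f)" and "V \<equiv> wD l (wD l g)" and "P \<equiv> wD l h" and "Z \<equiv> wD l z"
  shows "dissipation \<epsilon>1 \<epsilon>2 e1 e2 e3 e4 (f, g, h, z) \<le>
      (\<epsilon>2 + \<Lambda>1) * ip l g g + (\<Lambda>6 - b1) * ip l V V + (\<Lambda>2 - \<epsilon>2 * a1) * ip l W W
      + (\<epsilon>1 + \<Lambda>3) * ip l z z + (\<Lambda>5 - b2) * ip l Z Z + (\<Lambda>4 - \<epsilon>1 * a2) * ip l P P
      + (1 / r 7 / 2 + \<epsilon>2 * (1 / r 8 / 2)) * ip l e1 e1 + (1 / r 9 / 2 + \<epsilon>1 * (1 / r 10 / 2)) * ip l e2 e2
      + 1 / r 13 * e3\<^sup>2 + 1 / r 14 * e4\<^sup>2"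
proof -
  note ds = dom_AD[OF l dom] and ss = state_spaceD[OF l dom_AD(1)[OF l dom]]
  have rf: "prim2_rep l f W" and rg: "prim2_rep l g V" and rh: "prim_rep l h P" and rz: "prim_rep l z Z"
    using ds ss by (simp_all add: W_def V_def P_def Z_def)
  have L: "f \<in> L2 l" "g \<in> L2 l" "h \<in> L2 l" "z \<in> L2 l"
    using rf rg rh rz by (auto simp: prim_rep_def prim2_rep_def)
  define i where "i k = 1 / r k" for k
  have r0: "r k > 0" "i k > 0" if "k \<in> {1..14}" for k using r[OF that] by (auto simp: i_def)
  note [simp] = ip_self_nonneg
  have bf: "ip l g (beam_force e1 (f, g, h, z)) = c1 * ip l g h + p1 * ip l g z + q1 * ip l g g + ip l g e1"
    "ip l f (beam_force e1 (f, g, h, z)) = c1 * ip l f h + p1 * ip l f z + q1 * ip l f g + ip l f e1"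
    unfolding beam_force_def prod.case
    by (simp_all add: ip_add_right ip_cmult_right L2_add L2_cmult L e)
  have sf: "ip l z (string_force e2 (f, g, h, z)) = c2 * ip l z h + p2 * ip l z z + q2 * ip l z g + ip l z e2"
    "ip l h (string_force e2 (f, g, h, z)) = c2 * ip l h h + p2 * ip l h z + q2 * ip l h g + ip l h e2"
    unfolding string_force_def prod.case
    by (simp_all add: ip_add_right ip_cmult_right L2_add L2_cmult L e)
  note Y = ip_young_upper[of _ l _ "r _", folded i_def] and mm = mult_left_mono
  have R1: "ip l g (beam_force e1 (f, g, h, z)) \<le>
      (c1 * r 1 / 2 + p1 * r 2 / 2 + q1 + r 7 / 2) * ip l g g + c1 * i 1 / 2 * ip l h h + p1 * i 2 / 2 * ip l z z
      + i 7 / 2 * ip l e1 e1"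
    using mm[OF Y(1)[OF L(2) L(3) r0(1), of 1] sg(1)] mm[OF Y(1)[OF L(2) L(4) r0(1), of 2] sg(3)]
      Y(1)[OF L(2) e(1) r0(1), of 7] unfolding bf by (simp add: algebra_simps)
  have R2: "ip l f (beam_force e1 (f, g, h, z)) \<le>
      (c1 * r 3 / 2 + p1 * r 4 / 2 - q1 * i 5 / 2 + r 8 / 2) * ip l f f - q1 * r 5 / 2 * ip l g g
      + c1 * i 3 / 2 * ip l h h + p1 * i 4 / 2 * ip l z z + i 8 / 2 * ip l e1 e1"
    using mm[OF Y(1)[OF L(1) L(3) r0(1), of 3] sg(1)] mm[OF Y(1)[OF L(1) L(4) r0(1), of 4] sg(3)]
      \<comment> \<open>Since \<open>q1\<close> is nonpositive, the term is \<open>- q1\<close>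
        times the negated product, so the second Young inequality is the one to multiply.\<close>
      mm[OF Y(2)[OF L(2) L(1) r0(1), of 5], of "- q1"] sg(5)
      Y(1)[OF L(1) e(1) r0(1), of 8] unfolding bf by (simp add: algebra_simps ip_commute[of l g f])
  have R3: "ip l z (string_force e2 (f, g, h, z)) \<le>
      (c2 * r 6 / 2 + p2 + q2 * i 2 / 2 + r 9 / 2) * ip l z z + c2 * i 6 / 2 * ip l h h + q2 * r 2 / 2 * ip l g g
      + i 9 / 2 * ip l e2 e2"
    using mm[OF Y(1)[OF L(4) L(3) r0(1), of 6] sg(2)] mm[OF Y(1)[OF L(2) L(4) r0(1), of 2] sg(6)]
      Y(1)[OF L(4) e(2) r0(1), of 9] unfolding sf by (simp add: algebra_simps ip_commute[of l g z])
  have R4: "ip l h (string_force e2 (f, g, h, z)) \<le>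
      (c2 - p2 * i 6 / 2 + q2 * i 1 / 2 + r 10 / 2) * ip l h h - p2 * r 6 / 2 * ip l z z + q2 * r 1 / 2 * ip l g g
      + i 10 / 2 * ip l e2 e2"
    using mm[OF Y(2)[OF L(4) L(3) r0(1), of 6], of "- p2"] sg(4) mm[OF Y(1)[OF L(2) L(3) r0(1), of 1] sg(6)]
      Y(1)[OF L(3) e(2) r0(1), of 10] unfolding sf by (simp add: algebra_simps ip_commute[of l z h] ip_commute[of l g h])
  have l3: "l^3 > 0" "l^4 > 0" "l\<^sup>2 > 0" using l by auto
  note py = product_young[of "r _", folded i_def]
  \<comment> \<open>The trace inequality gives the coefficient \<open>l^3 * r 13 / 4\<close>; it is
    doubled to match the one in \<open>\<Lambda>6\<close>.\<close>
  have E3: "- prim l (prim l V) l * e3 \<le> (l^3 * r 13 / 2) * ip l V V + i 13 / 2 * e3\<^sup>2"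
  proof -
    have "r 13 / 2 * (prim l (prim l V) l)\<^sup>2 \<le> r 13 / 2 * (l^3 / 2 * ip l V V)"
      by (rule mm[OF prim2_rep_end_le[OF l rg]]) (use r0[of 13] in simp)
    moreover have "r 13 / 2 * (l^3 / 2 * ip l V V) \<le> r 13 / 2 * (l^3 * ip l V V)"
      using r0[of 13] l3 by (intro mult_left_mono mult_right_mono) auto
    ultimately show ?thesis using py(2)[OF r0(1), of 13 "prim l (prim l V) l" e3] by (simp add: mult_ac)
  qed
  have E3': "\<epsilon>2 * (- prim l (prim l W) l * e3) \<le> (\<epsilon>2\<^sup>2 * l^3 * r 13 / 2) * ip l W W + i 13 / 2 * e3\<^sup>2"
  proof -
    have "r 13 / 2 * (\<epsilon>2\<^sup>2 * (prim l (prim l W) l)\<^sup>2) \<le> r 13 / 2 * (\<epsilon>2\<^sup>2 * (l^3 / 2 * ip l W W))"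
      by (rule mm[OF mm[OF prim2_rep_end_le[OF l rf]]]) (use r0[of 13] in simp_all)
    moreover have "r 13 / 2 * (\<epsilon>2\<^sup>2 * (l^3 / 2 * ip l W W)) \<le> r 13 / 2 * (\<epsilon>2\<^sup>2 * (l^3 * ip l W W))"
      using r0[of 13] l3 by (intro mult_left_mono mult_right_mono) auto
    ultimately show ?thesis using py(2)[OF r0(1), of 13 "\<epsilon>2 * prim l (prim l W) l" e3]
      by (simp add: mult_ac power_mult_distrib)
  qed
  \<comment> \<open>Young is applied with weight \<open>2 * r 14\<close>, so the halved weight times
    the trace constant \<open>l\<close> is exactly the \<open>l * r 14\<close> of
    \<open>\<Lambda>5\<close>.\<close>
  have r14: "2 * r 14 > 0" using r0[of 14] by simp
  have i14: "1 / (2 * r 14) / 2 = i 14 / 4" by (simp add: i_def)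
  note py4 = product_young(1)[OF r14, unfolded i14]
  have E4: "prim l Z l * e4 \<le> (l * r 14) * ip l Z Z + i 14 / 4 * e4\<^sup>2"
  proof -
    have "r 14 * (prim l Z l)\<^sup>2 \<le> r 14 * (l * ip l Z Z)"
      by (rule mm[OF prim_rep_end_le[OF l rz]]) (use r0[of 14] in simp)
    then show ?thesis using py4[of "prim l Z l" e4] by (simp add: mult_ac)
  qed
  have E4': "\<epsilon>1 * (prim l P l * e4) \<le> (l * r 14 * \<epsilon>1\<^sup>2) * ip l P P + i 14 / 4 * e4\<^sup>2"
  proof -
    have "r 14 * (\<epsilon>1\<^sup>2 * (prim l P l)\<^sup>2) \<le> r 14 * (\<epsilon>1\<^sup>2 * (l * ip l P P))"
      by (rule mm[OF mm[OF prim_rep_end_le[OF l rh]]]) (use r0[of 14] in simp_all)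
    then show ?thesis using py4[of "\<epsilon>1 * prim l P l" e4] by (simp add: mult_ac power_mult_distrib)
  qed
  \<comment> \<open>\<open>kf\<close> and \<open>kh\<close> collect the coefficients of the squares
    of f and h. The signs of the constants make both nonnegative, which allows Poincare to be
    multiplied by them.\<close>
  define kf where "kf = \<epsilon>2 * (c1 * r 3 / 2 + p1 * r 4 / 2 - q1 * i 5 / 2 + r 8 / 2)"
  define kh where "kh = c1 * i 1 / 2 + \<epsilon>2 * (c1 * i 3 / 2) + c2 * i 6 / 2
      + \<epsilon>1 * (c2 - p2 * i 6 / 2 + q2 * i 1 / 2 + r 10 / 2)"
  have nn: "0 \<le> r k" "0 \<le> i k" if "k \<in> {1..14}" for k using r0[OF that] by auto
  have neg: "0 \<le> - q1 * i 5" "0 \<le> - p2 * i 6" using sg nn(2)[of 5] nn(2)[of 6] by (auto intro: mult_nonpos_nonneg)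
  have "0 \<le> kf"
    unfolding kf_def using sg nn[of 3] nn[of 4] nn[of 8] neg
    by (intro mult_nonneg_nonneg) (auto intro!: add_nonneg_nonneg simp: diff_conv_add_uminus simp del: add_uminus_conv_diff)
  then have kf: "kf * ip l f f \<le> kf * (l^4 / 4 * ip l W W)"
    by (intro mult_left_mono prim2_rep_ip_le l rf)
  have "0 \<le> kh"
    unfolding kh_def using sg nn[of 1] nn[of 3] nn[of 6] nn[of 10] neg
    by (intro add_nonneg_nonneg mult_nonneg_nonneg) (auto intro!: add_nonneg_nonneg simp: diff_conv_add_uminus simp del: add_uminus_conv_diff)
  then have kh: "kh * ip l h h \<le> kh * (l\<^sup>2 / 2 * ip l P P)"
    by (intro mult_left_mono prim_rep_ip_le l rh)
  define kg where "kg = c1 * r 1 / 2 + p1 * r 2 / 2 + q1 + r 7 / 2 - \<epsilon>2 * (q1 * r 5 / 2) + q2 * r 2 / 2 + \<epsilon>1 * (q2 * r 1 / 2)"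
  define kz where "kz = p1 * i 2 / 2 + \<epsilon>2 * (p1 * i 4 / 2) + c2 * r 6 / 2 + p2 + q2 * i 2 / 2 + r 9 / 2 - \<epsilon>1 * (p2 * r 6 / 2)"
  have S: "ip l g (beam_force e1 (f, g, h, z)) + \<epsilon>2 * ip l f (beam_force e1 (f, g, h, z))
      + ip l z (string_force e2 (f, g, h, z)) + \<epsilon>1 * ip l h (string_force e2 (f, g, h, z))
    \<le> kg * ip l g g + kf * ip l f f + kz * ip l z z + kh * ip l h h
      + (i 7 / 2 + \<epsilon>2 * (i 8 / 2)) * ip l e1 e1 + (i 9 / 2 + \<epsilon>1 * (i 10 / 2)) * ip l e2 e2"
    using R1 mm[OF R2, of \<epsilon>2] R3 mm[OF R4, of \<epsilon>1] sg unfolding kg_def kz_def kf_def kh_def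
    by (simp add: algebra_simps)
  \<comment> \<open>The coupling contributes \<open>q1\<close>, and \<open>\<Lambda>1\<close>
    contains \<open>- q1\<close>, which is at least as large. The same happens with
    \<open>p2\<close> in \<open>\<Lambda>3\<close> below.\<close>
  have C1: "kg * ip l g g \<le> \<Lambda>1 * ip l g g"
    unfolding kg_def \<Lambda>1 using sg by (intro mult_right_mono) (auto simp: algebra_simps)
  \<comment> \<open>The Poincare constant turns the halves in \<open>kf\<close> into the factor
    \<open>l^4 / 8\<close>; \<open>\<Lambda>2\<close> exceeds the left coefficient by the
    nonnegative \<open>\<epsilon>2 / (2 * r 12)\<close>.\<close>
  have C2: "(kf * (l^4 / 4) + \<epsilon>2\<^sup>2 * l^3 * r 13 / 2) * ip l W W \<le> \<Lambda>2 * ip l W W"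
    unfolding kf_def \<Lambda>2 i_def using sg r0[of 12] by (intro mult_right_mono) (auto simp: algebra_simps add_divide_distrib diff_divide_distrib)
  have C3: "kz * ip l z z \<le> \<Lambda>3 * ip l z z"
    unfolding kz_def \<Lambda>3 i_def using sg by (intro mult_right_mono) (auto simp: algebra_simps)
  have C4: "(kh * (l\<^sup>2 / 2) + l * r 14 * \<epsilon>1\<^sup>2) * ip l P P \<le> \<Lambda>4 * ip l P P"
  proof -
    have "\<Lambda>4 = \<epsilon>1 / (2 * r 11) + c1 * l\<^sup>2 / 4 * (i 1 + \<epsilon>2 * i 3)
      + l\<^sup>2 / 4 * (c2 * i 6 + 2 * \<epsilon>1 * c2 - \<epsilon>1 * p2 * i 6 + \<epsilon>1 * q2 * i 1 + \<epsilon>1 * r 10) + l * r 14 * \<epsilon>1\<^sup>2"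
      by (simp add: \<Lambda>4 i_def)
    moreover have "0 \<le> \<epsilon>1 / (2 * r 11)" using sg r0[of 11] by simp
    ultimately have "kh * (l\<^sup>2 / 2) + l * r 14 * \<epsilon>1\<^sup>2 \<le> \<Lambda>4"
      unfolding kh_def by (simp add: algebra_simps add_divide_distrib)
    then show ?thesis by (intro mult_right_mono) auto
  qed
  have C5: "(l * r 14) * ip l Z Z \<le> \<Lambda>5 * ip l Z Z"
    unfolding \<Lambda>5 using sg r0[of 11] by (intro mult_right_mono) auto
  have C6: "(l^3 * r 13 / 2) * ip l V V \<le> \<Lambda>6 * ip l V V"
    unfolding \<Lambda>6 using sg r0[of 12] by (intro mult_right_mono) auto
  \<comment> \<open>The trace of phi_t and the trace of phi each contribute a quarter of
    \<open>i 14\<close>.\<close>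
  have I: "i 14 / 4 * e4\<^sup>2 + i 14 / 4 * e4\<^sup>2 \<le> i 14 * e4\<^sup>2"
    using r0[of 14] by simp
  have "dissipation \<epsilon>1 \<epsilon>2 e1 e2 e3 e4 (f, g, h, z)
    = (ip l g (beam_force e1 (f, g, h, z)) + \<epsilon>2 * ip l f (beam_force e1 (f, g, h, z))
      + ip l z (string_force e2 (f, g, h, z)) + \<epsilon>1 * ip l h (string_force e2 (f, g, h, z)))
      + (- prim l (prim l V) l * e3) + \<epsilon>2 * (- prim l (prim l W) l * e3) + prim l Z l * e4 + \<epsilon>1 * (prim l P l * e4)
      - b1 * ip l V V - b2 * ip l Z Z + \<epsilon>2 * ip l g g - (\<epsilon>2 * a1) * ip l W W + \<epsilon>1 * ip l z z - (\<epsilon>1 * a2) * ip l P P"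
    unfolding dissipation_def prod.case W_def V_def P_def Z_def by (simp add: algebra_simps)
  also have "\<dots> \<le> (\<epsilon>2 + \<Lambda>1) * ip l g g + (\<Lambda>6 - b1) * ip l V V + (\<Lambda>2 - \<epsilon>2 * a1) * ip l W W
      + (\<epsilon>1 + \<Lambda>3) * ip l z z + (\<Lambda>5 - b2) * ip l Z Z + (\<Lambda>4 - \<epsilon>1 * a2) * ip l P P
      + (i 7 / 2 + \<epsilon>2 * (i 8 / 2)) * ip l e1 e1 + (i 9 / 2 + \<epsilon>1 * (i 10 / 2)) * ip l e2 e2
      + i 13 * e3\<^sup>2 + i 14 * e4\<^sup>2"
    using S kf kh E3 E3' E4 E4' C1 C2 C3 C4 C5 C6 I
    unfolding distrib_right left_diff_distrib mult.assoc[symmetric] by linarith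
  finally show ?thesis by (simp add: i_def)
qed


section \<open>Equivalence with the energy, and coercivity\<close>

text \<open>Young with weight \<open>sqrt a1\<close>, followed by Poincare, bounds the coupling term
  <w, w_t> by half of \<open>K\<close> times the beam energy: \<open>l^4 / (4 * sqrt a1)\<close> is
  the factor at w_yy and \<open>1 / sqrt a1\<close> the one at w_t. The string gives the other two
  lower bounds on \<open>K\<close>.\<close>

lemma lyapunov_bounds:
  assumes pos: "l > 0" "a1 > 0" "a2 > 0" "b1 > 0" "b2 > 0"
    and K: "K \<ge> 1 / sqrt a1" "K \<ge> 1 / sqrt a2" "K \<ge> l\<^sup>2 / (2 * sqrt a2)" "K \<ge> l^4 / (4 * sqrt a1)"
    and \<epsilon>: "\<epsilon>1 > 0" "\<epsilon>2 > 0" "\<epsilon>1 * K < 1" "\<epsilon>2 * K < 1"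
  obtains lo hi where "lo > 0" "hi > 0"
    "\<And>x. x \<in> state_space \<Longrightarrow> lo * (state_norm x)\<^sup>2 \<le> lyapunov \<epsilon>1 \<epsilon>2 x"
    "\<And>x. x \<in> state_space \<Longrightarrow> lyapunov \<epsilon>1 \<epsilon>2 x \<le> hi * (state_norm x)\<^sup>2"
proof -
  define m where "m = max (\<epsilon>1 * K) (\<epsilon>2 * K)"
  define lo where "lo = (1 - m) / 2"
  define hi where "hi = (1 + m) / 2 + \<epsilon>2 * b1 / (2 * a1) + \<epsilon>1 * b2 / (2 * a2)"
  have m: "m < 1" "\<epsilon>1 * K \<le> m" "\<epsilon>2 * K \<le> m" using \<epsilon> by (auto simp: m_def)
  have "0 < 1 / sqrt a1" using pos by simp
  then have "K > 0" using K(1) by linarith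
  then have "m > 0" using m(2) \<epsilon>(1) mult_pos_pos[of \<epsilon>1 K] by linarith
  have "lo > 0" using m by (simp add: lo_def)
  moreover have "hi > 0"
    unfolding hi_def using \<open>m > 0\<close> pos \<epsilon> by (intro add_pos_pos divide_pos_pos mult_pos_pos) auto
  moreover have "lo * (state_norm x)\<^sup>2 \<le> lyapunov \<epsilon>1 \<epsilon>2 x \<and> lyapunov \<epsilon>1 \<epsilon>2 x \<le> hi * (state_norm x)\<^sup>2"
    if "x \<in> state_space" for x
  proof -
    obtain f g h z where x: "x = (f, g, h, z)" by (metis prod_cases4)
    define W where "W = wD l (wD l f)"
    define P where "P = wD l h"
    note ss = state_spaceD[OF pos(1) that[unfolded x], folded W_def P_def]
    have L: "f \<in> L2 l" "h \<in> L2 l" using ss by (auto simp: prim_rep_def prim2_rep_def)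
    have N: "(state_norm x)\<^sup>2 = a1 * ip l W W + ip l g g + a2 * ip l P P + ip l z z"
      unfolding x using pos by (intro state_norm_rep_sq ss) auto
    have nn: "0 \<le> ip l u u" for u by (rule ip_self_nonneg)
    have s: "sqrt a1 > 0" "sqrt a2 > 0" "a1 = sqrt a1 * sqrt a1" "a2 = sqrt a2 * sqrt a2" using pos by auto
    have fg: "\<bar>ip l f g\<bar> \<le> K / 2 * (a1 * ip l W W + ip l g g)"
    proof -
      have "\<bar>ip l f g\<bar> \<le> sqrt a1 / 2 * ip l f f + ip l g g / (2 * sqrt a1)"
        by (rule ip_young[OF L(1) ss(2) s(1)])
      also have "\<dots> \<le> sqrt a1 / 2 * (l^4 / 4 * ip l W W) + (1 / sqrt a1) / 2 * ip l g g"
        by (intro add_mono mult_left_mono prim2_rep_ip_le[OF pos(1) ss(1)]) (use s in simp_all)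
      also have "sqrt a1 / 2 * (l^4 / 4 * ip l W W) = (l^4 / (4 * sqrt a1)) / 2 * (a1 * ip l W W)"
        using s by (simp add: field_simps)
      also have "(l^4 / (4 * sqrt a1)) / 2 * (a1 * ip l W W) \<le> K / 2 * (a1 * ip l W W)"
        using K pos nn by (intro mult_right_mono divide_right_mono) auto
      also have "(1 / sqrt a1) / 2 * ip l g g \<le> K / 2 * ip l g g"
        using K nn by (intro mult_right_mono divide_right_mono) auto
      finally show ?thesis by (simp add: distrib_left)
    qed
    have hz: "\<bar>ip l h z\<bar> \<le> K / 2 * (a2 * ip l P P + ip l z z)"
    proof -
      have "\<bar>ip l h z\<bar> \<le> sqrt a2 / 2 * ip l h h + ip l z z / (2 * sqrt a2)"
        by (rule ip_young[OF L(2) ss(4) s(2)])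
      also have "\<dots> \<le> sqrt a2 / 2 * (l\<^sup>2 / 2 * ip l P P) + (1 / sqrt a2) / 2 * ip l z z"
        by (intro add_mono mult_left_mono prim_rep_ip_le[OF pos(1) ss(3)]) (use s in simp_all)
      also have "sqrt a2 / 2 * (l\<^sup>2 / 2 * ip l P P) = (l\<^sup>2 / (2 * sqrt a2)) / 2 * (a2 * ip l P P)"
        using s by (simp add: field_simps)
      also have "(l\<^sup>2 / (2 * sqrt a2)) / 2 * (a2 * ip l P P) \<le> K / 2 * (a2 * ip l P P)"
        using K pos nn by (intro mult_right_mono divide_right_mono) auto
      also have "(1 / sqrt a2) / 2 * ip l z z \<le> K / 2 * ip l z z"
        using K nn by (intro mult_right_mono divide_right_mono) auto
      finally show ?thesis by (simp add: distrib_left)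
    qed
    have fg': "\<bar>\<epsilon>2 * ip l f g\<bar> \<le> m / 2 * (a1 * ip l W W + ip l g g)"
    proof -
      have "\<bar>\<epsilon>2 * ip l f g\<bar> \<le> \<epsilon>2 * (K / 2 * (a1 * ip l W W + ip l g g))"
        using fg \<epsilon> by (simp add: abs_mult)
      also have "\<dots> = (\<epsilon>2 * K) / 2 * (a1 * ip l W W + ip l g g)" by simp
      also have "\<dots> \<le> m / 2 * (a1 * ip l W W + ip l g g)"
        using m pos nn by (intro mult_right_mono divide_right_mono) auto
      finally show ?thesis .
    qed
    have hz': "\<bar>\<epsilon>1 * ip l h z\<bar> \<le> m / 2 * (a2 * ip l P P + ip l z z)"
    proof -
      have "\<bar>\<epsilon>1 * ip l h z\<bar> \<le> \<epsilon>1 * (K / 2 * (a2 * ip l P P + ip l z z))"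
        using hz \<epsilon> by (simp add: abs_mult)
      also have "\<dots> = (\<epsilon>1 * K) / 2 * (a2 * ip l P P + ip l z z)" by simp
      also have "\<dots> \<le> m / 2 * (a2 * ip l P P + ip l z z)"
        using m pos nn by (intro mult_right_mono divide_right_mono) auto
      finally show ?thesis .
    qed
    have B: "0 \<le> \<epsilon>2 * (b1 / 2 * ip l W W)" "0 \<le> \<epsilon>1 * (b2 / 2 * ip l P P)"
      using \<epsilon> pos nn by auto
    have "a1 * ip l W W \<le> (state_norm x)\<^sup>2" "a2 * ip l P P \<le> (state_norm x)\<^sup>2"
      unfolding N using nn[of W] nn[of P] nn[of g] nn[of z] pos by auto
    then have B': "\<epsilon>2 * (b1 / 2 * ip l W W) \<le> \<epsilon>2 * b1 / (2 * a1) * (state_norm x)\<^sup>2"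
      "\<epsilon>1 * (b2 / 2 * ip l P P) \<le> \<epsilon>1 * b2 / (2 * a2) * (state_norm x)\<^sup>2"
      using mult_left_mono[of "a1 * ip l W W" "(state_norm x)\<^sup>2" "\<epsilon>2 * b1 / (2 * a1)"]
        mult_left_mono[of "a2 * ip l P P" "(state_norm x)\<^sup>2" "\<epsilon>1 * b2 / (2 * a2)"] pos \<epsilon> by auto
    have V: "lyapunov \<epsilon>1 \<epsilon>2 x = (state_norm x)\<^sup>2 / 2 + \<epsilon>2 * ip l f g + \<epsilon>2 * (b1 / 2 * ip l W W)
        + \<epsilon>1 * ip l h z + \<epsilon>1 * (b2 / 2 * ip l P P)"
      unfolding N by (simp add: x lyapunov_def W_def P_def distrib_left)
    have cross: "\<bar>\<epsilon>2 * ip l f g + \<epsilon>1 * ip l h z\<bar> \<le> m / 2 * (state_norm x)\<^sup>2"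
    proof -
      have "m / 2 * (state_norm x)\<^sup>2 = m / 2 * (a1 * ip l W W + ip l g g) + m / 2 * (a2 * ip l P P + ip l z z)"
        by (simp add: N distrib_left)
      then show ?thesis using fg' hz' by linarith
    qed
    have "lo * (state_norm x)\<^sup>2 = (state_norm x)\<^sup>2 / 2 - m / 2 * (state_norm x)\<^sup>2"
      by (simp add: lo_def algebra_simps diff_divide_distrib)
    moreover have "hi * (state_norm x)\<^sup>2 = (state_norm x)\<^sup>2 / 2 + m / 2 * (state_norm x)\<^sup>2
        + \<epsilon>2 * b1 / (2 * a1) * (state_norm x)\<^sup>2 + \<epsilon>1 * b2 / (2 * a2) * (state_norm x)\<^sup>2"
      by (simp add: hi_def algebra_simps add_divide_distrib)
    ultimately show ?thesis unfolding V using cross B B' by linarith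
  qed
  ultimately show ?thesis using that by blast
qed

text \<open>Poincare's inequality turns the damping terms \<open>w\<^sub>t\<^sub>y\<^sub>y\<close> and \<open>\<phi>\<^sub>t\<^sub>y\<close> into decay of the velocities.\<close>

lemma quadratic_form_coercive:
  assumes pos: "l > 0" "a1 > 0" "a2 > 0"
    and \<alpha>: "\<alpha>1 > 0" "\<alpha>3 > 0" and neg: "\<alpha>1 + 4 / l^4 * \<alpha>6 < 0" "\<alpha>2 < 0" "\<alpha>3 + 2 / l\<^sup>2 * \<alpha>5 < 0" "\<alpha>4 < 0"
  obtains k where "k > 0"
    "\<And>f g h z. (f, g, h, z) \<in> dom_A \<Longrightarrow>
      \<alpha>1 * ip l g g + \<alpha>6 * ip l (wD l (wD l g)) (wD l (wD l g)) + \<alpha>2 * ip l (wD l (wD l f)) (wD l (wD l f))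
      + \<alpha>3 * ip l z z + \<alpha>5 * ip l (wD l z) (wD l z) + \<alpha>4 * ip l (wD l h) (wD l h) \<le> - k * (state_norm (f, g, h, z))\<^sup>2"
proof -
  define \<sigma>1 where "\<sigma>1 = - (\<alpha>1 + 4 / l^4 * \<alpha>6)"
  define \<sigma>3 where "\<sigma>3 = - (\<alpha>3 + 2 / l\<^sup>2 * \<alpha>5)"
  \<comment> \<open>The state norm weights w_yy and phi_y by \<open>a1\<close> and
    \<open>a2\<close>, hence the two quotients.\<close>
  define k where "k = min (min \<sigma>1 (- \<alpha>2 / a1)) (min \<sigma>3 (- \<alpha>4 / a2))"
  have \<sigma>: "\<sigma>1 > 0" "\<sigma>3 > 0" using neg by (auto simp: \<sigma>1_def \<sigma>3_def)
  have "k > 0" using \<sigma> neg pos by (simp add: k_def divide_neg_pos)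
  have kk: "k \<le> \<sigma>1" "k \<le> - \<alpha>2 / a1" "k \<le> \<sigma>3" "k \<le> - \<alpha>4 / a2"
    unfolding k_def by auto
  then have kk': "k * a1 \<le> - \<alpha>2" "k * a2 \<le> - \<alpha>4"
    using pos by (simp_all only: pos_le_divide_eq)
  have lp: "0 < 4 / l^4" "0 < 2 / l\<^sup>2" using pos by auto
  \<comment> \<open>As \<open>\<alpha>1\<close> and \<open>\<alpha>3\<close> are positive, the
    hypotheses force the damping coefficients to be negative, and multiplying Poincare by them gives
    the upper bounds wanted.\<close>
  have "4 / l^4 * \<alpha>6 < 0" "2 / l\<^sup>2 * \<alpha>5 < 0" using neg \<alpha> by linarith+
  then have "\<alpha>6 < 0" "\<alpha>5 < 0" using lp by (simp_all add: mult_less_0_iff divide_less_0_iff zero_less_mult_iff not_less)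
  have "\<alpha>1 * ip l g g + \<alpha>6 * ip l (wD l (wD l g)) (wD l (wD l g)) + \<alpha>2 * ip l (wD l (wD l f)) (wD l (wD l f))
      + \<alpha>3 * ip l z z + \<alpha>5 * ip l (wD l z) (wD l z) + \<alpha>4 * ip l (wD l h) (wD l h) \<le> - k * (state_norm (f, g, h, z))\<^sup>2"
    if dom: "(f, g, h, z) \<in> dom_A" for f g h z
  proof -
    define W where "W = wD l (wD l f)"
    define V where "V = wD l (wD l g)"
    define P where "P = wD l h"
    define Z where "Z = wD l z"
    note ds = dom_AD[OF pos(1) dom, folded W_def P_def V_def Z_def]
    note ss = state_spaceD[OF pos(1) ds(1), folded W_def P_def]
    have N: "(state_norm (f, g, h, z))\<^sup>2 = a1 * ip l W W + ip l g g + a2 * ip l P P + ip l z z"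
      using pos by (intro state_norm_rep_sq ss) auto
    have nn: "0 \<le> ip l u u" for u by (rule ip_self_nonneg)
    have g: "4 / l^4 * ip l g g \<le> ip l V V"
      using prim2_rep_ip_le[OF pos(1) ds(2)] pos by (simp add: field_simps)
    have z: "2 / l\<^sup>2 * ip l z z \<le> ip l Z Z"
      using prim_rep_ip_le[OF pos(1) ds(3)] pos by (simp add: field_simps)
    have "\<alpha>6 * ip l V V \<le> \<alpha>6 * (4 / l^4 * ip l g g)" "\<alpha>5 * ip l Z Z \<le> \<alpha>5 * (2 / l\<^sup>2 * ip l z z)"
      using g z \<open>\<alpha>6 < 0\<close> \<open>\<alpha>5 < 0\<close> by (intro mult_left_mono_neg; simp)+
    moreover have "k * ip l g g \<le> \<sigma>1 * ip l g g" "k * ip l z z \<le> \<sigma>3 * ip l z z"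
      "k * a1 * ip l W W \<le> - \<alpha>2 * ip l W W" "k * a2 * ip l P P \<le> - \<alpha>4 * ip l P P"
      by (intro mult_right_mono kk kk' nn)+
    ultimately show ?thesis
      unfolding N W_def[symmetric] V_def[symmetric] P_def[symmetric] Z_def[symmetric] \<sigma>1_def \<sigma>3_def
      by (simp add: algebra_simps)
  qed
  then show ?thesis using that \<open>k > 0\<close> by blast
qed

end

section \<open>Gronwall's lemma with two bounds on its kernel\<close>

lemma gronwall:
  fixes V D :: "real \<Rightarrow> real"
  assumes V: "\<And>t. t \<ge> 0 \<Longrightarrow> (V has_real_derivative V' t) (at t within {0..})"
    and le: "\<And>t. t \<ge> 0 \<Longrightarrow> V' t \<le> - \<mu> * V t + K * D t"
    and D: "continuous_on {0..} D" and t: "t \<ge> 0"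
  shows "V t \<le> exp (- \<mu> * t) * V 0 + K * integral {0..t} (\<lambda>s. exp (- \<mu> * (t - s)) * D s)"
proof -
  define g where "g s = exp (\<mu> * s) * D s" for s
  have g: "continuous_on {0..t} g"
    unfolding g_def by (intro continuous_intros continuous_on_subset[OF D]) auto
  \<comment> \<open>With the integrating factor exp(\<mu> s), the differential inequality says
    exactly that this function does not increase.\<close>
  define \<Phi> where "\<Phi> s = exp (\<mu> * s) * V s - K * integral {0..s} g" for s
  have d\<Phi>: "(\<Phi> has_real_derivative exp (\<mu> * s) * \<mu> * V s + exp (\<mu> * s) * V' s - K * g s) (at s within {0..t})"
    if s: "s \<in> {0..t}" for s
  proof -
    have "(V has_real_derivative V' s) (at s within {0..t})"
      using V[of s] s by (auto intro: DERIV_subset)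
    moreover have "((\<lambda>x. integral {0..x} g) has_real_derivative g s) (at s within {0..t})"
      by (rule integral_has_real_derivative[OF g s])
    ultimately show ?thesis
      unfolding \<Phi>_def by (auto intro!: derivative_eq_intros)
  qed
  have "\<Phi> t \<le> \<Phi> 0"
  proof (cases "t = 0")
    case False
    show ?thesis
    \<comment> \<open>At the endpoints only one-sided derivatives are at hand, so monotonicity comes
      from the open interval together with continuity on the closed one.\<close>
    proof (rule DERIV_nonpos_imp_decreasing_open[OF t])
      fix s assume s: "0 < s" "s < t"
      have 1: "(\<Phi> has_real_derivative exp (\<mu> * s) * \<mu> * V s + exp (\<mu> * s) * V' s - K * g s) (at s)"
        using d\<Phi>[of s] s by (simp add: at_within_interior[of s "{0..t}"])
      have 2: "exp (\<mu> * s) * \<mu> * V s + exp (\<mu> * s) * V' s - K * g s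
          = exp (\<mu> * s) * (V' s - (- \<mu> * V s + K * D s))"
        by (simp add: g_def algebra_simps)
      have "exp (\<mu> * s) * (V' s - (- \<mu> * V s + K * D s)) \<le> 0"
        using le[of s] s by (intro mult_nonneg_nonpos) auto
      with 1 show "\<exists>y. (\<Phi> has_real_derivative y) (at s) \<and> y \<le> 0"
        unfolding 2 by blast
    next
      show "continuous_on {0..t} \<Phi>"
        by (rule DERIV_continuous_on[OF d\<Phi>])
    qed
  qed simp
  then have "exp (\<mu> * t) * V t \<le> V 0 + K * integral {0..t} g" by (simp add: \<Phi>_def)
  then have h: "exp (- \<mu> * t) * (exp (\<mu> * t) * V t) \<le> exp (- \<mu> * t) * (V 0 + K * integral {0..t} g)"
    by (intro mult_left_mono) auto
  have V: "exp (- \<mu> * t) * (exp (\<mu> * t) * V t) = V t"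
    by (simp add: exp_minus)
  have I: "exp (- \<mu> * t) * integral {0..t} g = integral {0..t} (\<lambda>s. exp (- \<mu> * (t - s)) * D s)"
  proof -
    have "exp (- \<mu> * t) * integral {0..t} g = integral {0..t} (\<lambda>s. exp (- \<mu> * t) * g s)"
      by (rule integral_mult_right[symmetric])
    also have "(\<lambda>s. exp (- \<mu> * t) * g s) = (\<lambda>s. exp (- \<mu> * (t - s)) * D s)"
      by (auto simp: g_def algebra_simps simp flip: exp_add mult.assoc)
    finally show ?thesis .
  qed
  show ?thesis
    using h unfolding V distrib_left mult.left_commute[of _ K] I .
qed

text \<open>The kernel has total mass (1 - exp(- \<mu> t)) / \<mu>. The bound on \<open>D\<close> is
  assumed for positive \<open>t\<close> only: at t = 0 the value of \<open>Linf_norm\<close> is 0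
  and need not bound \<open>D 0\<close>, but the integral vanishes there.\<close>

lemma gronwall_sup:
  assumes D: "continuous_on {0..t} D" and \<mu>: "\<mu> > 0" and t: "t \<ge> (0::real)" and "m \<ge> 0"
    and le: "\<And>s. 0 < t \<Longrightarrow> s \<in> {0..t} \<Longrightarrow> D s \<le> m"
  shows "integral {0..t} (\<lambda>s. exp (- \<mu> * (t - s)) * D s) \<le> m / \<mu>"
proof (cases "t = 0")
  case False
  with t have "t > 0" by simp
  have 1: "((\<lambda>s. exp (- \<mu> * (t - s)) * m) has_integral (exp (- \<mu> * (t - t)) * m / \<mu> - exp (- \<mu> * (t - 0)) * m / \<mu>)) {0..t}"
    using t \<mu> by (intro fundamental_theorem_of_calculus)
      (auto intro!: derivative_eq_intros simp flip: has_real_derivative_iff_has_vector_derivative)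
  have 2: "((\<lambda>s. exp (- \<mu> * (t - s)) * D s) has_integral integral {0..t} (\<lambda>s. exp (- \<mu> * (t - s)) * D s)) {0..t}"
    by (intro integrable_integral integrable_continuous_real continuous_intros D)
  have "integral {0..t} (\<lambda>s. exp (- \<mu> * (t - s)) * D s)
      \<le> exp (- \<mu> * (t - t)) * m / \<mu> - exp (- \<mu> * (t - 0)) * m / \<mu>"
    by (rule has_integral_le[OF 2 1], rule mult_left_mono[OF le[OF \<open>t > 0\<close>]]) simp_all
  also have "\<dots> \<le> m / \<mu>" using \<open>m \<ge> 0\<close> \<mu> by simp
  finally show ?thesis .
qed (use assms in simp)

text \<open>The kernel is at most 1 on the interval of integration.\<close>

lemma gronwall_integral:
  assumes D: "continuous_on {0..t} D" and \<mu>: "\<mu> > 0" and D0: "\<And>s. s \<in> {0..t} \<Longrightarrow> D s \<ge> (0::real)"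
  shows "integral {0..t} (\<lambda>s. exp (- \<mu> * (t - s)) * D s) \<le> integral {0..t} D"
proof (rule integral_le)
  show "(\<lambda>s. exp (- \<mu> * (t - s)) * D s) integrable_on {0..t}"
    by (intro integrable_continuous_real continuous_intros D)
  show "D integrable_on {0..t}" by (intro integrable_continuous_real D)
  show "exp (- \<mu> * (t - s)) * D s \<le> D s" if "s \<in> {0..t}" for s
    using that \<mu> D0[OF that] by (intro mult_left_le_one_le) auto
qed

section \<open>Norms of disturbances and comparison functions\<close>

text \<open>For a continuous function an essential bound on (0, t) holds at every point of the
  closed interval. Positivity of \<open>t\<close> keeps the open interval from being null.\<close>

lemma abs_le_Linf_norm:
  assumes d: "continuous_on {0..} d" and t: "t > 0" and s: "s \<in> {0..t}"
  shows "\<bar>d s\<bar> \<le> Linf_norm t d"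
proof -
  let ?M = "lebesgue_on {0<..<t}"
  have dt: "continuous_on {0..t} d" by (rule continuous_on_subset[OF d]) auto
  have meas: "(\<lambda>s. ennreal \<bar>d s\<bar>) \<in> borel_measurable ?M"
  proof -
    have "continuous_on {0<..<t} d" by (rule continuous_on_subset[OF d]) auto
    then have "d \<in> borel_measurable ?M" by (rule continuous_imp_measurable_on_sets_lebesgue) simp
    then show ?thesis by simp
  qed
  obtain B where B: "\<And>s. s \<in> {0..t} \<Longrightarrow> \<bar>d s\<bar> \<le> B"
    using compact_imp_bounded[OF compact_continuous_image[OF dt compact_Icc]] bounded_iff
    by (metis imageI real_norm_def)
  \<comment> \<open>Boundedness on the compact interval rules out an infinite essential supremum,
    which \<open>enn2real\<close> would send to 0.\<close>
  have "esssup ?M (\<lambda>s. ennreal \<bar>d s\<bar>) \<le> ennreal B"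
    by (rule esssup_I[OF meas], rule AE_I2) (auto intro!: ennreal_leI B)
  then have fin: "esssup ?M (\<lambda>s. ennreal \<bar>d s\<bar>) < \<infinity>"
    using ennreal_less_top le_less_trans by (metis infinity_ennreal_def)
  have ae: "AE s in ?M. \<bar>d s\<bar> \<le> Linf_norm t d"
    using esssup_AE[of "\<lambda>s. ennreal \<bar>d s\<bar>" ?M]
  proof (rule eventually_mono)
    fix s assume "ennreal \<bar>d s\<bar> \<le> esssup ?M (\<lambda>s. ennreal \<bar>d s\<bar>)"
    then show "\<bar>d s\<bar> \<le> Linf_norm t d"
      unfolding Linf_norm_def using fin enn2real_mono[of "ennreal \<bar>d s\<bar>"] by simp
  qed
  \<comment> \<open>An inequality almost everywhere becomes an equality of continuous functions by
    taking the maximum, so that the uniqueness lemma applies.\<close>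
  have "max \<bar>d s\<bar> (Linf_norm t d) = Linf_norm t d"
  proof (rule ae_eq_continuous_eq[OF t _ _ _ s])
    show "ae_eq t (\<lambda>s. max \<bar>d s\<bar> (Linf_norm t d)) (\<lambda>s. Linf_norm t d)"
      unfolding ae_eq_def interval_measure_def using ae by (rule eventually_mono) simp
    show "continuous_on {0..t} (\<lambda>s. max \<bar>d s\<bar> (Linf_norm t d))"
      by (intro continuous_intros dt)
  qed simp
  then show ?thesis by (simp add: max_def split: if_splits)
qed

lemma Linf_norm_nonneg: "0 \<le> Linf_norm t d"
  by (simp add: Linf_norm_def)

lemma C0_into_L2_norm_continuous:
  assumes "C0_into (L2_norm l) (L2 l) d"
  shows "continuous_on {0..} (\<lambda>s. L2_norm l (d s))"
  unfolding continuous_on_def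
proof
  fix t :: real assume "t \<in> {0..}"
  then show "((\<lambda>s. L2_norm l (d s)) \<longlongrightarrow> L2_norm l (d t)) (at t within {0..})"
    using assms by (intro L2_norm_tendsto) (auto simp: C0_into_def fun_diff_def)
qed

lemma C2_real_continuous: "C2_real d \<Longrightarrow> continuous_on {0..} d"
  unfolding C2_real_def by (metis DERIV_continuous_on atLeast_iff)

lemma class_K_inf_linear: "C > 0 \<Longrightarrow> (\<lambda>s. C * s) \<in> class_K_inf"
  unfolding class_K_inf_def class_K_def
  by (auto intro!: continuous_intros filterlim_tendsto_pos_mult_at_top[OF tendsto_const _ filterlim_ident]
      simp: strict_mono_on_def)

lemma class_K_inf_sqrt: "C > 0 \<Longrightarrow> (\<lambda>s. C * sqrt s) \<in> class_K_inf"
  unfolding class_K_inf_def class_K_def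
  by (auto intro!: continuous_intros filterlim_tendsto_pos_mult_at_top[OF tendsto_const _ sqrt_at_top]
      simp: strict_mono_on_def)

lemma class_K_square: "(\<lambda>s. s\<^sup>2) \<in> class_K"
  unfolding class_K_def by (auto intro!: continuous_intros power_strict_mono simp: strict_mono_on_def)

lemma class_K_inf_imp_class_K: "\<gamma> \<in> class_K_inf \<Longrightarrow> \<gamma> \<in> class_K"
  by (simp add: class_K_inf_def)

text \<open>Passes from a bound on squares to a bound on norms: a sum of squares of nonnegative
  numbers is at most the square of their sum.\<close>

lemma le_sqrt_mult_sum:
  fixes N :: real
  assumes "N\<^sup>2 \<le> Q * (a\<^sup>2 + b\<^sup>2 + c\<^sup>2 + d\<^sup>2 + e\<^sup>2)" "Q \<ge> 0"
    and nn: "0 \<le> a" "0 \<le> b" "0 \<le> c" "0 \<le> d" "0 \<le> e"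
  shows "N \<le> sqrt Q * (a + b + c + d + e)"
proof (rule power2_le_imp_le)
  have "a\<^sup>2 + b\<^sup>2 \<le> (a + b)\<^sup>2" "(a + b)\<^sup>2 + c\<^sup>2 \<le> (a + b + c)\<^sup>2"
      "(a + b + c)\<^sup>2 + d\<^sup>2 \<le> (a + b + c + d)\<^sup>2" "(a + b + c + d)\<^sup>2 + e\<^sup>2 \<le> (a + b + c + d + e)\<^sup>2"
    using nn by (simp_all add: power2_sum)
  then have "a\<^sup>2 + b\<^sup>2 + c\<^sup>2 + d\<^sup>2 + e\<^sup>2 \<le> (a + b + c + d + e)\<^sup>2" by linarith
  then have "Q * (a\<^sup>2 + b\<^sup>2 + c\<^sup>2 + d\<^sup>2 + e\<^sup>2) \<le> Q * (a + b + c + d + e)\<^sup>2"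
    using assms(2) by (rule mult_left_mono)
  then show "N\<^sup>2 \<le> (sqrt Q * (a + b + c + d + e))\<^sup>2"
    using assms(1,2) by (simp add: power_mult_distrib)
qed (use assms in simp)

lemma lebesgue_integral_eq_integral_continuous:
  fixes f :: "real \<Rightarrow> real"
  assumes "continuous_on {0..t} f"
  shows "(LINT s|lebesgue_on {0..t}. f s) = integral {0..t} f"
  by (intro lebesgue_integral_eq_integral continuous_imp_integrable_real assms) simp

section \<open>From dissipation to the two stability estimates\<close>

context beam_string
begin

text \<open>A solution attains its initial datum only in the sense of \<open>state_eq\<close>, so
  the norm has to be shown independent of representatives.\<close>

lemma state_norm_cong:
  assumes "l > 0" "x \<in> state_space" "y \<in> state_space" "state_eq x y"
  shows "state_norm x = state_norm y"
proof -
  obtain f g h z f' g' h' z' where x: "x = (f, g, h, z)" and y: "y = (f', g', h', z')"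
    by (metis prod_cases4)
  note sx = state_spaceD[OF assms(1) assms(2)[unfolded x]] and sy = state_spaceD[OF assms(1) assms(3)[unfolded y]]
  have ae: "ae_eq l f f'" "ae_eq l g g'" "ae_eq l h h'" "ae_eq l z z'"
    using assms(4) by (auto simp: state_eq_def x y)
  have L: "f' \<in> L2 l" "h' \<in> L2 l" using sy by (auto simp: prim_rep_def prim2_rep_def)
  show ?thesis
    unfolding x y state_norm_def prod.case
    using state_norm_rep[OF assms(1) sx] state_norm_rep[OF assms(1) prim2_rep_cong[OF sx(1) ae(1) L(1)] sy(2)
        prim_rep_cong[OF sx(3) ae(3) L(2)] sy(4)]
      ip_cong_AE[OF ae(2,2) sx(2,2) sy(2,2)] ip_cong_AE[OF ae(4,4) sx(4,4) sy(4,4)] by simp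
qed

text \<open>One application of Gronwall serves both estimates; they differ only in whether its
  integral is bounded by suprema or by the plain integral of the squared disturbances.\<close>

lemma solution_estimate:
  assumes pos: "l > 0" "a1 > 0" "a2 > 0" and c: "lo > 0" "hi > 0" "k > 0" "K \<ge> 0"
    and lower: "\<And>x. x \<in> state_space \<Longrightarrow> lo * (state_norm x)\<^sup>2 \<le> lyapunov \<epsilon>1 \<epsilon>2 x"
    and upper: "\<And>x. x \<in> state_space \<Longrightarrow> lyapunov \<epsilon>1 \<epsilon>2 x \<le> hi * (state_norm x)\<^sup>2"
    and diss: "\<And>x e1 e2 e3 e4. x \<in> dom_A \<Longrightarrow> e1 \<in> L2 l \<Longrightarrow> e2 \<in> L2 l \<Longrightarrow>
      dissipation \<epsilon>1 \<epsilon>2 e1 e2 e3 e4 x \<le> - k * (state_norm x)\<^sup>2 + K * (ip l e1 e1 + ip l e2 e2 + e3\<^sup>2 + e4\<^sup>2)"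
  obtains C \<mu> where "C > 0" "\<mu> > 0"
    "\<And>d1 d2 d3 d4 X0 X t. disturbances d1 d2 d3 d4 \<Longrightarrow> solution d1 d2 d3 d4 X0 X \<Longrightarrow> t \<ge> 0 \<Longrightarrow>
      state_norm (X t) \<le> C * exp (- (\<mu> / 4) * t) * state_norm X0
        + C * (Linf_norm t (\<lambda>s. L2_norm l (d1 s)) + Linf_norm t (\<lambda>s. L2_norm l (d2 s)))
        + C * (Linf_norm t d3 + Linf_norm t d4)"
    "\<And>d1 d2 d3 d4 X0 X t. disturbances d1 d2 d3 d4 \<Longrightarrow> solution d1 d2 d3 d4 X0 X \<Longrightarrow> t \<ge> 0 \<Longrightarrow>
      state_norm (X t) \<le> C * exp (- (\<mu> / 4) * t) * state_norm X0
        + C * sqrt (LINT s|lebesgue_on {0..t}. (L2_norm l (d1 s))\<^sup>2)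
        + C * sqrt (LINT s|lebesgue_on {0..t}. (L2_norm l (d2 s))\<^sup>2)
        + C * sqrt (LINT s|lebesgue_on {0..t}. (d3 s)\<^sup>2)
        + C * sqrt (LINT s|lebesgue_on {0..t}. (d4 s)\<^sup>2)"
proof -
  \<comment> \<open>Dissipation is measured by the squared norm; dividing by \<open>hi\<close>
    expresses it through the functional itself.\<close>
  define \<nu> where "\<nu> = k / hi"
  \<comment> \<open>One constant for three factors: \<open>hi / lo\<close> for the initial datum,
    \<open>K / (lo * \<nu>)\<close> for the suprema and \<open>K / lo\<close> for the
    integrals.\<close>
  define Q where "Q = hi / lo + K / (lo * \<nu>) + K / lo"
  have \<nu>: "\<nu> > 0" using c by (simp add: \<nu>_def)
  have Qp: "hi / lo > 0" "K / (lo * \<nu>) \<ge> 0" "K / lo \<ge> 0" using c \<nu> by auto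
  then have Q: "Q > 0" "hi / lo \<le> Q" "K / (lo * \<nu>) \<le> Q" "K / lo \<le> Q" by (auto simp: Q_def)
  {
    fix d1 d2 d3 d4 X0 X and t :: real
    assume d: "disturbances d1 d2 d3 d4" and sol: "solution d1 d2 d3 d4 X0 X" and t: "t \<ge> 0"
    have dL: "d1 s \<in> L2 l" "d2 s \<in> L2 l" if "s \<ge> 0" for s
      using d that by (auto simp: disturbances_def C1_into_def C0_into_def)
    have cont: "continuous_on {0..} (\<lambda>s. L2_norm l (d1 s))" "continuous_on {0..} (\<lambda>s. L2_norm l (d2 s))"
        "continuous_on {0..} d3" "continuous_on {0..} d4"
      using d by (auto simp: disturbances_def C1_into_def intro: C0_into_L2_norm_continuous C2_real_continuous)
    have Xdom: "X s \<in> dom_A" if "s \<ge> 0" for s using sol that by (auto simp: solution_def C0_into_def)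
    have Xss: "X s \<in> state_space" if "s \<ge> 0" for s
      using Xdom[OF that] dom_AD(1)[OF pos(1)] by (metis prod_cases4)
    have "X0 \<in> dom_A" "state_eq (X 0) X0" using sol by (auto simp: solution_def)
    then have N0: "state_norm (X 0) = state_norm X0"
      using dom_AD(1)[OF pos(1)] by (intro state_norm_cong pos Xss) (auto, metis prod_cases4)
    define D where "D s = (L2_norm l (d1 s))\<^sup>2 + (L2_norm l (d2 s))\<^sup>2 + (d3 s)\<^sup>2 + (d4 s)\<^sup>2" for s
    have contD: "continuous_on {0..} D" unfolding D_def by (intro continuous_intros cont)
    have contD': "continuous_on {0..t} D" by (rule continuous_on_subset[OF contD]) auto
    define I where "I = integral {0..t} (\<lambda>s. exp (- \<nu> * (t - s)) * D s)"
    have "lyapunov \<epsilon>1 \<epsilon>2 (X t) \<le> exp (- \<nu> * t) * lyapunov \<epsilon>1 \<epsilon>2 (X 0) + K * I"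
      unfolding I_def
    proof (rule gronwall[where V = "\<lambda>s. lyapunov \<epsilon>1 \<epsilon>2 (X s)", OF _ _ contD t])
      fix s :: real assume s: "s \<ge> 0"
      show "((\<lambda>s. lyapunov \<epsilon>1 \<epsilon>2 (X s)) has_real_derivative
          dissipation \<epsilon>1 \<epsilon>2 (d1 s) (d2 s) (d3 s) (d4 s) (X s)) (at s within {0..})"
        by (rule lyapunov_derivative[OF pos s sol dL[OF s]])
      have "\<nu> * lyapunov \<epsilon>1 \<epsilon>2 (X s) \<le> \<nu> * (hi * (state_norm (X s))\<^sup>2)"
        using \<nu> by (intro mult_left_mono upper Xss s) auto
      also have "\<dots> = k * (state_norm (X s))\<^sup>2" using c by (simp add: \<nu>_def)
      finally show "dissipation \<epsilon>1 \<epsilon>2 (d1 s) (d2 s) (d3 s) (d4 s) (X s)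
          \<le> - \<nu> * lyapunov \<epsilon>1 \<epsilon>2 (X s) + K * D s"
        using diss[OF Xdom[OF s] dL[OF s], of "d3 s" "d4 s"] by (simp add: D_def ip_self)
    qed
    also have "exp (- \<nu> * t) * lyapunov \<epsilon>1 \<epsilon>2 (X 0) \<le> exp (- \<nu> * t) * (hi * (state_norm X0)\<^sup>2)"
      using upper[OF Xss[of 0]] by (simp add: N0)
    finally have "lo * (state_norm (X t))\<^sup>2 \<le> exp (- \<nu> * t) * (hi * (state_norm X0)\<^sup>2) + K * I"
      using lower[OF Xss[OF t]] by simp
    then have main: "(state_norm (X t))\<^sup>2 \<le> hi / lo * (exp (- \<nu> * t) * (state_norm X0)\<^sup>2) + K / lo * I"
      using c by (simp add: field_simps)
    \<comment> \<open>Gronwall bounds the squared norm, so the root halves the rate.\<close>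
    have exp2: "(exp (- (\<nu> / 2) * t) * state_norm X0)\<^sup>2 = exp (- \<nu> * t) * (state_norm X0)\<^sup>2"
      by (simp add: power_mult_distrib flip: exp_double)
    have nn: "0 \<le> exp (- (\<nu> / 2) * t) * state_norm X0"
    proof -
      have "0 \<le> state_norm X0"
        using pos by (cases X0) (auto simp: state_norm_def intro!: integral_nonneg_AE AE_I2)
      then show ?thesis by simp
    qed
    have first: "hi / lo * (exp (- \<nu> * t) * (state_norm X0)\<^sup>2) \<le> Q * (exp (- (\<nu> / 2) * t) * state_norm X0)\<^sup>2"
      unfolding exp2 by (intro mult_right_mono Q) simp
    \<comment> \<open>Lists indexed by 0 to 3 merely give the four disturbance terms uniform
      names.\<close>
    define y where "y j = [Linf_norm t (\<lambda>s. L2_norm l (d1 s)), Linf_norm t (\<lambda>s. L2_norm l (d2 s)),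
      Linf_norm t d3, Linf_norm t d4] ! j" for j
    have y: "0 \<le> y 0" "0 \<le> y 1" "0 \<le> y 2" "0 \<le> y 3" by (simp_all add: y_def Linf_norm_nonneg)
    have "I \<le> ((y 0)\<^sup>2 + (y 1)\<^sup>2 + (y 2)\<^sup>2 + (y 3)\<^sup>2) / \<nu>"
      unfolding I_def
    proof (rule gronwall_sup[OF contD' \<nu> t])
      fix s assume s: "0 < t" "s \<in> {0..t}"
      have sq: "a\<^sup>2 \<le> b\<^sup>2" if "\<bar>a\<bar> \<le> b" for a b :: real using power_mono[OF that abs_ge_zero, of 2] by simp
      show "D s \<le> (y 0)\<^sup>2 + (y 1)\<^sup>2 + (y 2)\<^sup>2 + (y 3)\<^sup>2"
        unfolding D_def y_def using cont s
        by (intro add_mono sq) (auto intro!: abs_le_Linf_norm)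
    qed simp
    then have "K / lo * I \<le> K / lo * (((y 0)\<^sup>2 + (y 1)\<^sup>2 + (y 2)\<^sup>2 + (y 3)\<^sup>2) / \<nu>)"
      by (intro mult_left_mono Qp)
    also have "\<dots> = K / (lo * \<nu>) * ((y 0)\<^sup>2 + (y 1)\<^sup>2 + (y 2)\<^sup>2 + (y 3)\<^sup>2)" by simp
    also have "\<dots> \<le> Q * ((y 0)\<^sup>2 + (y 1)\<^sup>2 + (y 2)\<^sup>2 + (y 3)\<^sup>2)" by (intro mult_right_mono Q) simp
    finally have "(state_norm (X t))\<^sup>2 \<le> Q * ((exp (- (\<nu> / 2) * t) * state_norm X0)\<^sup>2 + (y 0)\<^sup>2 + (y 1)\<^sup>2 + (y 2)\<^sup>2 + (y 3)\<^sup>2)"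
      using main first by (simp add: distrib_left)
    from le_sqrt_mult_sum[OF this _ nn y] Q
    have A: "state_norm (X t) \<le> sqrt Q * exp (- (2 * \<nu> / 4) * t) * state_norm X0
        + sqrt Q * (Linf_norm t (\<lambda>s. L2_norm l (d1 s)) + Linf_norm t (\<lambda>s. L2_norm l (d2 s)))
        + sqrt Q * (Linf_norm t d3 + Linf_norm t d4)"
      by (simp add: y_def distrib_left mult.assoc)
    define u where "u j = [\<lambda>s. L2_norm l (d1 s), \<lambda>s. L2_norm l (d2 s), d3, d4] ! j" for j
    define x where "x j = sqrt (LINT s|lebesgue_on {0..t}. (u j s)\<^sup>2)" for j
    have x: "0 \<le> x j" for j by (simp add: x_def)
    have u: "continuous_on {0..t} (\<lambda>s. (u 0 s)\<^sup>2)" "continuous_on {0..t} (\<lambda>s. (u 1 s)\<^sup>2)"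
      "continuous_on {0..t} (\<lambda>s. (u 2 s)\<^sup>2)" "continuous_on {0..t} (\<lambda>s. (u 3 s)\<^sup>2)"
      using cont by (auto simp: u_def intro!: continuous_intros elim!: continuous_on_subset)
    have x2: "(x j)\<^sup>2 = integral {0..t} (\<lambda>s. (u j s)\<^sup>2)" if "continuous_on {0..t} (\<lambda>s. (u j s)\<^sup>2)" for j
      using that by (simp add: x_def lebesgue_integral_eq_integral_continuous[OF that, symmetric])
    have "I \<le> integral {0..t} D"
      unfolding I_def by (rule gronwall_integral[OF contD' \<nu>]) (simp add: D_def)
    also have "integral {0..t} D = integral {0..t} (\<lambda>s. (u 0 s)\<^sup>2 + (u 1 s)\<^sup>2 + (u 2 s)\<^sup>2 + (u 3 s)\<^sup>2)"
      by (simp add: D_def[abs_def] u_def)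
    also have "\<dots> = (x 0)\<^sup>2 + (x 1)\<^sup>2 + (x 2)\<^sup>2 + (x 3)\<^sup>2"
      unfolding x2[OF u(1)] x2[OF u(2)] x2[OF u(3)] x2[OF u(4)]
      by (intro integral_unique has_integral_add integrable_integral integrable_continuous_real u)
    finally have "K / lo * I \<le> K / lo * ((x 0)\<^sup>2 + (x 1)\<^sup>2 + (x 2)\<^sup>2 + (x 3)\<^sup>2)"
      by (intro mult_left_mono Qp)
    also have "\<dots> \<le> Q * ((x 0)\<^sup>2 + (x 1)\<^sup>2 + (x 2)\<^sup>2 + (x 3)\<^sup>2)" by (intro mult_right_mono Q) simp
    finally have "(state_norm (X t))\<^sup>2 \<le> Q * ((exp (- (\<nu> / 2) * t) * state_norm X0)\<^sup>2 + (x 0)\<^sup>2 + (x 1)\<^sup>2 + (x 2)\<^sup>2 + (x 3)\<^sup>2)"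
      using main first by (simp add: distrib_left)
    from le_sqrt_mult_sum[OF this _ nn x x x x] Q
    have B: "state_norm (X t) \<le> sqrt Q * exp (- (2 * \<nu> / 4) * t) * state_norm X0
        + sqrt Q * sqrt (LINT s|lebesgue_on {0..t}. (L2_norm l (d1 s))\<^sup>2)
        + sqrt Q * sqrt (LINT s|lebesgue_on {0..t}. (L2_norm l (d2 s))\<^sup>2)
        + sqrt Q * sqrt (LINT s|lebesgue_on {0..t}. (d3 s)\<^sup>2)
        + sqrt Q * sqrt (LINT s|lebesgue_on {0..t}. (d4 s)\<^sup>2)"
      by (simp add: x_def u_def distrib_left mult.assoc)
    note A B
  }
  note estimates = this
  \<comment> \<open>With \<mu> = 2 \<nu>, the exponent \<mu> / 4 is the halved rate \<nu> /
    2.\<close>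
  show ?thesis
    by (rule that[of "sqrt Q" "2 * \<nu>"]) (use Q \<nu> in simp, use \<nu> in simp, (rule estimates; assumption)+)
qed

text \<open>All comparison functions are the linear function with slope \<open>C\<close>.\<close>

lemma EISS_of_estimate:
  assumes "C > 0" "\<mu> > 0"
    "\<And>d1 d2 d3 d4 X0 X t. disturbances d1 d2 d3 d4 \<Longrightarrow> solution d1 d2 d3 d4 X0 X \<Longrightarrow> t \<ge> 0 \<Longrightarrow>
      state_norm (X t) \<le> C * exp (- (\<mu> / 4) * t) * state_norm X0
        + C * (Linf_norm t (\<lambda>s. L2_norm l (d1 s)) + Linf_norm t (\<lambda>s. L2_norm l (d2 s)))
        + C * (Linf_norm t d3 + Linf_norm t d4)"
  shows EISS
proof -
  note K = class_K_inf_linear[OF assms(1)] and K' = class_K_inf_imp_class_K[OF class_K_inf_linear[OF assms(1)]]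
  show ?thesis
    unfolding EISS_def
  proof (rule bexI[OF _ K], rule exI[of _ "\<mu> / 4"], intro conjI)
    show "\<mu> / 4 > 0" using assms by simp
    show "\<exists>\<gamma>1\<in>class_K. \<exists>\<gamma>2\<in>class_K. \<exists>\<gamma>3\<in>class_K. \<exists>\<gamma>4\<in>class_K.
     \<forall>d1 d2 d3 d4 X0 X. disturbances d1 d2 d3 d4 \<longrightarrow> solution d1 d2 d3 d4 X0 X \<longrightarrow>
     (\<forall>t\<ge>0. state_norm (X t) \<le> C * state_norm X0 * exp (- (\<mu> / 4) * t)
        + \<gamma>1 (Linf_norm t (\<lambda>s. L2_norm l (d1 s))) + \<gamma>2 (Linf_norm t (\<lambda>s. L2_norm l (d2 s)))
        + \<gamma>3 (Linf_norm t d3) + \<gamma>4 (Linf_norm t d4))"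
    proof (rule bexI[OF _ K'], rule bexI[OF _ K'], rule bexI[OF _ K'], rule bexI[OF _ K'], intro allI impI)
      fix d1 d2 d3 d4 X0 X and t :: real
      assume "disturbances d1 d2 d3 d4" "solution d1 d2 d3 d4 X0 X" "0 \<le> t"
      from assms(3)[OF this]
      show "state_norm (X t) \<le> C * state_norm X0 * exp (- (\<mu> / 4) * t)
        + C * Linf_norm t (\<lambda>s. L2_norm l (d1 s)) + C * Linf_norm t (\<lambda>s. L2_norm l (d2 s))
        + C * Linf_norm t d3 + C * Linf_norm t d4"
        by (simp add: algebra_simps)
    qed
  qed
qed

text \<open>The square root of an integral of squares is read as an outer function
  \<open>C * sqrt s\<close> of class K-infinity and an inner gain \<open>s^2\<close>, which takes
  the absolute value of a boundary disturbance to its square.\<close>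

lemma EiISS_of_estimate:
  assumes "C > 0" "\<mu> > 0"
    "\<And>d1 d2 d3 d4 X0 X t. disturbances d1 d2 d3 d4 \<Longrightarrow> solution d1 d2 d3 d4 X0 X \<Longrightarrow> t \<ge> 0 \<Longrightarrow>
      state_norm (X t) \<le> C * exp (- (\<mu> / 4) * t) * state_norm X0
        + C * sqrt (LINT s|lebesgue_on {0..t}. (L2_norm l (d1 s))\<^sup>2)
        + C * sqrt (LINT s|lebesgue_on {0..t}. (L2_norm l (d2 s))\<^sup>2)
        + C * sqrt (LINT s|lebesgue_on {0..t}. (d3 s)\<^sup>2)
        + C * sqrt (LINT s|lebesgue_on {0..t}. (d4 s)\<^sup>2)"
  shows EiISS
proof -
  note K = class_K_inf_linear[OF assms(1)] and R = class_K_inf_sqrt[OF assms(1)] and S = class_K_square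
  show ?thesis
    unfolding EiISS_def
  proof (rule bexI[OF _ K], rule exI[of _ "\<mu> / 4"], intro conjI)
    show "\<mu> / 4 > 0" using assms by simp
    show "\<exists>\<theta>1\<in>class_K_inf. \<exists>\<theta>2\<in>class_K_inf. \<exists>\<theta>3\<in>class_K_inf. \<exists>\<theta>4\<in>class_K_inf.
     \<exists>\<gamma>1\<in>class_K. \<exists>\<gamma>2\<in>class_K. \<exists>\<gamma>3\<in>class_K. \<exists>\<gamma>4\<in>class_K.
     \<forall>d1 d2 d3 d4 X0 X. disturbances d1 d2 d3 d4 \<longrightarrow> solution d1 d2 d3 d4 X0 X \<longrightarrow>
     (\<forall>t\<ge>0. state_norm (X t) \<le> C * state_norm X0 * exp (- (\<mu> / 4) * t)
        + \<theta>1 (LINT s|lebesgue_on {0..t}. \<gamma>1 (L2_norm l (d1 s)))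
        + \<theta>2 (LINT s|lebesgue_on {0..t}. \<gamma>2 (L2_norm l (d2 s)))
        + \<theta>3 (LINT s|lebesgue_on {0..t}. \<gamma>3 \<bar>d3 s\<bar>)
        + \<theta>4 (LINT s|lebesgue_on {0..t}. \<gamma>4 \<bar>d4 s\<bar>))"
    proof (rule bexI[OF _ R], rule bexI[OF _ R], rule bexI[OF _ R], rule bexI[OF _ R],
        rule bexI[OF _ S], rule bexI[OF _ S], rule bexI[OF _ S], rule bexI[OF _ S], intro allI impI)
      fix d1 d2 d3 d4 X0 X and t :: real
      assume "disturbances d1 d2 d3 d4" "solution d1 d2 d3 d4 X0 X" "0 \<le> t"
      from assms(3)[OF this]
      show "state_norm (X t) \<le> C * state_norm X0 * exp (- (\<mu> / 4) * t)
        + C * sqrt (LINT s|lebesgue_on {0..t}. (L2_norm l (d1 s))\<^sup>2)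
        + C * sqrt (LINT s|lebesgue_on {0..t}. (L2_norm l (d2 s))\<^sup>2)
        + C * sqrt (LINT s|lebesgue_on {0..t}. \<bar>d3 s\<bar>\<^sup>2)
        + C * sqrt (LINT s|lebesgue_on {0..t}. \<bar>d4 s\<bar>\<^sup>2)"
        by (simp add: mult_ac)
    qed
  qed
qed

end

theorem theorem3:
  fixes l a1 a2 b1 b2 c1 c2 p1 p2 q1 q2 \<epsilon>1 \<epsilon>2 K_m \<Lambda>1 \<Lambda>2 \<Lambda>3 \<Lambda>4 \<Lambda>5 \<Lambda>6 :: real
    and r :: "nat \<Rightarrow> real"
  assumes "l > 0" "a1 > 0" "a2 > 0" "b1 > 0" "b2 > 0"
    and "c1 \<ge> 0" "c2 \<ge> 0" "p1 \<ge> 0" "p2 \<le> 0" "q1 \<le> 0" "q2 \<ge> 0"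
    and K_m: "K_m = Max {1 / sqrt a1, 1 / sqrt a2, l^2 / (2 * sqrt a2), l^4 / (4 * sqrt a1)}"
    and r: "\<forall>i\<in>{1..14}. r i > 0"
    and \<epsilon>1: "0 < \<epsilon>1" "\<epsilon>1 < min 1 (1 / K_m)"
    and \<epsilon>2: "0 < \<epsilon>2" "\<epsilon>2 < min 1 (1 / K_m)"
    and \<Lambda>1: "\<Lambda>1 = 1/2 * (c1 * r 1 + p1 * r 2 - 2 * q1 + r 7 - \<epsilon>2 * q1 * r 5)
                   + q2 / 2 * (r 2 + \<epsilon>1 * r 1)"
    and \<Lambda>2: "\<Lambda>2 = \<epsilon>2 / (2 * r 12) + \<epsilon>2 * l^4 / 8 * (c1 * r 3 + p1 * r 4 - q1 / r 5 + r 8)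
                   + \<epsilon>2^2 * l^3 * r 13 / 2"
    and \<Lambda>3: "\<Lambda>3 = p1 / 2 * (1 / r 2 + \<epsilon>2 / r 4)
                   + 1/2 * (c2 * r 6 - 2 * p2 + q2 / r 2 + r 9 - \<epsilon>1 * p2 * r 6)"
    and \<Lambda>4: "\<Lambda>4 = \<epsilon>1 / (2 * r 11) + c1 * l^2 / 4 * (1 / r 1 + \<epsilon>2 / r 3)
                   + l^2 / 4 * (c2 / r 6 + 2 * \<epsilon>1 * c2 - \<epsilon>1 * p2 / r 6 + \<epsilon>1 * q2 / r 1 + \<epsilon>1 * r 10)
                   + l * r 14 * \<epsilon>1^2"
    and \<Lambda>5: "\<Lambda>5 = \<epsilon>1 / 2 * r 11 + l * r 14"
    and \<Lambda>6: "\<Lambda>6 = \<epsilon>2 / 2 * r 12 + l^3 * r 13 / 2"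
    and "\<epsilon>2 + \<Lambda>1 + 4 / l^4 * (\<Lambda>6 - b1) < 0"
    and "\<Lambda>2 - \<epsilon>2 * a1 < 0"
    and "\<epsilon>1 + \<Lambda>3 + 2 / l^2 * (\<Lambda>5 - b2) < 0"
    and "\<Lambda>4 - \<epsilon>1 * a2 < 0"
  shows "beam_string.EISS l a1 a2 b1 b2 c1 c2 p1 p2 q1 q2 \<and>
    beam_string.EiISS l a1 a2 b1 b2 c1 c2 p1 p2 q1 q2 \<and>
    (\<exists>C>0. \<exists>\<mu>\<^sub>m>0. \<forall>d1 d2 d3 d4 X0 X.
       beam_string.disturbances l d1 d2 d3 d4 \<longrightarrow>
       beam_string.solution l a1 a2 b1 b2 c1 c2 p1 p2 q1 q2 d1 d2 d3 d4 X0 X \<longrightarrow>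
       (\<forall>t\<ge>0.
         beam_string.state_norm l a1 a2 (X t)
           \<le> C * exp (- (\<mu>\<^sub>m / 4) * t) * beam_string.state_norm l a1 a2 X0
             + C * (Linf_norm t (\<lambda>s. L2_norm l (d1 s)) + Linf_norm t (\<lambda>s. L2_norm l (d2 s)))
             + C * (Linf_norm t d3 + Linf_norm t d4) \<and>
         beam_string.state_norm l a1 a2 (X t)
           \<le> C * exp (- (\<mu>\<^sub>m / 4) * t) * beam_string.state_norm l a1 a2 X0
             + C * sqrt (LINT s|lebesgue_on {0..t}. (L2_norm l (d1 s))\<^sup>2)
             + C * sqrt (LINT s|lebesgue_on {0..t}. (L2_norm l (d2 s))\<^sup>2)
             + C * sqrt (LINT s|lebesgue_on {0..t}. (d3 s)\<^sup>2)
             + C * sqrt (LINT s|lebesgue_on {0..t}. (d4 s)\<^sup>2)))"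
proof -
  have K: "1 / sqrt a1 \<le> K_m" "1 / sqrt a2 \<le> K_m" "l\<^sup>2 / (2 * sqrt a2) \<le> K_m" "l^4 / (4 * sqrt a1) \<le> K_m"
    unfolding K_m by (rule Max_ge; simp)+
  have "0 < 1 / sqrt a1" using assms(2) by simp
  then have "K_m > 0" using K(1) by linarith
  then have \<epsilon>K: "\<epsilon>1 * K_m < 1" "\<epsilon>2 * K_m < 1"
    using \<epsilon>1(2) \<epsilon>2(2) by (simp_all add: field_simps)
  have r: "r i > 0" if "i \<in> {1..14}" for i using r that by blast
  note pos = assms(1-5) and sg = assms(6-11)
  obtain lo hi where lohi: "lo > 0" "hi > 0"
    and lower: "\<And>x. x \<in> beam_string.state_space l \<Longrightarrow>
      lo * (beam_string.state_norm l a1 a2 x)\<^sup>2 \<le> beam_string.lyapunov l a1 a2 b1 b2 \<epsilon>1 \<epsilon>2 x"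
    and upper: "\<And>x. x \<in> beam_string.state_space l \<Longrightarrow>
      beam_string.lyapunov l a1 a2 b1 b2 \<epsilon>1 \<epsilon>2 x \<le> hi * (beam_string.state_norm l a1 a2 x)\<^sup>2"
    using beam_string.lyapunov_bounds[OF pos K \<epsilon>1(1) \<epsilon>2(1) \<epsilon>K] by blast
  \<comment> \<open>Coercivity asks for positive coefficients of the squared velocities. The signs
    of \<open>q1\<close> and \<open>p2\<close> enter here, through \<open>- q1\<close> and
    \<open>- p2\<close>.\<close>
  have \<Lambda>pos: "0 \<le> \<Lambda>1" "0 \<le> \<Lambda>3"
  proof -
    have nn: "0 \<le> r i" if "i \<in> {1..14}" for i using r[OF that] by simp
    have 1: "0 \<le> - q1 * r 5" "0 \<le> - p2 * r 6" using sg nn[of 5] nn[of 6] by (auto intro: mult_nonpos_nonneg)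
    have "0 \<le> 1/2 * (c1 * r 1 + p1 * r 2 + 2 * (- q1) + r 7 + \<epsilon>2 * (- q1 * r 5)) + q2 / 2 * (r 2 + \<epsilon>1 * r 1)"
      by (intro add_nonneg_nonneg mult_nonneg_nonneg) (use sg nn 1 \<epsilon>1 \<epsilon>2 in auto)
    then show "0 \<le> \<Lambda>1" by (simp add: \<Lambda>1 mult.assoc)
    have "0 \<le> p1 / 2 * (1 / r 2 + \<epsilon>2 / r 4) + 1/2 * (c2 * r 6 + 2 * (- p2) + q2 / r 2 + r 9 + \<epsilon>1 * (- p2 * r 6))"
      by (intro add_nonneg_nonneg mult_nonneg_nonneg divide_nonneg_nonneg) (use sg nn 1 \<epsilon>1 \<epsilon>2 in auto)
    then show "0 \<le> \<Lambda>3" by (simp add: \<Lambda>3 mult.assoc)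
  qed
  obtain k where k: "k > 0" and coercive: "\<And>f g h z. (f, g, h, z) \<in> beam_string.dom_A l a1 a2 b1 b2 \<Longrightarrow>
      (\<epsilon>2 + \<Lambda>1) * ip l g g + (\<Lambda>6 - b1) * ip l (wD l (wD l g)) (wD l (wD l g))
      + (\<Lambda>2 - \<epsilon>2 * a1) * ip l (wD l (wD l f)) (wD l (wD l f)) + (\<epsilon>1 + \<Lambda>3) * ip l z z
      + (\<Lambda>5 - b2) * ip l (wD l z) (wD l z) + (\<Lambda>4 - \<epsilon>1 * a2) * ip l (wD l h) (wD l h)
      \<le> - k * (beam_string.state_norm l a1 a2 (f, g, h, z))\<^sup>2"
    by (rule beam_string.quadratic_form_coercive[OF pos(1-3) add_pos_nonneg[OF \<epsilon>2(1) \<Lambda>pos(1)]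
        add_pos_nonneg[OF \<epsilon>1(1) \<Lambda>pos(2)] assms(24-27)]) blast
  define K1 where "K1 = 1 / r 7 / 2 + \<epsilon>2 * (1 / r 8 / 2)"
  define K2 where "K2 = 1 / r 9 / 2 + \<epsilon>1 * (1 / r 10 / 2)"
  have K12: "0 \<le> K1" "0 \<le> K2" "0 \<le> 1 / r 13" "0 \<le> 1 / r 14"
    unfolding K1_def K2_def using r[of 7] r[of 8] r[of 9] r[of 10] r[of 13] r[of 14] \<epsilon>1 \<epsilon>2 by auto
  \<comment> \<open>The sum of the four nonnegative gains dominates each of them, so one constant
    multiplies all disturbances.\<close>
  define K where "K = K1 + K2 + 1 / r 13 + 1 / r 14"
  have KK: "K1 \<le> K" "K2 \<le> K" "1 / r 13 \<le> K" "1 / r 14 \<le> K" "0 \<le> K" using K12 by (auto simp: K_def)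
  have diss: "beam_string.dissipation l a1 a2 b1 b2 c1 c2 p1 p2 q1 q2 \<epsilon>1 \<epsilon>2 e1 e2 e3 e4 x
      \<le> - k * (beam_string.state_norm l a1 a2 x)\<^sup>2 + K * (ip l e1 e1 + ip l e2 e2 + e3\<^sup>2 + e4\<^sup>2)"
    if dom: "x \<in> beam_string.dom_A l a1 a2 b1 b2" and e: "e1 \<in> L2 l" "e2 \<in> L2 l" for x e1 e2 e3 e4
  proof -
    obtain f g h z where x: "x = (f, g, h, z)" by (metis prod_cases4)
    have "K1 * ip l e1 e1 \<le> K * ip l e1 e1" "K2 * ip l e2 e2 \<le> K * ip l e2 e2"
      "1 / r 13 * e3\<^sup>2 \<le> K * e3\<^sup>2" "1 / r 14 * e4\<^sup>2 \<le> K * e4\<^sup>2"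
      by (intro mult_right_mono KK ip_self_nonneg zero_le_power2)+
    then show ?thesis
      using beam_string.dissipation_le[OF pos(1) sg \<epsilon>1(1) \<epsilon>2(1) r \<Lambda>1 \<Lambda>2 \<Lambda>3 \<Lambda>4 \<Lambda>5 \<Lambda>6 dom[unfolded x] e, of e3 e4]
        coercive[OF dom[unfolded x]] unfolding x K1_def[symmetric] K2_def[symmetric] distrib_left by linarith
  qed
  obtain C \<mu> where C: "C > 0" "\<mu> > 0"
    and A: "\<And>d1 d2 d3 d4 X0 X t. beam_string.disturbances l d1 d2 d3 d4 \<Longrightarrow>
      beam_string.solution l a1 a2 b1 b2 c1 c2 p1 p2 q1 q2 d1 d2 d3 d4 X0 X \<Longrightarrow> t \<ge> 0 \<Longrightarrow>
      beam_string.state_norm l a1 a2 (X t) \<le> C * exp (- (\<mu> / 4) * t) * beam_string.state_norm l a1 a2 X0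
        + C * (Linf_norm t (\<lambda>s. L2_norm l (d1 s)) + Linf_norm t (\<lambda>s. L2_norm l (d2 s)))
        + C * (Linf_norm t d3 + Linf_norm t d4)"
    and B: "\<And>d1 d2 d3 d4 X0 X t. beam_string.disturbances l d1 d2 d3 d4 \<Longrightarrow>
      beam_string.solution l a1 a2 b1 b2 c1 c2 p1 p2 q1 q2 d1 d2 d3 d4 X0 X \<Longrightarrow> t \<ge> 0 \<Longrightarrow>
      beam_string.state_norm l a1 a2 (X t) \<le> C * exp (- (\<mu> / 4) * t) * beam_string.state_norm l a1 a2 X0
        + C * sqrt (LINT s|lebesgue_on {0..t}. (L2_norm l (d1 s))\<^sup>2)
        + C * sqrt (LINT s|lebesgue_on {0..t}. (L2_norm l (d2 s))\<^sup>2)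
        + C * sqrt (LINT s|lebesgue_on {0..t}. (d3 s)\<^sup>2)
        + C * sqrt (LINT s|lebesgue_on {0..t}. (d4 s)\<^sup>2)"
    by (rule beam_string.solution_estimate[OF pos(1-3) lohi k KK(5) lower upper diss]) blast+
  have "beam_string.EISS l a1 a2 b1 b2 c1 c2 p1 p2 q1 q2"
    by (rule beam_string.EISS_of_estimate[OF C], (rule A; assumption))
  moreover have "beam_string.EiISS l a1 a2 b1 b2 c1 c2 p1 p2 q1 q2"
    by (rule beam_string.EiISS_of_estimate[OF C], (rule B; assumption))
  ultimately show ?thesis
    apply (intro conjI)
      apply assumption+
    apply (rule exI[of _ C], rule conjI[OF C(1)], rule exI[of _ \<mu>], rule conjI[OF C(2)])
    apply (intro allI impI conjI)
     apply (rule A; assumption)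
    apply (rule B; assumption)
    done
qed

end
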